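(* For all integers $\Delta,k\ge 2$ and $c^*\ge\Delta+2$, and all $0<\eta'<1/2$, there exists $\eta_0>0$ such that whenever $0<\eta<\eta_0$ the following holds. Let $J$ be a finite linearly ordered set and let $H$ be a $J$-partite $k$-complex on $J$ (that is, with vertex set $J$ and parts of size one) such that the graph $H^{(2)}$ has maximum degree at most $\Delta$. Suppose that $\Gamma$ is a $J$-partite $k$-graph with vertex sets $\{V_j\}_{j\in J}$ whose weight function $\gamma$ is identically $1$ on $V_e$ for every $e\subseteq J$ with $e\notin H$, and that $\mathcal P$ is a density $k$-graph on $J$ such that for all $J$-partite $k$-complexes $F$ on at most $(\Delta+2)c^*$ vertices we have $$\Gamma(F)=(1\pm\eta)\frac{\gamma(\emptyset)}{p(\emptyset)}\mathcal P(F).$$ Then $\Gamma$ is an $(\eta',c^* )$-THC graph (with density graph $\mathcal P$).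
   Context: Write $x=a\pm b$ for $a-b\le x\le a+b$. A $k$-complex $H$ is a finite vertex set $V(H)$ together with a down-closed family of subsets (edges, including $\emptyset$), each of size at most $k$; $v(H)=|V(H)|$, and $H^{(\ell)}$ is the set of edges of size $\ell$ (so $H^{(2)}$ is a graph). A weighted hypergraph $\mathcal G$ on a vertex set $V$ is a function $g$ from the power set of $V$ to the nonnegative reals (lower-case letters denote weight functions: $\gamma$ for $\Gamma$, $p$ for $\mathcal P$). It is a $k$-graph if $g(e)=1$ whenever $|e|\ge k+1$. For a finite index set $J$, "$J$-partite" means that the vertex set comes with a partition into parts indexed by $J$; a set is crossing if it has at most one vertex in each part, and all edges of a $J$-partite complex are crossing. For $f\subseteq J$, $V_f$ is the collection of crossing $|f|$-sets with one vertex in each $V_j$, $j\in f$ (so $V_\emptyset=\{\emptyset\}$). For a $J$-partite complex $R$ and $J$-partite weighted hypergraph $\mathcal G$, $\mathcal G(R)=\mathbb E_\phi\big[\prod_{e\in R}g(\phi(e))\big]$, where $\phi$ is a uniformly random map sending each part of $R$ into the corresponding part of $\mathcal G$ (the product includes $e=\emptyset$ and singletons). A density $k$-graph $\mathcal P$ on $J$ is a $k$-graph with vertex set $J$ (one vertex per part), where $p(\emptyset)>0$ so that the formulas make sense; thus $\mathcal P(R)=\prod_{e\in R}p(\pi(e))$, where $\pi(e)\subseteq J$ is the set of indices of parts met by $e$. For $v\in V_i$, the link $\mathcal G_v$ is the weighted hypergraph on $\{V_j\}_{j\in J\setminus\{i\}}$ with weights $g_v(e)=g(e)\,g(e\cup\{v\})$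 for crossing $e$ ($e=\emptyset$ included). Similarly $\mathcal P_x$ is the link of $x\in J$ in $\mathcal P$. For $U\subseteq V_j$, $\|U\|_{\mathcal G}=\mathbb E_{v\in V_j}[\mathbf 1_{v\in U}\,g(v)]$ with $v$ uniform in $V_j$. Typically hereditary counting (THC), defined recursively: given a linearly ordered finite set $J$ and a density $k$-graph $\mathcal P$ on $J$, a $J$-partite $k$-graph $\Gamma$ is an $(\eta,c^* )$-THC graph (with density graph $\mathcal P$) if (1) for each $J$-partite $k$-complex $R$ with at most $4$ vertices in each part and at most $c^*$ vertices in total, $\Gamma(R)=(1\pm v(R)\eta)\frac{\gamma(\emptyset)}{p(\emptyset)}\mathcal P(R)$; and (2) if $|J|\ge2$ and $x$ is the first vertex of $J$, there is $V_x'\subseteq V_x$ with $\|V_x'\|_\Gamma\ge(1-\eta)\|V_x\|_\Gamma$ such that for each $v\in V_x'$ the graph $\Gamma_v$ is an $(\eta,c^* )$-THC graph on $J\setminus\{x\}$ with density graph $\mathcal P_x$.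
   Formalization: The formal theorem also assumes that the density graph P has p(e)=1 for every e⊆J with e∉H; without this the claim fails, e.g. H={∅}, γ≡1 and p slightly above 1 on all pairs with |J| large. *)

theory Defs
  imports "HOL-Probability.Probability"
begin

text \<open>
  A \<open>J\<close>-partite vertex set is a family \<open>V\<close> of pairwise disjoint sets \<open>V j\<close>, \<open>j \<in> J\<close>.  Deleting an
  index shrinks \<open>J\<close> and leaves \<open>V\<close> as it is; the values of \<open>V\<close> outside \<open>J\<close> are never used.
\<close>

definition crossing :: "'j set \<Rightarrow> ('j \<Rightarrow> 'v set) \<Rightarrow> 'v set \<Rightarrow> bool" where
  "crossing J V e \<longleftrightarrow> e \<subseteq> (\<Union>j\<in>J. V j) \<and> (\<forall>j\<in>J. card (e \<inter> V j) \<le> 1)"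

definition crossing_sets :: "('j \<Rightarrow> 'v set) \<Rightarrow> 'j set \<Rightarrow> 'v set set" where
  "crossing_sets V f = {e. e \<subseteq> (\<Union>j\<in>f. V j) \<and> (\<forall>j\<in>f. card (e \<inter> V j) = 1)}"

text \<open>
  The vertex set \<open>X\<close> is separate data: a vertex \<open>x\<close> need not give rise to an edge \<open>{x}\<close>.
\<close>

definition k_complex :: "nat \<Rightarrow> 'a set \<Rightarrow> 'a set set \<Rightarrow> bool" where
  "k_complex k X E \<longleftrightarrow>
     finite X \<and> {} \<in> E \<and> (\<forall>e\<in>E. e \<subseteq> X \<and> card e \<le> k) \<and> (\<forall>e\<in>E. \<forall>f. f \<subseteq> e \<longrightarrow> f \<in> E)"

text \<open>Parts of a complex may be empty.\<close>

definition partite_complex :: "nat \<Rightarrow> 'j set \<Rightarrow> ('j \<Rightarrow> 'a set) \<Rightarrow> 'a set set \<Rightarrow> bool" where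
  "partite_complex k J X E \<longleftrightarrow>
     disjoint_family_on X J \<and> k_complex k (\<Union>j\<in>J. X j) E \<and> (\<forall>e\<in>E. crossing J X e)"

definition num_vertices :: "'j set \<Rightarrow> ('j \<Rightarrow> 'a set) \<Rightarrow> nat" where
  "num_vertices J X = card (\<Union>j\<in>J. X j)"

definition level :: "nat \<Rightarrow> 'a set set \<Rightarrow> 'a set set" where
  "level l E = {e \<in> E. card e = l}"

definition max_degree_le :: "'a set \<Rightarrow> 'a set set \<Rightarrow> nat \<Rightarrow> bool" where
  "max_degree_le X E d \<longleftrightarrow> (\<forall>x\<in>X. card {e \<in> E. x \<in> e} \<le> d)"

definition weighted_hypergraph :: "'v set \<Rightarrow> ('v set \<Rightarrow> real) \<Rightarrow> bool" where
  "weighted_hypergraph W g \<longleftrightarrow> (\<forall>e. e \<subseteq> W \<longrightarrow> 0 \<le> g e)"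

definition k_graph :: "nat \<Rightarrow> 'v set \<Rightarrow> ('v set \<Rightarrow> real) \<Rightarrow> bool" where
  "k_graph k W g \<longleftrightarrow>
     weighted_hypergraph W g \<and> (\<forall>e. e \<subseteq> W \<and> k + 1 \<le> card e \<longrightarrow> g e = 1)"

text \<open>
  Parts of a partite \<open>k\<close>-graph are finite and nonempty, so that uniformly random vertices and maps exist.
\<close>

definition partite_k_graph :: "nat \<Rightarrow> 'j set \<Rightarrow> ('j \<Rightarrow> 'v set) \<Rightarrow> ('v set \<Rightarrow> real) \<Rightarrow> bool" where
  "partite_k_graph k J V g \<longleftrightarrow>
     disjoint_family_on V J \<and> (\<forall>j\<in>J. finite (V j) \<and> V j \<noteq> {}) \<and> k_graph k (\<Union>j\<in>J. V j) g"

definition density_k_graph :: "nat \<Rightarrow> 'j set \<Rightarrow> ('j set \<Rightarrow> real) \<Rightarrow> bool" where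
  "density_k_graph k J p \<longleftrightarrow> partite_k_graph k J (\<lambda>j. {j}) p \<and> 0 < p {}"

definition partite_maps :: "'j set \<Rightarrow> ('j \<Rightarrow> 'a set) \<Rightarrow> ('j \<Rightarrow> 'v set) \<Rightarrow> ('a \<Rightarrow> 'v) set" where
  "partite_maps J X V = {\<phi> \<in> extensional (\<Union>j\<in>J. X j). \<forall>j\<in>J. \<phi> ` X j \<subseteq> V j}"

definition count_in ::
  "'j set \<Rightarrow> ('j \<Rightarrow> 'v set) \<Rightarrow> ('v set \<Rightarrow> real) \<Rightarrow> ('j \<Rightarrow> 'a set) \<Rightarrow> 'a set set \<Rightarrow> real" where
  "count_in J V g X E =
     measure_pmf.expectation (pmf_of_set (partite_maps J X V)) (\<lambda>\<phi>. \<Prod>e\<in>E. g (\<phi> ` e))"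

text \<open>A density graph is the case in which the part of index \<open>j\<close> is \<open>{j}\<close>.\<close>

abbreviation density_count :: "'j set \<Rightarrow> ('j set \<Rightarrow> real) \<Rightarrow> ('j \<Rightarrow> 'a set) \<Rightarrow> 'a set set \<Rightarrow> real" where
  "density_count J p X E \<equiv> count_in J (\<lambda>j. {j}) p X E"

definition index_set :: "'j set \<Rightarrow> ('j \<Rightarrow> 'a set) \<Rightarrow> 'a set \<Rightarrow> 'j set" where
  "index_set J X e = {j \<in> J. e \<inter> X j \<noteq> {}}"

lemma density_count_eq:
  assumes "partite_complex k J X E"
  shows "density_count J p X E = (\<Prod>e\<in>E. p (index_set J X e))"
proof -
  have disj: "disjoint_family_on X J" and sub: "\<And>e. e \<in> E \<Longrightarrow> e \<subseteq> (\<Union>j\<in>J. X j)"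
    using assms by (auto simp: partite_complex_def k_complex_def)
  define \<psi> where "\<psi> = (\<lambda>x\<in>(\<Union>j\<in>J. X j). THE j. j \<in> J \<and> x \<in> X j)"
  have \<psi>: "\<psi> x = j" if "j \<in> J" "x \<in> X j" for x j
  proof -
    have "(THE j. j \<in> J \<and> x \<in> X j) = j"
      using that disj by (intro the_equality) (auto simp: disjoint_family_on_def)
    then show ?thesis
      using that by (auto simp: \<psi>_def)
  qed
  have "partite_maps J X (\<lambda>j. {j}) = {\<psi>}"
  proof (intro equalityI subsetI)
    fix \<phi> assume \<phi>: "\<phi> \<in> partite_maps J X (\<lambda>j. {j})"
    have "\<phi> x = \<psi> x" for x
    proof (cases "x \<in> (\<Union>j\<in>J. X j)")
      case True
      then obtain j where "j \<in> J" "x \<in> X j" by blast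
      moreover from this \<phi> have "\<phi> x \<in> {j}" unfolding partite_maps_def by blast
      ultimately show ?thesis using \<psi> by simp
    next
      case False
      with \<phi> show ?thesis by (auto simp: partite_maps_def \<psi>_def extensional_def)
    qed
    then show "\<phi> \<in> {\<psi>}" by auto
  next
    fix \<phi> assume "\<phi> \<in> {\<psi>}"
    moreover have "\<psi> \<in> extensional (\<Union>j\<in>J. X j)"
      unfolding \<psi>_def by (rule restrict_extensional)
    ultimately show "\<phi> \<in> partite_maps J X (\<lambda>j. {j})"
      by (auto simp: partite_maps_def \<psi>)
  qed
  moreover have "\<psi> ` e = index_set J X e" if "e \<in> E" for e
  proof (intro equalityI subsetI)
    fix j assume "j \<in> \<psi> ` e"
    then obtain x where x: "x \<in> e" "j = \<psi> x" by blast
    with sub[OF that] obtain i where "i \<in> J" "x \<in> X i" by blast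
    with x \<psi> show "j \<in> index_set J X e" by (auto simp: index_set_def)
  next
    fix j assume "j \<in> index_set J X e"
    then obtain x where "j \<in> J" "x \<in> e" "x \<in> X j" by (auto simp: index_set_def)
    then show "j \<in> \<psi> ` e" using \<psi> by force
  qed
  ultimately show ?thesis
    by (simp add: count_in_def pmf_of_set_singleton)
qed

definition link :: "'v \<Rightarrow> ('v set \<Rightarrow> real) \<Rightarrow> 'v set \<Rightarrow> real" where
  "link v g e = g e * g (insert v e)"

definition vertex_norm :: "'v set \<Rightarrow> ('v set \<Rightarrow> real) \<Rightarrow> 'v set \<Rightarrow> real" where
  "vertex_norm W g U = measure_pmf.expectation (pmf_of_set W) (\<lambda>v. indicator U v * g {v})"

text \<open>
  \<open>approx_count \<epsilon> J p V g X E\<close> is the estimate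
  \<open>\<Gamma>(R) = (1 \<plusminus> \<epsilon>) (\<gamma>(\<emptyset>) / p(\<emptyset>)) \<P>(R)\<close>.
\<close>

definition approx_count ::
  "real \<Rightarrow> 'j set \<Rightarrow> ('j set \<Rightarrow> real) \<Rightarrow> ('j \<Rightarrow> 'v set) \<Rightarrow> ('v set \<Rightarrow> real) \<Rightarrow>
   ('j \<Rightarrow> 'a set) \<Rightarrow> 'a set set \<Rightarrow> bool" where
  "approx_count \<epsilon> J p V g X E \<longleftrightarrow>
     (1 - \<epsilon>) * (g {} / p {} * density_count J p X E) \<le> count_in J V g X E \<and>
     count_in J V g X E \<le> (1 + \<epsilon>) * (g {} / p {} * density_count J p X E)"

lemma card_Diff_Min_less:
  fixes J :: "'j::linorder set"
  assumes "2 \<le> card J"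
  shows "card (J - {Min J}) < card J"
proof -
  have "finite J" "J \<noteq> {}"
    using assms by (auto intro: card_ge_0_finite)
  then show ?thesis
    by (intro card_Diff1_less Min_in)
qed

text \<open>
  Typically hereditary counting.  The complexes \<open>R\<close> range over complexes with vertices in \<open>nat\<close>,
  which loses nothing because they are finite.  The first vertex of \<open>J\<close> is \<open>Min J\<close>.

  The density graph of a link of \<open>\<P>\<close> has weight \<open>p {} * p {x}\<close> at the empty set, which can be zero
  when \<open>p {x}\<close> is.  Then, as division by zero yields zero, the first condition for the link of \<open>v\<close>
  demands that all counts in it vanish, i.e. that \<open>g {} * g {v} = 0\<close>.
\<close>

function THC ::
  "real \<Rightarrow> nat \<Rightarrow> nat \<Rightarrow> 'j::linorder set \<Rightarrow> ('j set \<Rightarrow> real) \<Rightarrow> ('j \<Rightarrow> 'v set) \<Rightarrow>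
   ('v set \<Rightarrow> real) \<Rightarrow> bool" where
  "THC \<eta> c k J p V g \<longleftrightarrow>
     partite_k_graph k J V g \<and>
     (\<forall>(X :: 'j \<Rightarrow> nat set) E.
        partite_complex k J X E \<and> (\<forall>j\<in>J. card (X j) \<le> 4) \<and> num_vertices J X \<le> c \<longrightarrow>
        approx_count (real (num_vertices J X) * \<eta>) J p V g X E) \<and>
     (2 \<le> card J \<longrightarrow>
        (\<exists>V'. V' \<subseteq> V (Min J) \<and>
           vertex_norm (V (Min J)) g V' \<ge> (1 - \<eta>) * vertex_norm (V (Min J)) g (V (Min J)) \<and>
           (\<forall>v\<in>V'. THC \<eta> c k (J - {Min J}) (link (Min J) p) V (link v g))))"
  by pat_completeness auto
termination
  by (relation "Wellfounded.measure (\<lambda>(\<eta>, c, k, J, p, V, g). card J)")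
    (simp_all add: card_Diff_Min_less)

declare THC.simps [simp del]

end

theory Submission
  imports Defs
begin

text \<open>
  Typically hereditary counting asks for correct counts in every graph that arises by taking links
  of typical vertices \<open>v\<^sub>1, v\<^sub>2, \<dots>\<close> (the pins), with constants that do not depend on the number of
  indices. The proof keeps track of a family of small sets of forbidden tuples of pins, shows that
  most vertices keep these sets small, and that the counts are right as long as they are small.

  Locality. All weights equal one off \<open>H\<close>. Hence the count of a complex, normalised by the weight
  of the empty set, depends only on pins at indices adjacent in \<open>H\<close> to its own indices, and counts
  over index sets with no edge of \<open>H\<close> between them multiply (\<open>clustered_counts_multiply\<close>). So it
  suffices to consider clustered complexes, those whose indices lie in a ball of bounded radius.
  Up to relabelling, only boundedly many of them live near a given index, and at most \<open>\<Delta> c\<close> pins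
  affect each one.

  The start. Counting a set \<open>Q\<close> of at most \<open>\<Delta> c\<close> pins together with two copies of a complex \<open>R\<close> on
  at most \<open>c\<close> vertices takes \<open>(\<Delta> + 2) c\<close> vertices. By a second moment argument the tuples of pins
  on \<open>Q\<close> that make the count of \<open>R\<close> wrong have tiny mass, when tuples are weighted by their own
  edges (\<open>wrong_count_rare\<close>). These tuples are forbidden (\<open>guarded_initially\<close>).

  One step. Let \<open>v\<close> be chosen at the index \<open>x\<close>. A forbidden tuple with an entry at \<open>x\<close> is replaced
  by its slice at \<open>v\<close>, and the mass of these slices averages to the old mass. A forbidden tuple
  without an entry at \<open>x\<close> stays, but \<open>v\<close> changes its weight by a factor. If the mean of this
  factor over \<open>v\<close> is at most twice its expected value, the mass is at most doubled on average.
  Otherwise the tuple is no longer forbidden as a whole, and its entries at neighbours of \<open>x\<close> form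
  a new forbidden tuple instead. The new tuples have small mass because the current graph counts
  correctly at most \<open>\<Delta>\<close> neighbours of \<open>x\<close> together with two copies of \<open>x\<close>; this is where
  \<open>\<Delta> + 2 \<le> c\<close> enters (\<open>next_mass_le\<close>). By Markov's inequality most vertices \<open>v\<close> keep the mass at
  every \<open>Q\<close> near \<open>x\<close> below a threshold that is larger than the previous one by a factor \<open>1 / \<theta>\<close>,
  and nothing changes at the other sets (\<open>guarded_next\<close>).

  Why this closes. The threshold at \<open>Q\<close> is raised only when an index near \<open>Q\<close> is used up, which
  happens a bounded number of times, so it always stays below one. For \<open>Q = {}\<close> the mass is zero
  or one; hence the empty tuple is never forbidden, that is, the counts of clustered complexes are
  right in the current graph, with a fixed accuracy \<open>\<xi>\<close> that does not deteriorate from step to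
  step.
\<close>

section \<open>Averages over finite sets\<close>

definition avg :: "'a set \<Rightarrow> ('a \<Rightarrow> real) \<Rightarrow> real" where
  "avg A f = (\<Sum>a\<in>A. f a) / real (card A)"

lemma expectation_pmf_of_set_eq_avg:
  "finite A \<Longrightarrow> A \<noteq> {} \<Longrightarrow> measure_pmf.expectation (pmf_of_set A) f = avg A f"
  by (simp add: integral_pmf_of_set avg_def)

lemma avg_cong: "A = B \<Longrightarrow> (\<And>a. a \<in> B \<Longrightarrow> f a = h a) \<Longrightarrow> avg A f = avg B h"
  by (simp add: avg_def)

lemma avg_mono: "(\<And>a. a \<in> A \<Longrightarrow> f a \<le> h a) \<Longrightarrow> avg A f \<le> avg A h"
  by (auto simp: avg_def intro!: divide_right_mono sum_mono)

lemma avg_nonneg: "(\<And>a. a \<in> A \<Longrightarrow> 0 \<le> f a) \<Longrightarrow> 0 \<le> avg A f"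
  by (auto simp: avg_def intro!: divide_nonneg_nonneg sum_nonneg)

lemma avg_singleton [simp]: "avg {a} f = f a"
  by (simp add: avg_def)

lemma avg_zero [simp]: "avg A (\<lambda>_. 0) = 0"
  by (simp add: avg_def)

lemma avg_add: "avg A (\<lambda>a. f a + h a) = avg A f + avg A h"
  by (simp add: avg_def sum.distrib add_divide_distrib)

lemma avg_sum: "avg A (\<lambda>a. \<Sum>i\<in>I. f i a) = (\<Sum>i\<in>I. avg A (f i))"
  by (simp add: avg_def sum.swap[of _ A I] sum_divide_distrib)

lemma avg_mult_left: "avg A (\<lambda>a. c * f a) = c * avg A f"
  by (simp add: avg_def sum_distrib_left)

lemma avg_mult_right: "avg A (\<lambda>a. f a * c) = avg A f * c"
  by (simp add: avg_def sum_distrib_right)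

lemma avg_swap: "avg A (\<lambda>a. avg B (f a)) = avg B (\<lambda>b. avg A (\<lambda>a. f a b))"
proof -
  have "(\<Sum>a\<in>A. (\<Sum>b\<in>B. f a b)) = (\<Sum>b\<in>B. (\<Sum>a\<in>A. f a b))"
    by (rule sum.swap)
  then show ?thesis
    by (simp add: avg_def flip: sum_divide_distrib)
qed

lemma avg_eq_0_D:
  assumes "finite A" "\<And>a. a \<in> A \<Longrightarrow> 0 \<le> f a" "avg A f \<le> 0" "a \<in> A"
  shows "f a = 0"
proof -
  have "card A > 0"
    using assms by (auto simp: card_gt_0_iff)
  then have "(\<Sum>a\<in>A. f a) \<le> 0"
    using assms(3) by (simp add: avg_def divide_le_0_iff)
  then have "(\<Sum>a\<in>A. f a) = 0"
    by (intro antisym sum_nonneg assms)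
  then show ?thesis
    using assms sum_nonneg_eq_0_iff[of A f] by auto
qed

text \<open>
  The factor \<open>t\<close> is kept apart because it will be a product of densities, which may vanish. In
  that case the assumption forces \<open>h a * f a = 0\<close> everywhere, and the bound persists.
\<close>

lemma avg_Markov:
  assumes "finite A" "\<And>a. a \<in> A \<Longrightarrow> 0 \<le> h a" "\<And>a. a \<in> A \<Longrightarrow> 0 \<le> f a"
    and le: "avg A (\<lambda>a. h a * f a) \<le> s * (\<delta> * t)" and "0 < \<delta>" "0 \<le> t" "0 \<le> s"
  shows "avg A (\<lambda>a. h a * of_bool (\<delta> * t < f a)) \<le> s"
proof (cases "t = 0")
  case True
  have "h a * f a = 0" if "a \<in> A" for a
    using le True that assms by (intro avg_eq_0_D[of A "\<lambda>a. h a * f a"]) auto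
  then have "avg A (\<lambda>a. h a * of_bool (\<delta> * t < f a)) = avg A (\<lambda>_. 0)"
    using True by (intro avg_cong refl) force
  then show ?thesis
    using \<open>0 \<le> s\<close> by simp
next
  case False
  then have pos: "0 < \<delta> * t"
    using assms by simp
  have "avg A (\<lambda>a. h a * of_bool (\<delta> * t < f a)) * (\<delta> * t)
      = avg A (\<lambda>a. h a * of_bool (\<delta> * t < f a) * (\<delta> * t))"
    by (simp add: avg_mult_right)
  also have "\<dots> \<le> avg A (\<lambda>a. h a * f a)"
    using assms pos by (intro avg_mono) (auto simp: mult_left_mono)
  finally show ?thesis
    using le pos by (meson mult_le_cancel_right_pos order_trans)
qed

lemma avg_bij_betw:
  assumes "bij_betw r A B"
  shows "avg B f = avg A (\<lambda>a. f (r a))"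
  using sum.reindex_bij_betw[OF assms, of f] bij_betw_same_card[OF assms]
  by (simp add: avg_def)

lemma avg_Times: "avg (A \<times> B) f = avg A (\<lambda>a. avg B (\<lambda>b. f (a, b)))"
  by (simp add: avg_def card_cartesian_product flip: sum_divide_distrib)
     (simp add: sum.cartesian_product case_prod_unfold)

lemma avg_PiE_insert:
  assumes "x \<notin> Q"
  shows "avg (PiE (insert x Q) F) f = avg (F x) (\<lambda>v. avg (PiE Q F) (\<lambda>u. f (u(x := v))))"
proof -
  have "bij_betw (\<lambda>(y, u). u(x := y)) (F x \<times> PiE Q F) (PiE (insert x Q) F)"
    unfolding bij_betw_def using inj_combinator[OF assms, of F] PiE_insert_eq[of x Q F]
    by simp
  from avg_bij_betw[OF this, of f] show ?thesis
    by (simp add: avg_Times)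
qed

lemma avg_PiE_Plus:
  "avg (PiE (A <+> B) F) f =
   avg (PiE A (\<lambda>a. F (Inl a))) (\<lambda>u. avg (PiE B (\<lambda>b. F (Inr b))) (\<lambda>v. f (case_sum u v)))"
proof -
  let ?P = "PiE A (\<lambda>a. F (Inl a)) \<times> PiE B (\<lambda>b. F (Inr b))"
  have "bij_betw (\<lambda>(u, v). case_sum u v) ?P (PiE (A <+> B) F)"
  proof (rule bij_betwI[where g = "\<lambda>h. (h \<circ> Inl, h \<circ> Inr)"])
    show "(\<lambda>(u, v). case_sum u v) \<in> ?P \<rightarrow> PiE (A <+> B) F"
      by (auto simp: PiE_def Pi_def extensional_def split: sum.split)
    show "(\<lambda>h. (h \<circ> Inl, h \<circ> Inr)) \<in> PiE (A <+> B) F \<rightarrow> ?P"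
      by (auto simp: PiE_def Pi_def extensional_def)
  qed (auto simp: fun_eq_iff split: sum.split)
  from avg_bij_betw[OF this, of f] show ?thesis
    by (simp add: avg_Times)
qed

lemma avg_PiE_relabel:
  assumes "inj_on r A"
  shows "avg (PiE (r ` A) F) f =
         avg (PiE A (\<lambda>a. F (r a))) (\<lambda>u. f (\<lambda>y\<in>r ` A. u (inv_into A r y)))"
proof -
  have "bij_betw (\<lambda>u. \<lambda>y\<in>r ` A. u (inv_into A r y)) (PiE A (\<lambda>a. F (r a))) (PiE (r ` A) F)"
  proof (rule bij_betwI[where g = "\<lambda>h. \<lambda>a\<in>A. h (r a)"])
    show "(\<lambda>u. \<lambda>y\<in>r ` A. u (inv_into A r y)) \<in> PiE A (\<lambda>a. F (r a)) \<rightarrow> PiE (r ` A) F"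
      using assms by (auto simp: PiE_def Pi_def)
    show "(\<lambda>h. \<lambda>a\<in>A. h (r a)) \<in> PiE (r ` A) F \<rightarrow> PiE A (\<lambda>a. F (r a))"
      by (auto simp: PiE_def Pi_def)
    show "(\<lambda>a\<in>A. (\<lambda>y\<in>r ` A. u (inv_into A r y)) (r a)) = u"
      if "u \<in> PiE A (\<lambda>a. F (r a))" for u
      using assms that by (auto simp: fun_eq_iff PiE_def extensional_def restrict_def)
    show "(\<lambda>y\<in>r ` A. (\<lambda>a\<in>A. h (r a)) (inv_into A r y)) = h" if "h \<in> PiE (r ` A) F" for h
      using assms that
      by (auto simp: fun_eq_iff PiE_def extensional_def restrict_def f_inv_into_f inv_into_into)
  qed
  from avg_bij_betw[OF this, of f] show ?thesis .
qed

lemma avg_PiE_Un: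
  assumes "A \<inter> B = {}"
  shows "avg (PiE (A \<union> B) F) f =
         avg (PiE A F) (\<lambda>u. avg (PiE B F) (\<lambda>v. f (\<lambda>i. if i \<in> A then u i else v i)))"
proof -
  let ?P = "PiE A F \<times> PiE B F"
  have "bij_betw (\<lambda>(u, v). \<lambda>i. if i \<in> A then u i else v i) ?P (PiE (A \<union> B) F)"
  proof (rule bij_betwI[where g = "\<lambda>h. (restrict h A, restrict h B)"])
    show "(\<lambda>(u, v). \<lambda>i. if i \<in> A then u i else v i) \<in> ?P \<rightarrow> PiE (A \<union> B) F"
      by (auto simp: PiE_def Pi_def extensional_def)
    show "(\<lambda>h. (restrict h A, restrict h B)) \<in> PiE (A \<union> B) F \<rightarrow> ?P"
      by (auto simp: PiE_def Pi_def)
  qed (use assms in \<open>auto simp: fun_eq_iff PiE_def extensional_def restrict_def\<close>)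
  from avg_bij_betw[OF this, of f] show ?thesis
    by (simp add: avg_Times)
qed

section \<open>Labelled complexes and their normalised counts\<close>

text \<open>
  A partite complex presented by the map \<open>\<pi>\<close> from vertices to the indices of their parts; crossing
  edges are those on which \<open>\<pi>\<close> is injective. In this form complexes are easily relabelled, split
  and joined.
\<close>

definition labelled_complex :: "nat \<Rightarrow> 'j set \<Rightarrow> 'a set \<Rightarrow> ('a \<Rightarrow> 'j) \<Rightarrow> 'a set set \<Rightarrow> bool" where
  "labelled_complex k J Y \<pi> E \<longleftrightarrow> finite Y \<and> \<pi> ` Y \<subseteq> J \<and> {} \<in> E \<and>
     (\<forall>e\<in>E. e \<subseteq> Y \<and> card e \<le> k \<and> inj_on \<pi> e) \<and> (\<forall>e\<in>E. \<forall>f. f \<subseteq> e \<longrightarrow> f \<in> E)"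

lemma labelled_complex_finite: "labelled_complex k J Y \<pi> E \<Longrightarrow> finite E"
  unfolding labelled_complex_def by (meson finite_Pow_iff PowI finite_subset subsetI)

lemma labelled_complex_edgeD:
  assumes "labelled_complex k J Y \<pi> E" "e \<in> E"
  shows "e \<subseteq> Y" "finite e" "inj_on \<pi> e" "\<pi> ` e \<subseteq> J"
proof -
  show *: "e \<subseteq> Y" "inj_on \<pi> e"
    using assms by (simp_all add: labelled_complex_def)
  show "finite e" "\<pi> ` e \<subseteq> J"
    using assms(1) * by (auto simp: labelled_complex_def intro: finite_subset)
qed

lemma labelled_complex_Int_Pow:
  "labelled_complex k J Y \<pi> E \<Longrightarrow> Y' \<subseteq> Y \<Longrightarrow> labelled_complex k J Y' \<pi> (E \<inter> Pow Y')"
  unfolding labelled_complex_def by (auto intro: finite_subset)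

lemma labelled_complex_mono:
  "labelled_complex k J Y \<pi> E \<Longrightarrow> J \<subseteq> J' \<Longrightarrow> labelled_complex k J' Y \<pi> E"
  by (simp add: labelled_complex_def) (metis order_trans)

lemma labelled_complex_relabel:
  assumes "labelled_complex k J Y (\<pi> \<circ> r) E" "inj_on r Y"
  shows "labelled_complex k J (r ` Y) \<pi> ((`) r ` E)"
  unfolding labelled_complex_def
proof (intro conjI ballI allI impI)
  have E: "\<And>e. e \<in> E \<Longrightarrow> e \<subseteq> Y \<and> card e \<le> k \<and> inj_on (\<pi> \<circ> r) e"
    and down: "\<And>e f. e \<in> E \<Longrightarrow> f \<subseteq> e \<Longrightarrow> f \<in> E"
    using assms(1) by (auto simp: labelled_complex_def)
  show "finite (r ` Y)" "\<pi> ` r ` Y \<subseteq> J" "{} \<in> (`) r ` E"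
    using assms(1) by (auto simp: labelled_complex_def image_comp)
  fix e' assume "e' \<in> (`) r ` E"
  then obtain e where e: "e \<in> E" "e' = r ` e" by auto
  show "e' \<subseteq> r ` Y"
    using e E by auto
  show "card e' \<le> k"
    using e E assms(2) by (metis card_image inj_on_subset)
  show "inj_on \<pi> e'"
    using e E[OF e(1)] by (auto intro: inj_on_imageI)
  fix f assume "f \<subseteq> e'"
  then obtain f0 where "f0 \<subseteq> e" "f = r ` f0"
    using e by (meson subset_imageE)
  then show "f \<in> (`) r ` E"
    using down e by blast
qed

text \<open>
  The count of a complex relative to the weight of the empty set. Leaving out the empty edge
  instead of dividing by its weight gives a meaningful value when that weight is zero.
\<close>

definition ncount ::
  "('j \<Rightarrow> 'v set) \<Rightarrow> ('v set \<Rightarrow> real) \<Rightarrow> 'a set \<Rightarrow> ('a \<Rightarrow> 'j) \<Rightarrow> 'a set set \<Rightarrow> real" where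
  "ncount V g Y \<pi> E = avg (PiE Y (\<lambda>y. V (\<pi> y))) (\<lambda>\<phi>. \<Prod>e\<in>E - {{}}. g (\<phi> ` e))"

text \<open>
  The normalised count in a density graph, see \<open>ncount_singletons\<close>.
\<close>

definition dens :: "('j set \<Rightarrow> real) \<Rightarrow> ('a \<Rightarrow> 'j) \<Rightarrow> 'a set set \<Rightarrow> real" where
  "dens p \<pi> E = (\<Prod>e\<in>E - {{}}. p (\<pi> ` e))"

lemma image_Diff_empty: "(`) f ` E - {{}} = (`) f ` (E - {{}})"
  by auto

lemma inj_on_image_edges:
  assumes "inj_on r Y" "\<And>e. e \<in> E \<Longrightarrow> e \<subseteq> Y"
  shows "inj_on ((`) r) E"
  using assms by (intro inj_onI) (metis inj_on_image_eq_iff)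

lemma ncount_relabel:
  fixes r :: "'a \<Rightarrow> 'b" and V :: "'j \<Rightarrow> 'v set"
  assumes "inj_on r Y" "\<And>e. e \<in> E \<Longrightarrow> e \<subseteq> Y"
  shows "ncount V g (r ` Y) \<pi> ((`) r ` E) = ncount V g Y (\<pi> \<circ> r) E"
proof -
  have inj: "inj_on ((`) r) (E - {{}})"
    using inj_on_image_edges[OF assms] by (rule inj_on_subset) auto
  have "(\<lambda>y\<in>r ` Y. u (inv_into Y r y)) ` r ` e = u ` e" if "e \<in> E" for e and u :: "'a \<Rightarrow> 'v"
  proof -
    have "(\<lambda>y\<in>r ` Y. u (inv_into Y r y)) (r x) = u x" if "x \<in> e" for x
      using assms that \<open>e \<in> E\<close> by (auto simp: restrict_def subset_iff)
    then show ?thesis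
      unfolding image_image by (rule image_cong[OF refl])
  qed
  then show ?thesis
    unfolding ncount_def avg_PiE_relabel[OF assms(1)] image_Diff_empty prod.reindex[OF inj] o_def
    by (auto intro!: avg_cong prod.cong)
qed

lemma dens_relabel:
  assumes "inj_on r Y" "\<And>e. e \<in> E \<Longrightarrow> e \<subseteq> Y"
  shows "dens p \<pi> ((`) r ` E) = dens p (\<pi> \<circ> r) E"
proof -
  have inj: "inj_on ((`) r) (E - {{}})"
    using inj_on_image_edges[OF assms] by (rule inj_on_subset) auto
  show ?thesis
    unfolding dens_def image_Diff_empty prod.reindex[OF inj] by (simp add: image_comp)
qed

lemma ncount_cong:
  assumes "\<And>y. y \<in> Y \<Longrightarrow> \<pi> y = \<pi>' y"
    and "\<And>e \<phi>. e \<in> E \<Longrightarrow> e \<noteq> {} \<Longrightarrow> \<phi> \<in> PiE Y (\<lambda>y. V (\<pi> y)) \<Longrightarrow> g (\<phi> ` e) = g' (\<phi> ` e)"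
  shows "ncount V g Y \<pi> E = ncount V g' Y \<pi>' E"
proof -
  have "PiE Y (\<lambda>y. V (\<pi> y)) = PiE Y (\<lambda>y. V (\<pi>' y))"
    using assms(1) by (intro PiE_cong) auto
  then show ?thesis
    unfolding ncount_def using assms(2) by (intro avg_cong prod.cong) simp_all
qed

lemma dens_cong:
  assumes "\<And>e. e \<in> E \<Longrightarrow> e \<noteq> {} \<Longrightarrow> p (\<pi> ` e) = p' (\<pi>' ` e)"
  shows "dens p \<pi> E = dens p' \<pi>' E"
  unfolding dens_def using assms by (intro prod.cong) simp_all

lemma ncount_empty [simp]: "ncount V g {} \<pi> {{}} = 1"
  by (simp add: ncount_def)

lemma dens_empty [simp]: "dens p \<pi> {{}} = 1"
  by (simp add: dens_def)

text \<open>
  Counts are invariant under relabelling, so the vertex sets \<open>{..<n}\<close> represent all finite ones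
  (\<open>controlledD\<close>). The parameter \<open>L\<close> limits the index sets that are considered.
\<close>

definition controlled ::
  "'j set set \<Rightarrow> nat \<Rightarrow> 'j set \<Rightarrow> ('j \<Rightarrow> 'v set) \<Rightarrow> ('v set \<Rightarrow> real) \<Rightarrow> ('j set \<Rightarrow> real) \<Rightarrow> real \<Rightarrow> nat \<Rightarrow> bool" where
  "controlled L k J V g p \<epsilon> K \<longleftrightarrow>
     (\<forall>n\<le>K. \<forall>(\<pi> :: nat \<Rightarrow> 'j) E. labelled_complex k J {..<n} \<pi> E \<longrightarrow> \<pi> ` {..<n} \<in> L \<longrightarrow>
        \<bar>ncount V g {..<n} \<pi> E - dens p \<pi> E\<bar> \<le> \<epsilon> * dens p \<pi> E)"

lemma controlledD:
  assumes "controlled L k J V g p \<epsilon> K" "labelled_complex k J Y \<pi> E" "card Y \<le> K" "\<pi> ` Y \<in> L"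
  shows "\<bar>ncount V g Y \<pi> E - dens p \<pi> E\<bar> \<le> \<epsilon> * dens p \<pi> E"
proof -
  have "finite Y" and sub: "\<And>e. e \<in> E \<Longrightarrow> e \<subseteq> Y"
    using assms(2) by (auto simp: labelled_complex_def)
  then obtain n :: nat and r where r: "r ` Y = {..<n}" "inj_on r Y"
    using finite_imp_inj_to_nat_seg[of Y] by (auto simp: lessThan_def)
  define \<pi>' where "\<pi>' = \<pi> \<circ> inv_into Y r"
  have \<pi>': "\<pi>' (r y) = \<pi> y" if "y \<in> Y" for y
    using that r by (simp add: \<pi>'_def)
  have im: "(\<pi>' \<circ> r) ` e = \<pi> ` e" if "e \<subseteq> Y" for e
    using that \<pi>' by (intro image_cong) auto
  have "inj_on (\<pi>' \<circ> r) e = inj_on \<pi> e" if "e \<subseteq> Y" for e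
    using that \<pi>' by (intro inj_on_cong) auto
  then have "labelled_complex k J Y (\<pi>' \<circ> r) E"
    using assms(2) im[OF subset_refl] unfolding labelled_complex_def by auto
  then have "labelled_complex k J {..<n} \<pi>' ((`) r ` E)"
    using labelled_complex_relabel r by metis
  moreover have "n \<le> K"
    using assms(3) r card_image by fastforce
  moreover have "\<pi>' ` {..<n} \<in> L"
    using im[OF subset_refl] assms(4) r(1) by (metis image_comp)
  ultimately have "\<bar>ncount V g {..<n} \<pi>' ((`) r ` E) - dens p \<pi>' ((`) r ` E)\<bar>
      \<le> \<epsilon> * dens p \<pi>' ((`) r ` E)"
    using assms(1) by (auto simp: controlled_def)
  moreover have "ncount V g {..<n} \<pi>' ((`) r ` E) = ncount V g Y \<pi> E"
    using ncount_relabel[OF r(2), of E V g \<pi>'] sub r(1)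
      ncount_cong[of Y "\<pi>' \<circ> r" \<pi> E V g g] \<pi>' by auto
  moreover have "dens p \<pi>' ((`) r ` E) = dens p \<pi> E"
    using dens_relabel[OF r(2), of E p \<pi>'] sub
      dens_cong[of E p "\<pi>' \<circ> r" p \<pi>] im by auto
  ultimately show ?thesis
    by simp
qed

text \<open>
  The restrictions of a random map to \<open>Y1\<close> and \<open>Y2\<close> are independent, and the remaining edges
  contribute the factor one.
\<close>

lemma ncount_split:
  assumes "Y1 \<inter> Y2 = {}" "finite E"
    and cross: "\<And>e \<phi>. e \<in> E \<Longrightarrow> \<not> e \<subseteq> Y1 \<Longrightarrow> \<not> e \<subseteq> Y2 \<Longrightarrow>
           \<phi> \<in> PiE (Y1 \<union> Y2) (\<lambda>y. V (\<pi> y)) \<Longrightarrow> g (\<phi> ` e) = 1"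
  shows "ncount V g (Y1 \<union> Y2) \<pi> E =
         ncount V g Y1 \<pi> (E \<inter> Pow Y1) * ncount V g Y2 \<pi> (E \<inter> Pow Y2)"
proof -
  let ?F = "\<lambda>y. V (\<pi> y)"
  have "(\<Prod>e\<in>E - {{}}. g ((\<lambda>i. if i \<in> Y1 then a i else b i) ` e)) =
        (\<Prod>e\<in>E \<inter> Pow Y1 - {{}}. g (a ` e)) * (\<Prod>e\<in>E \<inter> Pow Y2 - {{}}. g (b ` e))"
    (is "prod ?G _ = _")
    if ab: "a \<in> PiE Y1 ?F" "b \<in> PiE Y2 ?F" for a b
  proof -
    have m: "(\<lambda>i. if i \<in> Y1 then a i else b i) \<in> PiE (Y1 \<union> Y2) ?F"
      using ab by (auto simp: PiE_def Pi_def extensional_def)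
    have "prod ?G (E - {{}}) = prod ?G ((E \<inter> Pow Y1 - {{}}) \<union> (E \<inter> Pow Y2 - {{}}))"
    proof (intro prod.mono_neutral_right ballI)
      fix e assume "e \<in> E - {{}} - ((E \<inter> Pow Y1 - {{}}) \<union> (E \<inter> Pow Y2 - {{}}))"
      then show "?G e = 1"
        by (intro cross m) blast+
    qed (use assms(2) in blast)+
    also have "\<dots> = prod ?G (E \<inter> Pow Y1 - {{}}) * prod ?G (E \<inter> Pow Y2 - {{}})"
      using assms(1,2) by (intro prod.union_disjoint) auto
    also have "prod ?G (E \<inter> Pow Y1 - {{}}) = (\<Prod>e\<in>E \<inter> Pow Y1 - {{}}. g (a ` e))"
      by (intro prod.cong refl arg_cong[of _ _ g] image_cong) auto
    also have "prod ?G (E \<inter> Pow Y2 - {{}}) = (\<Prod>e\<in>E \<inter> Pow Y2 - {{}}. g (b ` e))"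
      using assms(1) by (intro prod.cong refl arg_cong[of _ _ g] image_cong) auto
    finally show ?thesis .
  qed
  then have "ncount V g (Y1 \<union> Y2) \<pi> E = avg (PiE Y1 ?F) (\<lambda>a. avg (PiE Y2 ?F) (\<lambda>b.
      (\<Prod>e\<in>E \<inter> Pow Y1 - {{}}. g (a ` e)) * (\<Prod>e\<in>E \<inter> Pow Y2 - {{}}. g (b ` e))))"
    unfolding ncount_def avg_PiE_Un[OF assms(1)] by (intro avg_cong refl) auto
  then show ?thesis
    by (simp add: ncount_def avg_mult_left avg_mult_right)
qed

lemma dens_split:
  assumes "Y1 \<inter> Y2 = {}" "finite E"
    and cross: "\<And>e. e \<in> E \<Longrightarrow> \<not> e \<subseteq> Y1 \<Longrightarrow> \<not> e \<subseteq> Y2 \<Longrightarrow> p (\<pi> ` e) = 1"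
  shows "dens p \<pi> E = dens p \<pi> (E \<inter> Pow Y1) * dens p \<pi> (E \<inter> Pow Y2)"
proof -
  have "dens p \<pi> E = (\<Prod>e\<in>(E \<inter> Pow Y1 - {{}}) \<union> (E \<inter> Pow Y2 - {{}}). p (\<pi> ` e))"
    unfolding dens_def using assms(2) cross by (intro prod.mono_neutral_right) auto
  also have "\<dots> = dens p \<pi> (E \<inter> Pow Y1) * dens p \<pi> (E \<inter> Pow Y2)"
    unfolding dens_def using assms(1,2) by (intro prod.union_disjoint) auto
  finally show ?thesis .
qed

text \<open>
  Squares of counts are themselves counts, namely those of two disjoint copies of a complex.
\<close>

definition two_copies :: "'a set set \<Rightarrow> ('a + 'a) set set" where
  "two_copies E = (`) Inl ` E \<union> (`) Inr ` E"

lemma two_copies_prod: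
  assumes "finite E"
  shows "(\<Prod>e\<in>two_copies E - {{}}. F e) =
         (\<Prod>e\<in>E - {{}}. F (Inl ` e)) * (\<Prod>e\<in>E - {{}}. F (Inr ` e))"
proof -
  have inj: "inj_on ((`) Inl) A" "inj_on ((`) Inr) A" for A :: "'z set set"
    by (simp_all add: inj_on_def inj_image_eq_iff)
  have "two_copies E - {{}} = (`) Inl ` (E - {{}}) \<union> (`) Inr ` (E - {{}})"
    by (auto simp: two_copies_def)
  moreover have "(`) Inl ` (E - {{}}) \<inter> (`) Inr ` (E - {{}}) = {}"
  proof (rule equals0I)
    fix s assume "s \<in> (`) Inl ` (E - {{}}) \<inter> (`) Inr ` (E - {{}})"
    then obtain e f where "s = Inl ` e" "e \<noteq> {}" "s = Inr ` f"
      by blast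
    then show False
      by (metis Inl_Inr_False ex_in_conv image_iff)
  qed
  ultimately show ?thesis
    using assms by (simp add: prod.union_disjoint prod.reindex inj)
qed

lemma ncount_two_copies:
  assumes "finite E"
  shows "ncount V g (Y <+> Y) (case_sum \<pi> \<pi>) (two_copies E) = (ncount V g Y \<pi> E)\<^sup>2"
  by (simp add: ncount_def avg_PiE_Plus two_copies_prod[OF assms] image_image
      avg_mult_left avg_mult_right power2_eq_square)

lemma dens_two_copies:
  assumes "finite E"
  shows "dens p (case_sum \<pi> \<pi>) (two_copies E) = (dens p \<pi> E)\<^sup>2"
  by (simp add: dens_def two_copies_prod[OF assms] image_image power2_eq_square)

lemma labelled_complex_two_copies:
  assumes "labelled_complex k J Y \<pi> E"
  shows "labelled_complex k J (Y <+> Y) (case_sum \<pi> \<pi>) (two_copies E)"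
  unfolding labelled_complex_def
proof (intro conjI ballI allI impI)
  have E: "\<And>e. e \<in> E \<Longrightarrow> e \<subseteq> Y \<and> card e \<le> k \<and> inj_on \<pi> e"
    and down: "\<And>e f. e \<in> E \<Longrightarrow> f \<subseteq> e \<Longrightarrow> f \<in> E"
    using assms(1) by (auto simp: labelled_complex_def)
  show "finite (Y <+> Y)" "case_sum \<pi> \<pi> ` (Y <+> Y) \<subseteq> J" "{} \<in> two_copies E"
    using assms(1) by (auto simp: labelled_complex_def two_copies_def)
  fix e' assume "e' \<in> two_copies E"
  then consider e where "e \<in> E" "e' = Inl ` e" | e where "e \<in> E" "e' = Inr ` e"
    by (auto simp: two_copies_def)
  note cs = this
  show "e' \<subseteq> Y <+> Y"
    using cs E by cases auto
  show "card e' \<le> k"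
    using cs E by cases (simp_all add: card_image)
  show "inj_on (case_sum \<pi> \<pi>) e'"
    using cs E by cases (force simp: inj_on_def)+
  fix f assume "f \<subseteq> e'"
  show "f \<in> two_copies E"
    using cs
  proof cases
    case (1 e)
    with \<open>f \<subseteq> e'\<close> obtain f0 where "f0 \<subseteq> e" "f = Inl ` f0"
      by (meson subset_imageE)
    with 1 down show ?thesis by (auto simp: two_copies_def)
  next
    case (2 e)
    with \<open>f \<subseteq> e'\<close> obtain f0 where "f0 \<subseteq> e" "f = Inr ` f0"
      by (meson subset_imageE)
    with 2 down show ?thesis by (auto simp: two_copies_def)
  qed
qed

lemma ncount_vertex: "ncount V g {0::nat} (\<lambda>_. x) {{}, {0}} = avg (V x) (\<lambda>v. g {v})"
proof -
  have "{{}, {0}} - {{}} = {{0::nat}}"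
    by auto
  then show ?thesis
    using avg_PiE_insert[of "0::nat" "{}" "\<lambda>_. V x" "\<lambda>\<phi>. g {\<phi> 0}"]
    by (simp add: ncount_def)
qed

lemma dens_vertex: "dens p (\<lambda>_. x) {{}, {0::nat}} = p {x}"
proof -
  have "{{}, {0}} - {{}} = {{0::nat}}"
    by auto
  then show ?thesis
    by (simp add: dens_def)
qed

lemma labelled_complex_vertex:
  "1 \<le> k \<Longrightarrow> x \<in> J \<Longrightarrow> labelled_complex k J {0::nat} (\<lambda>_. x) {{}, {0}}"
  unfolding labelled_complex_def by (auto simp: subset_singleton_iff)

lemma controlled_vertex:
  assumes "controlled UNIV k J V g p \<epsilon> K" "1 \<le> k" "1 \<le> K" "x \<in> J"
  shows "\<bar>avg (V x) (\<lambda>v. g {v}) - p {x}\<bar> \<le> \<epsilon> * p {x}"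
  using controlledD[OF assms(1) labelled_complex_vertex[OF assms(2,4)]] assms(3)
  by (simp add: ncount_vertex dens_vertex)

section \<open>Weights that equal one off a complex\<close>

lemma image_in_crossing_sets:
  assumes "disjoint_family_on V J" "\<pi> ` e \<subseteq> J" "inj_on \<pi> e" "\<And>y. y \<in> e \<Longrightarrow> \<phi> y \<in> V (\<pi> y)"
  shows "\<phi> ` e \<in> crossing_sets V (\<pi> ` e)"
proof -
  have "\<phi> ` e \<inter> V (\<pi> y) = {\<phi> y}" if y: "y \<in> e" for y
  proof -
    have "z = y" if "z \<in> e" "\<phi> z \<in> V (\<pi> y)" for z
    proof -
      have "\<pi> z = \<pi> y"
      proof (rule ccontr)
        assume "\<pi> z \<noteq> \<pi> y"
        then have "V (\<pi> z) \<inter> V (\<pi> y) = {}"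
          using that y assms(2) by (intro disjoint_family_onD[OF assms(1)]) auto
        then show False
          using that assms(4) by blast
      qed
      then show ?thesis
        using assms(3) that y by (auto dest: inj_onD)
    qed
    then show ?thesis
      using y assms(4) by auto
  qed
  then show ?thesis
    using assms(4) by (auto simp: crossing_sets_def)
qed

lemma tuple_in_crossing_sets:
  assumes "disjoint_family_on V J" "Q \<subseteq> J" "u \<in> PiE Q V" "S \<subseteq> Q"
  shows "u ` S \<in> crossing_sets V S"
  using image_in_crossing_sets[of V J "\<lambda>x. x" S u] assms by (auto simp: PiE_def Pi_def)

lemma singleton_in_crossing_sets: "v \<in> V x \<Longrightarrow> {v} \<in> crossing_sets V {x}"
  by (auto simp: crossing_sets_def)

lemma Un_in_crossing_sets:
  assumes "disjoint_family_on V J" "f \<union> f' \<subseteq> J" "f \<inter> f' = {}"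
    and "s \<in> crossing_sets V f" "s' \<in> crossing_sets V f'"
  shows "s \<union> s' \<in> crossing_sets V (f \<union> f')"
proof -
  have aux: "(t \<union> t') \<inter> V j = t \<inter> V j"
    if "t' \<in> crossing_sets V h'" "j \<in> h" "h \<union> h' \<subseteq> J" "h \<inter> h' = {}" for t t' j h h'
  proof -
    have "V i \<inter> V j = {}" if "i \<in> h'" for i
      using that \<open>j \<in> h\<close> \<open>h \<union> h' \<subseteq> J\<close> \<open>h \<inter> h' = {}\<close> assms(1)
      by (intro disjoint_family_onD[of V J]) auto
    then show ?thesis
      using that(1) by (fastforce simp: crossing_sets_def)
  qed
  have "card ((s \<union> s') \<inter> V j) = 1" if "j \<in> f \<union> f'" for j
  proof (cases "j \<in> f")
    case True
    have "(s \<union> s') \<inter> V j = s \<inter> V j"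
      using True assms by (intro aux[of s' f' j f s]) auto
    then show ?thesis
      using True assms(4) by (simp add: crossing_sets_def)
  next
    case False
    then have "j \<in> f'"
      using that by simp
    moreover from this have "(s' \<union> s) \<inter> V j = s' \<inter> V j"
      using assms by (intro aux[of s f j f' s']) auto
    ultimately show ?thesis
      using assms(5) by (simp add: crossing_sets_def Un_commute)
  qed
  moreover have "s \<union> s' \<subseteq> \<Union> (V ` (f \<union> f'))"
    using assms(4,5) unfolding crossing_sets_def by blast
  ultimately show ?thesis
    by (simp add: crossing_sets_def)
qed

lemma crossing_sets_singletons: "s \<in> crossing_sets (\<lambda>j. {j}) f \<longleftrightarrow> s = f"
proof -
  have "card (s \<inter> {j}) = of_bool (j \<in> s)" for j
    by (cases "j \<in> s") auto
  then have "s \<in> crossing_sets (\<lambda>j. {j}) f \<longleftrightarrow> s \<subseteq> f \<and> (\<forall>j\<in>f. j \<in> s)"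
    by (simp add: crossing_sets_def)
  then show ?thesis
    by blast
qed

text \<open>
  The hypothesis that weights are one off \<open>H\<close>, stated so that a density graph is the case in which
  the part of \<open>j\<close> is \<open>{j}\<close>. Facts about links then serve for graphs and for density graphs alike.
\<close>

definition adapted :: "'j set set \<Rightarrow> 'j set \<Rightarrow> ('j \<Rightarrow> 'v set) \<Rightarrow> ('v set \<Rightarrow> real) \<Rightarrow> bool" where
  "adapted H J V g \<longleftrightarrow> disjoint_family_on V J \<and> (\<forall>j\<in>J. finite (V j) \<and> V j \<noteq> {}) \<and>
     (\<forall>e. e \<subseteq> \<Union> (V ` J) \<longrightarrow> 0 \<le> g e) \<and>
     (\<forall>f\<subseteq>J. f \<notin> H \<longrightarrow> (\<forall>s\<in>crossing_sets V f. g s = 1))"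

lemma adapted_off_complex:
  "adapted H J V g \<Longrightarrow> f \<subseteq> J \<Longrightarrow> f \<notin> H \<Longrightarrow> s \<in> crossing_sets V f \<Longrightarrow> g s = 1"
  by (simp add: adapted_def)

abbreviation adapted_density :: "'j set set \<Rightarrow> 'j set \<Rightarrow> ('j set \<Rightarrow> real) \<Rightarrow> bool" where
  "adapted_density H J p \<equiv> adapted H J (\<lambda>j. {j}) p"

lemma adapted_densityD:
  assumes "adapted_density H J p" "f \<subseteq> J"
  shows "0 \<le> p f" and "f \<notin> H \<Longrightarrow> p f = 1"
  using assms by (auto simp: adapted_def crossing_sets_singletons)

lemma crossing_one:
  assumes g: "adapted H J V g" and Y: "labelled_complex k J Y \<pi> E" and e: "e \<in> E"
    and \<phi>: "\<phi> \<in> PiE Y (\<lambda>y. V (\<pi> y))" and "\<pi> ` e \<notin> H"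
  shows "g (\<phi> ` e) = 1"
proof (rule adapted_off_complex[OF g])
  have "\<phi> y \<in> V (\<pi> y)" if "y \<in> e" for y
    using PiE_mem[OF \<phi>] labelled_complex_edgeD(1)[OF Y e] that by blast
  then show "\<phi> ` e \<in> crossing_sets V (\<pi> ` e)"
    using g labelled_complex_edgeD[OF Y e] by (intro image_in_crossing_sets) (auto simp: adapted_def)
qed (use assms labelled_complex_edgeD[OF Y e] in auto)

lemma dens_nonneg:
  assumes "adapted_density H J p" "labelled_complex k J Y \<pi> E"
  shows "0 \<le> dens p \<pi> E"
  unfolding dens_def
  using adapted_densityD(1)[OF assms(1)] labelled_complex_edgeD(4)[OF assms(2)]
  by (auto intro!: prod_nonneg)

section \<open>Pinning tuples of vertices\<close>

text \<open>
  The result of taking the links of the vertices \<open>u q\<close>, \<open>q \<in> Q\<close>, one after the other. In a density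
  graph the tuple \<open>u\<close> is the identity.
\<close>

definition pin :: "('v set \<Rightarrow> real) \<Rightarrow> 'j set \<Rightarrow> ('j \<Rightarrow> 'v) \<Rightarrow> 'v set \<Rightarrow> real" where
  "pin g Q u e = (\<Prod>S\<in>Pow Q. g (e \<union> u ` S))"

text \<open>
  The weight that a tuple carries by itself; \<open>g {} * pin_wt g Q u\<close> is the weight of the empty set
  after pinning \<open>u\<close>.
\<close>

definition pin_wt :: "('v set \<Rightarrow> real) \<Rightarrow> 'j set \<Rightarrow> ('j \<Rightarrow> 'v) \<Rightarrow> real" where
  "pin_wt g Q u = (\<Prod>S\<in>Pow Q - {{}}. g (u ` S))"

definition right_count ::
  "real \<Rightarrow> ('j \<Rightarrow> 'v set) \<Rightarrow> ('v set \<Rightarrow> real) \<Rightarrow> ('j set \<Rightarrow> real) \<Rightarrow> 'j set \<Rightarrow> ('j \<Rightarrow> 'v) \<Rightarrow>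
   'a set \<Rightarrow> ('a \<Rightarrow> 'j) \<Rightarrow> 'a set set \<Rightarrow> bool" where
  "right_count \<xi> V g p Q u Y \<pi> E \<longleftrightarrow>
     \<bar>ncount V (pin g Q u) Y \<pi> E - dens (pin p Q (\<lambda>j. j)) \<pi> E\<bar>
       \<le> \<xi> * dens (pin p Q (\<lambda>j. j)) \<pi> E"

text \<open>
  The mass of all tuples is close to \<open>pin_wt p Q (\<lambda>j. j)\<close> in a graph with right counts, so a set of
  tuples is small if its mass is a small multiple of this number.
\<close>

definition mass :: "('j \<Rightarrow> 'v set) \<Rightarrow> ('v set \<Rightarrow> real) \<Rightarrow> 'j set \<Rightarrow> ('j \<Rightarrow> 'v) set \<Rightarrow> real" where
  "mass V g Q B = avg (PiE Q V) (\<lambda>u. pin_wt g Q u * of_bool (u \<in> B))"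

lemma pin_cong: "(\<And>q. q \<in> Q \<Longrightarrow> u q = u' q) \<Longrightarrow> pin g Q u e = pin g Q u' e"
  unfolding pin_def
  by (intro prod.cong refl arg_cong[of _ _ g] arg_cong2[of _ _ _ _ "(\<union>)"] image_cong) auto

lemma pin_wt_cong: "(\<And>q. q \<in> Q \<Longrightarrow> u q = u' q) \<Longrightarrow> pin_wt g Q u = pin_wt g Q u'"
  unfolding pin_wt_def by (intro prod.cong refl arg_cong[of _ _ g] image_cong) auto

lemma pin_empty [simp]: "pin g {} u = g"
  by (simp add: pin_def fun_eq_iff)

lemma pin_wt_empty [simp]: "pin_wt g {} u = 1"
  by (simp add: pin_wt_def)

lemma upd_image:
  assumes "x \<notin> S"
  shows "u(x := v) ` S = u ` S" "u(x := v) ` insert x S = insert v (u ` S)"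
proof -
  show *: "u(x := v) ` S = u ` S"
    using assms by (intro image_cong) auto
  show "u(x := v) ` insert x S = insert v (u ` S)"
    by (simp only: image_insert fun_upd_same *)
qed

lemma Pow_insert_Diff_empty:
  "Pow (insert x Q) - {{}} = (Pow Q - {{}}) \<union> insert x ` Pow Q"
  by (auto simp: Pow_insert)

lemma inj_on_insert_Pow: "x \<notin> Q \<Longrightarrow> inj_on (insert x) (Pow Q)"
  by (auto simp: inj_on_def)

lemma pin_wt_insert:
  assumes "x \<notin> Q" "finite Q"
  shows "pin_wt g (insert x Q) (u(x := v)) = pin_wt g Q u * pin g Q u {v}"
proof -
  have "pin_wt g (insert x Q) (u(x := v)) = (\<Prod>S\<in>Pow Q - {{}}. g (u(x := v) ` S)) *
      (\<Prod>S\<in>insert x ` Pow Q. g (u(x := v) ` S))"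
    unfolding pin_wt_def Pow_insert_Diff_empty
    using assms by (intro prod.union_disjoint) auto
  also have "(\<Prod>S\<in>Pow Q - {{}}. g (u(x := v) ` S)) = pin_wt g Q u"
    unfolding pin_wt_def using assms(1) by (intro prod.cong refl arg_cong[of _ _ g] image_cong) auto
  also have "(\<Prod>S\<in>insert x ` Pow Q. g (u(x := v) ` S)) = (\<Prod>S\<in>Pow Q. g (u(x := v) ` insert x S))"
    by (simp add: prod.reindex[OF inj_on_insert_Pow[OF assms(1)]])
  also have "\<dots> = pin g Q u {v}"
    unfolding pin_def
  proof (intro prod.cong refl arg_cong[of _ _ g])
    fix S assume "S \<in> Pow Q"
    then have "x \<notin> S"
      using assms(1) by blast
    from upd_image(2)[OF this] show "u(x := v) ` insert x S = {v} \<union> u ` S"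
      by (simp only: insert_is_Un[symmetric])
  qed
  finally show ?thesis .
qed

text \<open>
  Together with \<open>pin_wt_insert\<close> this computes how choosing \<open>v\<close> changes the weight of a tuple:
  multiplied by the weight of \<open>v\<close> itself, the factor is the weight of \<open>v\<close> in the graph with \<open>u\<close>
  pinned.
\<close>

lemma pin_wt_link:
  assumes "finite Q"
  shows "g {v} * pin_wt (link v g) Q u = pin_wt g Q u * pin g Q u {v}"
proof -
  have "pin g Q u {v} = g {v} * (\<Prod>S\<in>Pow Q - {{}}. g (insert v (u ` S)))"
    unfolding pin_def using assms by (subst prod.remove[of _ "{}"]) auto
  then show ?thesis
    by (simp add: pin_wt_def link_def prod.distrib)
qed

text \<open>
  Pinning \<open>u\<close> in the link of \<open>v\<close> is pinning the tuple extended by \<open>v\<close>. This allows statements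
  about all tuples of pins to be passed on from a graph to the links of its vertices.
\<close>

lemma pin_link:
  assumes "x \<notin> Q" "finite Q"
  shows "pin (link v g) Q u e = pin g (insert x Q) (u(x := v)) e"
proof -
  have "pin g (insert x Q) (u(x := v)) e = (\<Prod>S\<in>Pow Q. g (e \<union> u(x := v) ` S)) *
      (\<Prod>S\<in>insert x ` Pow Q. g (e \<union> u(x := v) ` S))"
    unfolding pin_def Pow_insert using assms by (intro prod.union_disjoint) auto
  also have "(\<Prod>S\<in>insert x ` Pow Q. g (e \<union> u(x := v) ` S)) =
      (\<Prod>S\<in>Pow Q. g (e \<union> u(x := v) ` insert x S))"
    by (simp add: prod.reindex[OF inj_on_insert_Pow[OF assms(1)]])
  also have "(\<Prod>S\<in>Pow Q. g (e \<union> u(x := v) ` S)) * \<dots> =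
      (\<Prod>S\<in>Pow Q. g (e \<union> u(x := v) ` S) * g (e \<union> u(x := v) ` insert x S))"
    by (rule prod.distrib[symmetric])
  also have "\<dots> = pin (link v g) Q u e"
    unfolding pin_def link_def
  proof (intro prod.cong refl)
    fix S assume "S \<in> Pow Q"
    then have "x \<notin> S"
      using assms(1) by blast
    from upd_image[OF this, of u v] show "g (e \<union> u(x := v) ` S) * g (e \<union> u(x := v) ` insert x S) =
        g (e \<union> u ` S) * g (insert v (e \<union> u ` S))"
      by (simp only: Un_insert_right)
  qed
  finally show ?thesis ..
qed

lemma adapted_tuple_nonneg:
  assumes "adapted H J V g" "Q \<subseteq> J" "u \<in> PiE Q V" "S \<subseteq> Q" "e \<subseteq> \<Union> (V ` J)"
  shows "0 \<le> g (e \<union> u ` S)"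
proof -
  have "u ` S \<subseteq> \<Union> (V ` J)"
    using assms(2-4) by (auto simp: PiE_def Pi_def)
  then show ?thesis
    using assms(1,5) by (simp add: adapted_def)
qed

lemma pin_wt_nonneg:
  assumes "adapted H J V g" "Q \<subseteq> J" "u \<in> PiE Q V"
  shows "0 \<le> pin_wt g Q u"
  unfolding pin_wt_def using adapted_tuple_nonneg[OF assms, of _ "{}"] by (intro prod_nonneg) auto

lemma pin_nonneg:
  assumes "adapted H J V g" "Q \<subseteq> J" "u \<in> PiE Q V" "e \<subseteq> \<Union> (V ` J)"
  shows "0 \<le> pin g Q u e"
  unfolding pin_def using adapted_tuple_nonneg[OF assms(1-3) _ assms(4)]
  by (intro prod_nonneg) auto

lemma adapted_density_nonneg:
  assumes "adapted_density H J p" "Q \<subseteq> J"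
  shows "0 \<le> pin_wt p Q (\<lambda>x. x)" and "e \<subseteq> J \<Longrightarrow> 0 \<le> pin p Q (\<lambda>x. x) e"
  unfolding pin_wt_def pin_def using adapted_densityD(1)[OF assms(1)] assms(2)
  by (auto intro!: prod_nonneg)

text \<open>
  The edges of the complex that combines \<open>E\<close> with a simplex on the pins \<open>Q\<close>. Sets of more than \<open>k\<close>
  vertices are dropped so that the result is a \<open>k\<close>-complex; they are not in \<open>H\<close> and have weight
  one anyway.
\<close>

definition join :: "nat \<Rightarrow> 'j set \<Rightarrow> 'a set set \<Rightarrow> ('j + 'a) set set" where
  "join k Q E = (\<lambda>(S, e). Inl ` S \<union> Inr ` e) ` {(S, e). S \<subseteq> Q \<and> e \<in> E \<and> card S + card e \<le> k}"

lemma join_prod: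
  fixes Q :: "'j set" and E :: "'a set set"
  assumes "finite Q" "finite E" "{} \<in> E"
    and one: "\<And>S e. S \<subseteq> Q \<Longrightarrow> e \<in> E \<Longrightarrow> k < card S + card e \<Longrightarrow> F (Inl ` S \<union> Inr ` e) = 1"
  shows "(\<Prod>e\<in>join k Q E - {{}}. F e) = (\<Prod>S\<in>Pow Q - {{}}. F (Inl ` S)) *
           (\<Prod>e\<in>E - {{}}. \<Prod>S\<in>Pow Q. F (Inl ` S \<union> Inr ` e))"
proof -
  let ?j = "\<lambda>(S, e). Inl ` S \<union> Inr ` e" and ?B = "Pow Q \<times> E - {({}, {})}"
  let ?B' = "{(S, e). (S, e) \<in> ?B \<and> card S + card e \<le> k}"
  have inj: "inj_on ?j A" for A :: "('j set \<times> 'a set) set"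
  proof (rule inj_onI, clarify)
    fix S e S' e'
    assume *: "Inl ` S \<union> Inr ` e = Inl ` S' \<union> Inr ` (e' :: 'a set)"
    have "S = Inl -` (Inl ` S \<union> Inr ` e)" "S' = Inl -` (Inl ` S' \<union> Inr ` e')"
      "e = Inr -` (Inl ` S \<union> Inr ` e)" "e' = Inr -` (Inl ` S' \<union> Inr ` e')"
      by auto
    with * show "S = S' \<and> e = e'"
      by metis
  qed
  have "join k Q E - {{}} = ?j ` ?B'"
    by (auto simp: join_def)
  then have "(\<Prod>e\<in>join k Q E - {{}}. F e) = (\<Prod>b\<in>?B'. F (?j b))"
    using prod.reindex[OF inj, of F ?B'] by (simp only: o_def)
  also have "\<dots> = (\<Prod>b\<in>?B. F (?j b))"
  proof (intro prod.mono_neutral_left ballI)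
    fix b assume "b \<in> ?B - ?B'"
    then show "F (?j b) = 1"
      by (cases b) (use one in force)
  qed (use assms in auto)
  also have "?B = (Pow Q - {{}}) \<times> {{}} \<union> Pow Q \<times> (E - {{}})"
    using assms(3) by auto
  also have "(\<Prod>b\<in>\<dots>. F (?j b)) =
      (\<Prod>b\<in>(Pow Q - {{}}) \<times> {{}}. F (?j b)) * (\<Prod>b\<in>Pow Q \<times> (E - {{}}). F (?j b))"
    using assms by (intro prod.union_disjoint) auto
  also have "(\<Prod>b\<in>(Pow Q - {{}}) \<times> {{}}. F (?j b)) = (\<Prod>S\<in>Pow Q - {{}}. F (Inl ` S))"
    using prod.cartesian_product[of "\<lambda>S e. F (Inl ` S \<union> Inr ` e)" "{{}}" "Pow Q - {{}}"]
    by (simp add: case_prod_unfold)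
  also have "(\<Prod>b\<in>Pow Q \<times> (E - {{}}). F (?j b)) =
      (\<Prod>e\<in>E - {{}}. \<Prod>S\<in>Pow Q. F (Inl ` S \<union> Inr ` e))"
    using prod.cartesian_product[of "\<lambda>S e. F (Inl ` S \<union> Inr ` e)" "E - {{}}" "Pow Q"]
      prod.swap[of "\<lambda>S e. F (Inl ` S \<union> Inr ` e)" "E - {{}}" "Pow Q"]
    by (simp add: case_prod_unfold)
  finally show ?thesis .
qed

lemma labelled_complex_join:
  assumes "labelled_complex k J Y \<pi> E" "Q \<subseteq> J" "finite Q" "Q \<inter> \<pi> ` Y = {}"
  shows "labelled_complex k J (Q <+> Y) (case_sum (\<lambda>x. x) \<pi>) (join k Q E)"
  unfolding labelled_complex_def
proof (intro conjI ballI allI impI)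
  have fin: "finite Y" and E: "\<And>e. e \<in> E \<Longrightarrow> e \<subseteq> Y \<and> card e \<le> k \<and> inj_on \<pi> e"
    and down: "\<And>e f. e \<in> E \<Longrightarrow> f \<subseteq> e \<Longrightarrow> f \<in> E"
    using assms(1) by (auto simp: labelled_complex_def)
  have "Inl ` {} \<union> Inr ` {} \<in> join k Q E"
    using assms(1) unfolding join_def labelled_complex_def
    by (intro image_eqI[where x = "({}, {})"]) auto
  then show "finite (Q <+> Y)" "case_sum (\<lambda>x. x) \<pi> ` (Q <+> Y) \<subseteq> J" "{} \<in> join k Q E"
    using assms by (auto simp: labelled_complex_def)
  fix e' assume "e' \<in> join k Q E"
  then obtain S e where Se: "S \<subseteq> Q" "e \<in> E" "card S + card e \<le> k" "e' = Inl ` S \<union> Inr ` e"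
    by (auto simp: join_def)
  have finSe: "finite S" "finite e"
    using Se E fin assms(3) by (auto intro: finite_subset)
  show "e' \<subseteq> Q <+> Y"
    using Se E by auto
  have "card e' = card S + card e"
    unfolding Se(4) using finSe by (subst card_Un_disjoint) (auto simp: card_image)
  then show "card e' \<le> k"
    using Se by simp
  show "inj_on (case_sum (\<lambda>x. x) \<pi>) e'"
  proof (rule inj_onI)
    fix a b assume "a \<in> e'" "b \<in> e'" and eq: "case_sum (\<lambda>x. x) \<pi> a = case_sum (\<lambda>x. x) \<pi> b"
    moreover have "\<pi> y \<notin> Q" if "y \<in> e" for y
      using that assms(4) E[OF Se(2)] by auto
    ultimately show "a = b"
      using Se E[OF Se(2)] by (auto dest: inj_onD)
  qed
  fix f assume "f \<subseteq> e'"
  define T d where "T = Inl -` f" and "d = Inr -` f"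
  have f: "f = Inl ` T \<union> Inr ` d"
    by (auto simp: T_def d_def image_iff) (metis sumE)
  have "T \<subseteq> S" "d \<subseteq> e"
    using \<open>f \<subseteq> e'\<close> Se(4) by (auto simp: T_def d_def)
  moreover from this have "card T \<le> card S" "card d \<le> card e"
    using finSe by (auto intro: card_mono)
  ultimately show "f \<in> join k Q E"
    unfolding f join_def using Se down by (intro image_eqI[where x = "(T, d)"]) auto
qed

section \<open>Second moments: tuples with a wrong count are rare\<close>

text \<open>
  No index set is fixed: the indices in use become fewer whenever a link is taken, while \<open>H\<close> can
  stay the same.
\<close>

locale bounded_degree_complex =
  fixes H :: "'j set set" and k \<Delta> :: nat
  assumes H_card: "e \<in> H \<Longrightarrow> finite e \<and> card e \<le> k"
    and H_down: "e \<in> H \<Longrightarrow> f \<subseteq> e \<Longrightarrow> f \<in> H"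
    and degree: "finite {y. y \<noteq> x \<and> {x, y} \<in> H} \<and> card {y. y \<noteq> x \<and> {x, y} \<in> H} \<le> \<Delta>"

begin

text \<open>
  Weighting each tuple of pins by its own edges turns the average of the counts in the pinned
  graphs into a single count in the original graph.
\<close>

lemma ncount_join:
  assumes "adapted H J V g" "labelled_complex k J Y \<pi> E" "Q \<subseteq> J" "finite Q" "Q \<inter> \<pi> ` Y = {}"
  shows "ncount V g (Q <+> Y) (case_sum (\<lambda>x. x) \<pi>) (join k Q E) =
         avg (PiE Q V) (\<lambda>u. pin_wt g Q u * ncount V (pin g Q u) Y \<pi> E)"
proof -
  have "finite E" "{} \<in> E"
    using assms(2) labelled_complex_finite[OF assms(2)] by (simp_all add: labelled_complex_def)
  have "(\<Prod>e\<in>join k Q E - {{}}. g (case_sum u \<phi> ` e)) =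
        pin_wt g Q u * (\<Prod>e\<in>E - {{}}. pin g Q u (\<phi> ` e))"
    if u: "u \<in> PiE Q V" and \<phi>: "\<phi> \<in> PiE Y (\<lambda>y. V (\<pi> y))" for u \<phi>
  proof -
    have "g (case_sum u \<phi> ` (Inl ` S \<union> Inr ` e)) = 1"
      if "S \<subseteq> Q" "e \<in> E" "k < card S + card e" for S e
    proof -
      have e: "e \<subseteq> Y" "inj_on \<pi> e" "finite e"
        using labelled_complex_edgeD[OF assms(2) \<open>e \<in> E\<close>] by auto
      have disj: "S \<inter> \<pi> ` e = {}"
        using assms(5) that e by auto
      have sub: "S \<union> \<pi> ` e \<subseteq> J"
        using labelled_complex_edgeD[OF assms(2) \<open>e \<in> E\<close>] assms(3) that by auto
      have "card (S \<union> \<pi> ` e) = card S + card e"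
        using disj e finite_subset[OF \<open>S \<subseteq> Q\<close> \<open>finite Q\<close>]
        by (simp add: card_Un_disjoint card_image)
      then have "S \<union> \<pi> ` e \<notin> H"
        using that H_card[of "S \<union> \<pi> ` e"] by auto
      moreover have "u ` S \<union> \<phi> ` e \<in> crossing_sets V (S \<union> \<pi> ` e)"
      proof (rule Un_in_crossing_sets[of V J])
        show "disjoint_family_on V J"
          using assms(1) by (simp add: adapted_def)
        then show "u ` S \<in> crossing_sets V S"
          using tuple_in_crossing_sets[OF _ \<open>Q \<subseteq> J\<close> u \<open>S \<subseteq> Q\<close>] by blast
        have "\<phi> y \<in> V (\<pi> y)" if "y \<in> e" for y
          using PiE_mem[OF \<phi>] e(1) that by blast
        with \<open>disjoint_family_on V J\<close> show "\<phi> ` e \<in> crossing_sets V (\<pi> ` e)"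
          using labelled_complex_edgeD[OF assms(2) \<open>e \<in> E\<close>]
          by (intro image_in_crossing_sets)
      qed (use disj sub in auto)
      ultimately show ?thesis
        using adapted_off_complex[OF assms(1) sub] by (simp add: image_Un image_image)
    qed
    then show ?thesis
      by (subst join_prod[OF \<open>finite Q\<close> \<open>finite E\<close> \<open>{} \<in> E\<close>])
         (simp_all add: pin_wt_def pin_def image_Un image_image Un_commute)
  qed
  then show ?thesis
    unfolding ncount_def avg_PiE_Plus avg_mult_left[symmetric]
    by (intro avg_cong) simp_all
qed

lemma dens_join:
  assumes "adapted_density H J p" "labelled_complex k J Y \<pi> E" "Q \<subseteq> J" "finite Q" "Q \<inter> \<pi> ` Y = {}"
  shows "dens p (case_sum (\<lambda>x. x) \<pi>) (join k Q E) =
         pin_wt p Q (\<lambda>x. x) * dens (pin p Q (\<lambda>x. x)) \<pi> E"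
proof -
  have "finite E" "{} \<in> E"
    using assms(2) labelled_complex_finite[OF assms(2)] by (simp_all add: labelled_complex_def)
  have "p (case_sum (\<lambda>x. x) \<pi> ` (Inl ` S \<union> Inr ` e)) = 1"
    if "S \<subseteq> Q" "e \<in> E" "k < card S + card e" for S e
  proof -
    have e: "e \<subseteq> Y" "inj_on \<pi> e" "finite e"
      using labelled_complex_edgeD[OF assms(2) \<open>e \<in> E\<close>] by auto
    have disj: "S \<inter> \<pi> ` e = {}"
      using assms(5) that e by auto
    have sub: "S \<union> \<pi> ` e \<subseteq> J"
      using labelled_complex_edgeD[OF assms(2) \<open>e \<in> E\<close>] assms(3) that by auto
    have "card (S \<union> \<pi> ` e) = card S + card e"
      using disj e finite_subset[OF \<open>S \<subseteq> Q\<close> \<open>finite Q\<close>]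
      by (simp add: card_Un_disjoint card_image)
    then have "S \<union> \<pi> ` e \<notin> H"
      using that H_card[of "S \<union> \<pi> ` e"] by auto
    then show ?thesis
      using adapted_densityD(2)[OF assms(1) sub] by (simp add: image_Un image_image)
  qed
  then show ?thesis
    unfolding dens_def
    by (subst join_prod[OF \<open>finite Q\<close> \<open>finite E\<close> \<open>{} \<in> E\<close>])
       (simp_all add: pin_wt_def pin_def image_Un image_image Un_commute)
qed

text \<open>
  Expanding the square leaves the counts of the pins together with two copies, one copy and no
  copy of the complex. The main terms cancel, and the errors add up to \<open>1 + 2 + 1\<close> times
  \<open>\<epsilon> * \<rho>\<^sup>2 * W\<close>.
\<close>

lemma second_moment:
  fixes E :: "'a set set"
  assumes g: "adapted H J V g" and p: "adapted_density H J p" and ctrl: "controlled UNIV k J V g p \<epsilon> K"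
    and Y: "labelled_complex k J Y \<pi> E" and Q: "Q \<subseteq> J" "finite Q" "Q \<inter> \<pi> ` Y = {}"
    and K: "card Q + 2 * card Y \<le> K"
  defines "\<rho> \<equiv> dens (pin p Q (\<lambda>x. x)) \<pi> E" and "W \<equiv> pin_wt p Q (\<lambda>x. x)"
  shows "avg (PiE Q V) (\<lambda>u. pin_wt g Q u * (ncount V (pin g Q u) Y \<pi> E - \<rho>)\<^sup>2) \<le> 4 * \<epsilon> * \<rho>\<^sup>2 * W"
    and "0 \<le> \<rho>"
proof -
  let ?N = "\<lambda>u. ncount V (pin g Q u) Y \<pi> E"
  have fin: "finite Y" "finite E"
    using Y labelled_complex_finite[OF Y] by (simp_all add: labelled_complex_def)
  have "0 \<le> pin p Q (\<lambda>x. x) (\<pi> ` e)" if "e \<in> E" for e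
    using that Y by (intro adapted_density_nonneg(2)[OF p Q(1)]) (auto simp: labelled_complex_def)
  then show "0 \<le> \<rho>"
    unfolding \<rho>_def dens_def by (auto intro!: prod_nonneg)
  have two: "labelled_complex k J (Y <+> Y) (case_sum \<pi> \<pi>) (two_copies E)"
    by (rule labelled_complex_two_copies[OF Y])
  \<comment> \<open>The total weight of the tuples is the count of the pins joined with the complex without vertices.\<close>
  have none: "labelled_complex k J ({} :: 'a set) \<pi> {{}}"
    by (auto simp: labelled_complex_def)
  have disj: "Q \<inter> case_sum \<pi> \<pi> ` (Y <+> Y) = {}"
    using Q(3) by auto
  have cards: "card (Q <+> (Y <+> Y)) \<le> K" "card (Q <+> Y) \<le> K" "card (Q <+> ({} :: 'a set)) \<le> K"
    using K Q(2) fin(1) by (simp_all add: card_Plus)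
  have "\<bar>avg (PiE Q V) (\<lambda>u. pin_wt g Q u * (?N u)\<^sup>2) - W * \<rho>\<^sup>2\<bar> \<le> \<epsilon> * (W * \<rho>\<^sup>2)"
    using controlledD[OF ctrl labelled_complex_join[OF two Q(1,2) disj] cards(1) UNIV_I]
    unfolding ncount_join[OF g two Q(1,2) disj] dens_join[OF p two Q(1,2) disj]
      ncount_two_copies[OF fin(2)] dens_two_copies[OF fin(2)] W_def \<rho>_def .
  moreover have "\<bar>avg (PiE Q V) (\<lambda>u. pin_wt g Q u * ?N u) - W * \<rho>\<bar> \<le> \<epsilon> * (W * \<rho>)"
    using controlledD[OF ctrl labelled_complex_join[OF Y Q] cards(2) UNIV_I]
    unfolding ncount_join[OF g Y Q] dens_join[OF p Y Q] W_def \<rho>_def .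
  then have "2 * \<rho> * (W * \<rho> - avg (PiE Q V) (\<lambda>u. pin_wt g Q u * ?N u)) \<le> 2 * \<rho> * (\<epsilon> * (W * \<rho>))"
    using \<open>0 \<le> \<rho>\<close> by (intro mult_left_mono) auto
  moreover have "\<bar>avg (PiE Q V) (\<lambda>u. pin_wt g Q u) - W\<bar> \<le> \<epsilon> * W"
    using controlledD[OF ctrl labelled_complex_join[OF none Q(1,2)] cards(3) UNIV_I]
    using ncount_join[OF g none Q(1,2)] dens_join[OF p none Q(1,2)] by (simp add: W_def)
  then have "\<rho>\<^sup>2 * (avg (PiE Q V) (\<lambda>u. pin_wt g Q u) - W) \<le> \<rho>\<^sup>2 * (\<epsilon> * W)"
    by (intro mult_left_mono) auto
  moreover have "avg (PiE Q V) (\<lambda>u. pin_wt g Q u * (?N u - \<rho>)\<^sup>2) =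
      avg (PiE Q V) (\<lambda>u. pin_wt g Q u * (?N u)\<^sup>2) + (-2 * \<rho>) * avg (PiE Q V) (\<lambda>u. pin_wt g Q u * ?N u)
      + \<rho>\<^sup>2 * avg (PiE Q V) (\<lambda>u. pin_wt g Q u)"
    unfolding avg_mult_left[symmetric] avg_add[symmetric]
    by (intro avg_cong refl) (simp add: power2_eq_square algebra_simps)
  ultimately show "avg (PiE Q V) (\<lambda>u. pin_wt g Q u * (?N u - \<rho>)\<^sup>2) \<le> 4 * \<epsilon> * \<rho>\<^sup>2 * W"
    by (simp add: power2_eq_square algebra_simps abs_le_iff)
qed

lemma finite_PiE_parts:
  assumes "adapted H J V g" "Q \<subseteq> J" "finite Q"
  shows "finite (PiE Q V)" "PiE Q V \<noteq> {}"
  using assms by (auto simp: adapted_def PiE_eq_empty_iff intro!: finite_PiE)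

text \<open>
  Chebyshev's inequality. If \<open>\<rho> = 0\<close> then tuples with a wrong count carry no weight at all.
\<close>

lemma wrong_count_rare:
  assumes g: "adapted H J V g" and p: "adapted_density H J p" and ctrl: "controlled UNIV k J V g p \<epsilon> K"
    and Y: "labelled_complex k J Y \<pi> E" and Q: "Q \<subseteq> J" "finite Q" "Q \<inter> \<pi> ` Y = {}"
    and K: "card Q + 2 * card Y \<le> K" and "0 \<le> \<epsilon>" "0 < \<xi>"
  defines "\<rho> \<equiv> dens (pin p Q (\<lambda>x. x)) \<pi> E" and "W \<equiv> pin_wt p Q (\<lambda>x. x)"
  shows "avg (PiE Q V) (\<lambda>u. pin_wt g Q u *
           of_bool (\<xi> * \<rho> < \<bar>ncount V (pin g Q u) Y \<pi> E - \<rho>\<bar>)) \<le> 4 * \<epsilon> / \<xi>\<^sup>2 * W"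
proof -
  note sm = second_moment[OF g p ctrl Y Q K, folded \<rho>_def W_def]
  let ?N = "\<lambda>u. ncount V (pin g Q u) Y \<pi> E"
  have W: "0 \<le> W"
    unfolding W_def by (rule adapted_density_nonneg(1)[OF p Q(1)])
  have "avg (PiE Q V) (\<lambda>u. pin_wt g Q u * of_bool (\<xi> * \<rho> < \<bar>?N u - \<rho>\<bar>)) \<le>
        avg (PiE Q V) (\<lambda>u. pin_wt g Q u * of_bool (\<xi>\<^sup>2 * \<rho>\<^sup>2 < (?N u - \<rho>)\<^sup>2))"
  proof (intro avg_mono mult_left_mono pin_wt_nonneg[OF g Q(1)])
    fix u
    have "(\<xi> * \<rho>)\<^sup>2 < \<bar>?N u - \<rho>\<bar>\<^sup>2" if "\<xi> * \<rho> < \<bar>?N u - \<rho>\<bar>"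
      using that sm(2) \<open>0 < \<xi>\<close> by (intro power_strict_mono) auto
    then show "of_bool (\<xi> * \<rho> < \<bar>?N u - \<rho>\<bar>) \<le> (of_bool (\<xi>\<^sup>2 * \<rho>\<^sup>2 < (?N u - \<rho>)\<^sup>2) :: real)"
      by (simp add: power_mult_distrib)
  qed
  also have "\<dots> \<le> 4 * \<epsilon> / \<xi>\<^sup>2 * W"
    using sm(1) \<open>0 \<le> \<epsilon>\<close> \<open>0 < \<xi>\<close> W
    by (intro avg_Markov finite_PiE_parts[OF g Q(1,2)] pin_wt_nonneg[OF g Q(1)])
       (auto simp: field_simps)
  finally show ?thesis .
qed

text \<open>
  A count \<open>N > 2 * \<rho>\<close> is at most \<open>2 / \<rho> * (N - \<rho>)\<^sup>2\<close>, so even the first moment of such counts is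
  bounded by the variance; for \<open>\<rho> = 0\<close> such counts carry no weight.
\<close>

lemma excess_count_rare:
  assumes g: "adapted H J V g" and p: "adapted_density H J p" and ctrl: "controlled UNIV k J V g p \<epsilon> K"
    and Y: "labelled_complex k J Y \<pi> E" and Q: "Q \<subseteq> J" "finite Q" "Q \<inter> \<pi> ` Y = {}"
    and K: "card Q + 2 * card Y \<le> K"
  defines "\<rho> \<equiv> dens (pin p Q (\<lambda>x. x)) \<pi> E" and "W \<equiv> pin_wt p Q (\<lambda>x. x)"
  shows "avg (PiE Q V) (\<lambda>u. pin_wt g Q u *
           (of_bool (2 * \<rho> < ncount V (pin g Q u) Y \<pi> E) * ncount V (pin g Q u) Y \<pi> E))
         \<le> 8 * \<epsilon> * \<rho> * W"
proof -
  note sm = second_moment[OF g p ctrl Y Q K, folded \<rho>_def W_def]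
  let ?N = "\<lambda>u. ncount V (pin g Q u) Y \<pi> E"
  note w = pin_wt_nonneg[OF g Q(1)]
  show ?thesis
  proof (cases "\<rho> = 0")
    case True
    have "pin_wt g Q u * (?N u - \<rho>)\<^sup>2 = 0" if "u \<in> PiE Q V" for u
      using sm(1) True w that finite_PiE_parts[OF g Q(1,2)]
      by (intro avg_eq_0_D[of "PiE Q V" "\<lambda>u. pin_wt g Q u * (?N u - \<rho>)\<^sup>2"]) auto
    then have "avg (PiE Q V) (\<lambda>u. pin_wt g Q u * (of_bool (2 * \<rho> < ?N u) * ?N u)) = avg (PiE Q V) (\<lambda>_. 0)"
      using True by (intro avg_cong refl) fastforce
    then show ?thesis
      using True by simp
  next
    case False
    then have "0 < \<rho>"
      using sm(2) by simp
    have "of_bool (2 * \<rho> < n) * n \<le> 2 / \<rho> * (n - \<rho>)\<^sup>2" for n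
    proof (cases "2 * \<rho> < n")
      case True
      have "n * \<rho> \<le> (2 * (n - \<rho>)) * (n - \<rho>)"
        using True \<open>0 < \<rho>\<close> by (intro mult_mono) auto
      then show ?thesis
        using True \<open>0 < \<rho>\<close> by (simp add: field_simps power2_eq_square)
    qed (use \<open>0 < \<rho>\<close> in auto)
    then have "avg (PiE Q V) (\<lambda>u. pin_wt g Q u * (of_bool (2 * \<rho> < ?N u) * ?N u))
      \<le> avg (PiE Q V) (\<lambda>u. pin_wt g Q u * (2 / \<rho> * (?N u - \<rho>)\<^sup>2))"
      by (intro avg_mono mult_left_mono w)
    also have "\<dots> = 2 / \<rho> * avg (PiE Q V) (\<lambda>u. pin_wt g Q u * (?N u - \<rho>)\<^sup>2)"
      unfolding avg_mult_left[symmetric] by (simp add: mult_ac)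
    also have "\<dots> \<le> 2 / \<rho> * (4 * \<epsilon> * \<rho>\<^sup>2 * W)"
      using sm(1) \<open>0 < \<rho>\<close> by (intro mult_left_mono) auto
    also have "\<dots> = 8 * \<epsilon> * \<rho> * W"
      using \<open>0 < \<rho>\<close> by (simp add: power2_eq_square)
    finally show ?thesis .
  qed
qed

section \<open>Neighbourhoods and clustered index sets\<close>

definition nbrs :: "'j \<Rightarrow> 'j set" where
  "nbrs x = {y. y \<noteq> x \<and> {x, y} \<in> H}"

text \<open>
  Reflexive, so that its powers increase.
\<close>

definition reach :: "('j \<times> 'j) set" where
  "reach = {(x, y). y = x \<or> y \<in> nbrs x}"

text \<open>
  The ball of radius \<open>r\<close> about \<open>x\<close> in the graph of the two-element sets of \<open>H\<close>.
\<close>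

definition nbhd :: "nat \<Rightarrow> 'j \<Rightarrow> 'j set" where
  "nbhd r x = (reach ^^ r) `` {x}"

text \<open>
  Bounded diameter. The number of clustered sets near a given index is bounded in terms of \<open>\<Delta>\<close> and
  \<open>r\<close> only (\<open>card_clustered_near\<close>), which allows union bounds over them.
\<close>

definition clustered :: "nat \<Rightarrow> 'j set \<Rightarrow> bool" where
  "clustered r Q \<longleftrightarrow> (\<forall>q\<in>Q. Q \<subseteq> nbhd r q)"

text \<open>
  The indices at which a pin can influence counts over the index set \<open>f\<close>.
\<close>

definition frontier :: "'j set \<Rightarrow> 'j set" where
  "frontier f = (\<Union>j\<in>f. nbrs j) - f"

text \<open>
  The number of indices near \<open>Q\<close> that are still in use. It bounds how often the mass of the
  forbidden tuples on \<open>Q\<close> can still change.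
\<close>

definition lev :: "nat \<Rightarrow> 'j set \<Rightarrow> 'j set \<Rightarrow> nat" where
  "lev r J Q = card (J \<inter> (\<Union>q\<in>Q. nbhd r q))"

lemma finite_nbrs: "finite (nbrs x)" and card_nbrs: "card (nbrs x) \<le> \<Delta>"
  using degree[of x] by (simp_all add: nbrs_def)

lemma nbrs_sym: "y \<in> nbrs x \<longleftrightarrow> x \<in> nbrs y"
  by (auto simp: nbrs_def insert_commute)

lemma not_in_complex: "x \<in> e \<Longrightarrow> y \<in> e \<Longrightarrow> x \<noteq> y \<Longrightarrow> y \<notin> nbrs x \<Longrightarrow> e \<notin> H"
  using H_down[of e "{x, y}"] by (auto simp: nbrs_def)

lemma nbhd_0 [simp]: "nbhd 0 x = {x}"
  by (simp add: nbhd_def)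

lemma nbhd_Suc: "nbhd (Suc r) x = (\<Union>y\<in>nbhd r x. insert y (nbrs y))"
  by (auto simp: nbhd_def reach_def)

lemma nbhd_trans: "z \<in> nbhd s y \<Longrightarrow> y \<in> nbhd r x \<Longrightarrow> z \<in> nbhd (r + s) x"
  by (auto simp: nbhd_def relpow_add)

lemma nbhd_mono: "r \<le> s \<Longrightarrow> nbhd r x \<subseteq> nbhd s x"
  by (induction s rule: dec_induct) (auto simp: nbhd_Suc)

lemma self_in_nbhd: "x \<in> nbhd r x"
  using nbhd_mono[of 0 r x] by auto

lemma nbrs_nbhd_1: "y \<in> nbrs x \<Longrightarrow> y \<in> nbhd 1 x"
  by (auto simp: nbhd_Suc)

lemma nbhd_sym: "y \<in> nbhd r x \<Longrightarrow> x \<in> nbhd r y"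
proof (induction r arbitrary: y)
  case (Suc r)
  then obtain z where z: "z \<in> nbhd r x" "y = z \<or> y \<in> nbrs z"
    by (auto simp: nbhd_Suc)
  then have "z \<in> nbhd 1 y"
    using nbrs_sym by (auto simp: nbhd_Suc)
  from nbhd_trans[OF Suc.IH[OF z(1)] this] show ?case
    by simp
qed simp

lemma finite_nbhd: "finite (nbhd r x)"
  by (induction r) (auto simp: nbhd_Suc finite_nbrs)

lemma card_nbhd: "card (nbhd r x) \<le> (\<Delta> + 1) ^ r"
proof (induction r)
  case (Suc r)
  have "card (nbhd (Suc r) x) \<le> (\<Sum>y\<in>nbhd r x. card (insert y (nbrs y)))"
    unfolding nbhd_Suc by (rule card_UN_le[OF finite_nbhd])
  also have "\<dots> \<le> (\<Sum>y\<in>nbhd r x. \<Delta> + 1)"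
    using card_nbrs finite_nbrs by (intro sum_mono) (auto intro: card_insert_le_m1)
  also have "\<dots> \<le> (\<Delta> + 1) ^ Suc r"
    using mult_right_mono[OF Suc, of "\<Delta> + 1"] by (simp add: mult_ac)
  finally show ?case .
qed simp

lemma clustered_subset: "clustered r Q \<Longrightarrow> Q' \<subseteq> Q \<Longrightarrow> clustered r Q'"
  by (auto simp: clustered_def)

lemma clustered_mono: "clustered r Q \<Longrightarrow> r \<le> s \<Longrightarrow> clustered s Q"
  using nbhd_mono unfolding clustered_def by blast

lemma clustered_nbhd_subset:
  assumes "clustered r Q" "q \<in> Q"
  shows "(\<Union>y\<in>Q. nbhd r y) \<subseteq> nbhd (2 * r) q"
proof safe
  fix y z assume "y \<in> Q" "z \<in> nbhd r y"
  moreover from this have "y \<in> nbhd r q"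
    using assms by (auto simp: clustered_def)
  ultimately have "z \<in> nbhd (r + r) q"
    by (auto intro: nbhd_trans)
  then show "z \<in> nbhd (2 * r) q"
    by (simp add: mult_2)
qed

lemma clustered_subset_nbrs: "Q \<subseteq> nbrs x \<Longrightarrow> clustered 2 Q"
  unfolding clustered_def
proof (intro ballI subsetI)
  fix q y assume "Q \<subseteq> nbrs x" "q \<in> Q" "y \<in> Q"
  then have "x \<in> nbhd 1 q" "y \<in> nbhd 1 x"
    using nbrs_nbhd_1 nbrs_sym by blast+
  then have "y \<in> nbhd (1 + 1) q"
    by (intro nbhd_trans)
  then show "y \<in> nbhd 2 q"
    by (simp add: numeral_2_eq_2)
qed

lemma clustered_frontier:
  assumes "clustered c f" "Q \<subseteq> frontier f"
  shows "clustered (c + 2) Q"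
  unfolding clustered_def
proof (intro ballI subsetI)
  fix q y assume "q \<in> Q" "y \<in> Q"
  then obtain i j where ij: "i \<in> f" "q \<in> nbrs i" "j \<in> f" "y \<in> nbrs j"
    using assms(2) unfolding frontier_def by blast
  then have "i \<in> nbhd 1 q" "j \<in> nbhd c i" "y \<in> nbhd 1 j"
    using nbrs_nbhd_1 nbrs_sym assms(1) unfolding clustered_def by blast+
  then have "y \<in> nbhd (1 + c + 1) q"
    by (meson nbhd_trans)
  then show "y \<in> nbhd (c + 2) q"
    by (simp add: numeral_2_eq_2)
qed

lemma clustered_near_frontier:
  assumes "clustered c f" "q \<in> frontier f"
  shows "f \<subseteq> nbhd (c + 1) q"
proof
  fix y assume "y \<in> f"
  obtain i where i: "i \<in> f" "q \<in> nbrs i"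
    using assms(2) unfolding frontier_def by blast
  then have "i \<in> nbhd 1 q" "y \<in> nbhd c i"
    using nbrs_nbhd_1 nbrs_sym assms(1) \<open>y \<in> f\<close> unfolding clustered_def by blast+
  then have "y \<in> nbhd (1 + c) q"
    by (rule nbhd_trans[rotated])
  then show "y \<in> nbhd (c + 1) q"
    by simp
qed

lemma card_frontier_le:
  assumes "finite f" "Q \<subseteq> frontier f"
  shows "card Q \<le> card f * \<Delta>"
proof -
  have "card Q \<le> card (\<Union>j\<in>f. nbrs j)"
    using assms finite_nbrs by (intro card_mono) (auto simp: frontier_def)
  also have "\<dots> \<le> (\<Sum>j\<in>f. card (nbrs j))"
    by (rule card_UN_le[OF assms(1)])
  also have "\<dots> \<le> (\<Sum>j\<in>f. \<Delta>)"
    by (intro sum_mono card_nbrs)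
  finally show ?thesis
    by simp
qed

lemma lev_le:
  assumes "clustered r Q"
  shows "lev r J Q \<le> (\<Delta> + 1) ^ (2 * r)"
proof (cases "Q = {}")
  case False
  then obtain q where "q \<in> Q" by blast
  have "lev r J Q \<le> card (nbhd (2 * r) q)"
    unfolding lev_def using clustered_nbhd_subset[OF assms \<open>q \<in> Q\<close>] finite_nbhd
    by (intro card_mono) auto
  also have "\<dots> \<le> (\<Delta> + 1) ^ (2 * r)"
    by (rule card_nbhd)
  finally show ?thesis .
qed (simp add: lev_def)

lemma card_clustered_near:
  assumes "finite J"
  shows "card {Q. Q \<subseteq> J \<and> clustered r Q \<and> (Q = {} \<or> x \<in> (\<Union>q\<in>Q. nbhd r q))}
         \<le> 2 ^ ((\<Delta> + 1) ^ (2 * r))" (is "card ?A \<le> _")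
proof -
  have "?A \<subseteq> Pow (nbhd (2 * r) x)"
  proof (intro subsetI PowI)
    fix Q y assume Q: "Q \<in> ?A" and y: "y \<in> Q"
    then obtain q where q: "q \<in> Q" "x \<in> nbhd r q" by auto
    have "q \<in> nbhd r x" "y \<in> nbhd r q"
      using nbhd_sym q Q y by (auto simp: clustered_def)
    then have "y \<in> nbhd (r + r) x"
      by (auto intro: nbhd_trans)
    then show "y \<in> nbhd (2 * r) x"
      by (simp add: mult_2)
  qed
  then have "card ?A \<le> card (Pow (nbhd (2 * r) x))"
    using finite_nbhd by (intro card_mono) auto
  also have "\<dots> \<le> 2 ^ ((\<Delta> + 1) ^ (2 * r))"
    using card_nbhd finite_nbhd by (simp add: card_Pow power_increasing)
  finally show ?thesis .
qed

text \<open>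
  Suppose that \<open>f\<close> has an element outside the ball of radius \<open>c\<close> about another element \<open>a\<close>. If
  each of the \<open>c\<close> shells of this ball met \<open>f\<close>, then \<open>f\<close> would have more than \<open>c\<close> elements; so one
  of the shells misses \<open>f\<close>, and \<open>f\<close> can be cut there.
\<close>

lemma not_clustered_split:
  assumes "finite f" "card f \<le> c" "\<not> clustered c f"
  obtains C D where "f = C \<union> D" "C \<inter> D = {}" "C \<noteq> {}" "D \<noteq> {}"
    "\<And>x y. x \<in> C \<Longrightarrow> y \<in> D \<Longrightarrow> y \<notin> nbrs x"
proof -
  obtain a b where ab: "a \<in> f" "b \<in> f" "b \<notin> nbhd c a"
    using assms(3) by (auto simp: clustered_def)
  have "\<exists>i<c. f \<inter> nbhd (Suc i) a \<subseteq> nbhd i a"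
  proof (rule ccontr)
    assume neg: "\<not> ?thesis"
    have "i + 1 \<le> card (f \<inter> nbhd i a)" if "i \<le> c" for i
      using that
    proof (induction i)
      case 0
      then show ?case
        using ab by simp
    next
      case (Suc i)
      have "f \<inter> nbhd i a \<subset> f \<inter> nbhd (Suc i) a"
      proof
        show "f \<inter> nbhd i a \<subseteq> f \<inter> nbhd (Suc i) a"
          using nbhd_mono[of i "Suc i" a] by auto
        have "\<not> f \<inter> nbhd (Suc i) a \<subseteq> nbhd i a"
          using neg Suc.prems by auto
        then show "f \<inter> nbhd i a \<noteq> f \<inter> nbhd (Suc i) a"
          by blast
      qed
      then have "card (f \<inter> nbhd i a) < card (f \<inter> nbhd (Suc i) a)"
        using assms(1) by (intro psubset_card_mono) auto
      then show ?case
        using Suc by simp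
    qed
    then have "c + 1 \<le> card (f \<inter> nbhd c a)"
      by simp
    also have "\<dots> \<le> card f"
      using assms(1) by (intro card_mono) auto
    finally show False
      using assms(2) by simp
  qed
  then obtain i where i: "i < c" "f \<inter> nbhd (Suc i) a \<subseteq> nbhd i a"
    by blast
  show ?thesis
  proof
    show "f = (f \<inter> nbhd i a) \<union> (f - nbhd i a)"
      by blast
    show "f \<inter> nbhd i a \<noteq> {}"
      using ab self_in_nbhd by auto
    show "f - nbhd i a \<noteq> {}"
      using ab i(1) nbhd_mono[of i c a] by auto
    fix x y assume "x \<in> f \<inter> nbhd i a" "y \<in> f - nbhd i a"
    then show "y \<notin> nbrs x"
      using i(2) by (auto simp: nbhd_Suc)
  qed auto
qed

section \<open>Counts of clustered complexes control all counts\<close>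

lemma power_one_plus_le:
  fixes \<xi> :: real
  assumes "0 \<le> \<xi>" "\<xi> \<le> 1"
  shows "(1 + \<xi>) ^ m \<le> 1 + (2 ^ m - 1) * \<xi>"
proof (induction m)
  case (Suc m)
  have "(1 + \<xi>) ^ Suc m \<le> (1 + \<xi>) * (1 + (2 ^ m - 1) * \<xi>)"
    using Suc assms by (auto intro: mult_left_mono)
  also have "\<dots> = 1 + 2 ^ m * \<xi> + (2 ^ m - 1) * (\<xi> * \<xi>)"
    by (simp add: algebra_simps)
  also have "\<dots> \<le> 1 + 2 ^ m * \<xi> + (2 ^ m - 1) * \<xi>"
    using assms mult_left_le[of \<xi> \<xi>] by (intro add_left_mono mult_left_mono) auto
  finally show ?case
    by (simp add: algebra_simps)
qed simp

text \<open>
  An index set that is not clustered falls into two parts with no edge of \<open>H\<close> between them, and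
  the count is then the product of the counts over the parts. One error factor for each index
  makes the error bound multiplicative as well.
\<close>

lemma clustered_counts_multiply:
  fixes Y :: "'a set"
  assumes g: "adapted H J V g" and p: "adapted_density H J p" and "0 \<le> \<xi>" "\<xi> \<le> 1"
    and ctrl: "controlled {f. clustered c f} k J V g p \<xi> c"
    and "labelled_complex k J Y \<pi> E" "card Y \<le> c"
  shows "(1 - \<xi>) ^ card (\<pi> ` Y) * dens p \<pi> E \<le> ncount V g Y \<pi> E \<and>
         ncount V g Y \<pi> E \<le> (1 + \<xi>) ^ card (\<pi> ` Y) * dens p \<pi> E"
  using assms(6,7)
proof (induction "card (\<pi> ` Y)" arbitrary: Y E rule: less_induct)
  case less
  note Y = less.prems(1)
  have fin: "finite Y" "finite E"
    using Y labelled_complex_finite[OF Y] by (simp_all add: labelled_complex_def)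
  have d0: "0 \<le> dens p \<pi> E"
    by (rule dens_nonneg[OF p Y])
  consider (none) "Y = {}" | (loc) "Y \<noteq> {}" "clustered c (\<pi> ` Y)" | (nonloc) "\<not> clustered c (\<pi> ` Y)"
    by blast
  then show ?case
  proof cases
    case none
    then have "E = {{}}"
      using Y by (auto simp: labelled_complex_def)
    then show ?thesis
      using none by simp
  next
    case loc
    have "\<bar>ncount V g Y \<pi> E - dens p \<pi> E\<bar> \<le> \<xi> * dens p \<pi> E"
      using loc less.prems by (intro controlledD[OF ctrl]) auto
    then have "(1 - \<xi>) * dens p \<pi> E \<le> ncount V g Y \<pi> E" "ncount V g Y \<pi> E \<le> (1 + \<xi>) * dens p \<pi> E"
      by (auto simp: algebra_simps abs_le_iff)
    moreover have m: "1 \<le> card (\<pi> ` Y)"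
      using loc fin by (simp add: Suc_leI card_gt_0_iff)
    have "(1 - \<xi>) ^ card (\<pi> ` Y) \<le> (1 - \<xi>) ^ 1"
      using m assms(3,4) by (intro power_decreasing) auto
    then have "(1 - \<xi>) ^ card (\<pi> ` Y) * dens p \<pi> E \<le> (1 - \<xi>) * dens p \<pi> E"
      using d0 by (intro mult_right_mono) auto
    moreover have "(1 + \<xi>) ^ 1 \<le> (1 + \<xi>) ^ card (\<pi> ` Y)"
      using m assms(3,4) by (intro power_increasing) auto
    then have "(1 + \<xi>) * dens p \<pi> E \<le> (1 + \<xi>) ^ card (\<pi> ` Y) * dens p \<pi> E"
      using d0 by (intro mult_right_mono) auto
    ultimately show ?thesis
      by linarith
  next
    case nonloc
    have "card (\<pi> ` Y) \<le> c"
      using card_image_le[OF fin(1)] less.prems(2) by (rule order_trans)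
    then obtain C D where CD: "\<pi> ` Y = C \<union> D" "C \<inter> D = {}" "C \<noteq> {}" "D \<noteq> {}"
      "\<And>x y. x \<in> C \<Longrightarrow> y \<in> D \<Longrightarrow> y \<notin> nbrs x"
      using not_clustered_split[of "\<pi> ` Y" c] nonloc fin(1) by blast
    define Y1 Y2 where "Y1 = {y\<in>Y. \<pi> y \<in> C}" and "Y2 = {y\<in>Y. \<pi> y \<in> D}"
    have Y12: "Y1 \<inter> Y2 = {}" "Y1 \<union> Y2 = Y" and im: "\<pi> ` Y1 = C" "\<pi> ` Y2 = D"
    proof -
      have "\<pi> y \<in> C \<union> D" if "y \<in> Y" for y
        using that CD(1) by (metis imageI)
      then show "Y1 \<inter> Y2 = {}" "Y1 \<union> Y2 = Y"
        using CD(2) by (auto simp: Y1_def Y2_def)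
      have "z \<in> \<pi> ` Y" if "z \<in> C \<or> z \<in> D" for z
        using that CD(1) by simp
      then show "\<pi> ` Y1 = C" "\<pi> ` Y2 = D"
        by (force simp: Y1_def Y2_def)+
    qed
    have off: "\<pi> ` e \<notin> H" if esc: "e \<in> E" "\<not> e \<subseteq> Y1" "\<not> e \<subseteq> Y2" for e
    proof -
      obtain y1 y2 where "y1 \<in> e" "y1 \<in> Y1" "y2 \<in> e" "y2 \<in> Y2"
        using esc Y12 labelled_complex_edgeD(1)[OF Y \<open>e \<in> E\<close>] by blast
      then show ?thesis
        using CD(2,5) im by (intro not_in_complex[of "\<pi> y1" _ "\<pi> y2"]) blast+
    qed
    have nc: "ncount V g Y \<pi> E = ncount V g Y1 \<pi> (E \<inter> Pow Y1) * ncount V g Y2 \<pi> (E \<inter> Pow Y2)"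
    proof -
      have "g (\<phi> ` e) = 1"
        if "e \<in> E" "\<not> e \<subseteq> Y1" "\<not> e \<subseteq> Y2" "\<phi> \<in> PiE (Y1 \<union> Y2) (\<lambda>y. V (\<pi> y))" for e \<phi>
        using that(4) unfolding Y12(2) by (rule crossing_one[OF g Y that(1) _ off[OF that(1-3)]])
      from ncount_split[of Y1 Y2 E V \<pi> g, OF Y12(1) fin(2) this] show ?thesis
        unfolding Y12(2) .
    qed
    have de: "dens p \<pi> E = dens p \<pi> (E \<inter> Pow Y1) * dens p \<pi> (E \<inter> Pow Y2)"
      using off labelled_complex_edgeD(4)[OF Y] adapted_densityD(2)[OF p]
      by (intro dens_split[OF Y12(1) fin(2)]) blast
    have finCD: "finite C" "finite D"
      using CD(1) fin(1) by (metis finite_Un finite_imageI)+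
    have cc: "card (\<pi> ` Y) = card C + card D"
      using CD finCD by (simp add: card_Un_disjoint)
    have pos: "0 < card C" "0 < card D"
      using CD finCD by (simp_all add: card_gt_0_iff)
    have cards: "card Y1 \<le> c" "card Y2 \<le> c"
      using card_mono[OF fin(1), of Y1] card_mono[OF fin(1), of Y2] Y12(2) less.prems(2) by auto
    have l1: "labelled_complex k J Y1 \<pi> (E \<inter> Pow Y1)" and l2: "labelled_complex k J Y2 \<pi> (E \<inter> Pow Y2)"
      using Y12(2) by (auto intro!: labelled_complex_Int_Pow[OF Y])
    have b1: "(1 - \<xi>) ^ card C * dens p \<pi> (E \<inter> Pow Y1) \<le> ncount V g Y1 \<pi> (E \<inter> Pow Y1) \<and>
        ncount V g Y1 \<pi> (E \<inter> Pow Y1) \<le> (1 + \<xi>) ^ card C * dens p \<pi> (E \<inter> Pow Y1)"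
      using less.hyps[OF _ l1 cards(1)] cc pos im by simp
    have b2: "(1 - \<xi>) ^ card D * dens p \<pi> (E \<inter> Pow Y2) \<le> ncount V g Y2 \<pi> (E \<inter> Pow Y2) \<and>
        ncount V g Y2 \<pi> (E \<inter> Pow Y2) \<le> (1 + \<xi>) ^ card D * dens p \<pi> (E \<inter> Pow Y2)"
      using less.hyps[OF _ l2 cards(2)] cc pos im by simp
    have d: "0 \<le> (1 - \<xi>) ^ card C * dens p \<pi> (E \<inter> Pow Y1)" "0 \<le> (1 - \<xi>) ^ card D * dens p \<pi> (E \<inter> Pow Y2)"
      using dens_nonneg[OF p l1] dens_nonneg[OF p l2] assms(4) by simp_all
    have "((1 - \<xi>) ^ card C * dens p \<pi> (E \<inter> Pow Y1)) * ((1 - \<xi>) ^ card D * dens p \<pi> (E \<inter> Pow Y2))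
        \<le> ncount V g Y \<pi> E"
      unfolding nc using b1 b2 d by (intro mult_mono) linarith+
    moreover have "ncount V g Y \<pi> E
        \<le> ((1 + \<xi>) ^ card C * dens p \<pi> (E \<inter> Pow Y1)) * ((1 + \<xi>) ^ card D * dens p \<pi> (E \<inter> Pow Y2))"
      unfolding nc using b1 b2 d by (intro mult_mono) linarith+
    ultimately show ?thesis
      unfolding de cc power_add by (simp add: mult_ac)
  qed
qed

lemma controlled_of_clustered:
  assumes g: "adapted H J V g" and p: "adapted_density H J p" and "0 \<le> \<xi>" "\<xi> \<le> 1"
    and ctrl: "controlled {f. clustered c f} k J V g p \<xi> c"
  shows "controlled UNIV k J V g p (2 ^ c * \<xi>) c"
  unfolding controlled_def
proof (intro allI impI)
  fix n :: nat and \<pi> :: "nat \<Rightarrow> 'j" and E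
  assume n: "n \<le> c" and Y: "labelled_complex k J {..<n} \<pi> E"
  let ?m = "card (\<pi> ` {..<n})" and ?d = "dens p \<pi> E"
  have m: "?m \<le> c"
    using card_image_le[of "{..<n}" \<pi>] n by simp
  have "real ?m < 2 ^ ?m"
    by (rule of_nat_less_two_power)
  moreover have "(2 :: real) ^ ?m \<le> 2 ^ c"
    using m by (simp add: power_increasing)
  ultimately have pw: "real ?m \<le> 2 ^ c" "(2 :: real) ^ ?m \<le> 2 ^ c"
    by linarith+
  have "(1 + \<xi>) ^ ?m \<le> 1 + (2 ^ ?m - 1) * \<xi>"
    by (rule power_one_plus_le[OF assms(3,4)])
  also have "\<dots> \<le> 1 + 2 ^ c * \<xi>"
    using pw(2) assms(3) by (intro add_left_mono mult_right_mono) linarith+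
  finally have up: "(1 + \<xi>) ^ ?m * ?d \<le> (1 + 2 ^ c * \<xi>) * ?d"
    using dens_nonneg[OF p Y] by (intro mult_right_mono)
  have "1 - 2 ^ c * \<xi> \<le> 1 + real ?m * (- \<xi>)"
    using mult_right_mono[OF pw(1) assms(3)] by simp
  also have "\<dots> \<le> (1 - \<xi>) ^ ?m"
    using Bernoulli_inequality[of "- \<xi>" ?m] assms(4) by simp
  finally have low: "(1 - 2 ^ c * \<xi>) * ?d \<le> (1 - \<xi>) ^ ?m * ?d"
    using dens_nonneg[OF p Y] by (intro mult_right_mono)
  have "card {..<n} \<le> c"
    using n by simp
  from clustered_counts_multiply[OF assms Y this] up low
  show "\<bar>ncount V g {..<n} \<pi> E - ?d\<bar> \<le> 2 ^ c * \<xi> * ?d"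
    by (auto simp: algebra_simps abs_le_iff)
qed

section \<open>Taking the link of one vertex\<close>

lemma insert_in_crossing_sets:
  assumes "adapted H J V g" "x \<in> J" "v \<in> V x" "f \<subseteq> J - {x}" "s \<in> crossing_sets V f"
  shows "insert v s \<in> crossing_sets V (insert x f)"
  using Un_in_crossing_sets[of V J "{x}" f "{v}" s] assms singleton_in_crossing_sets[of v V x]
  by (auto simp: adapted_def)

lemma adapted_link:
  assumes g: "adapted H J V g" and x: "x \<in> J" "v \<in> V x"
  shows "adapted H (J - {x}) V (link v g)"
  unfolding adapted_def
proof (intro conjI allI impI ballI)
  show "disjoint_family_on V (J - {x})"
    using g by (auto simp: adapted_def disjoint_family_on_def)
  show "finite (V j)" "V j \<noteq> {}" if "j \<in> J - {x}" for j
    using g that by (auto simp: adapted_def)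
  show "0 \<le> link v g e" if "e \<subseteq> \<Union> (V ` (J - {x}))" for e
  proof -
    have "e \<subseteq> \<Union> (V ` J)" "insert v e \<subseteq> \<Union> (V ` J)"
      using that x by auto
    then show ?thesis
      using g by (auto simp: adapted_def link_def)
  qed
  fix f s assume f: "f \<subseteq> J - {x}" "f \<notin> H" "s \<in> crossing_sets V f"
  then have "insert x f \<notin> H"
    using H_down by blast
  moreover have "insert v s \<in> crossing_sets V (insert x f)"
    by (rule insert_in_crossing_sets[OF g x f(1,3)])
  ultimately have "g (insert v s) = 1"
    using f x by (intro adapted_off_complex[OF g, of "insert x f"]) auto
  moreover have "g s = 1"
    using f by (intro adapted_off_complex[OF g, of f]) auto
  ultimately show "link v g s = 1"
    by (simp add: link_def)
qed

text \<open>
  If some index in \<open>f\<close> is not adjacent to \<open>x\<close>, then \<open>f\<close> together with \<open>x\<close> is not in \<open>H\<close>, and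
  adding \<open>v\<close> gives weight one.
\<close>

lemma link_eq_far:
  assumes g: "adapted H J V g" and x: "x \<in> J" "v \<in> V x"
    and f: "f \<subseteq> J - {x}" "s \<in> crossing_sets V f" "\<not> f \<subseteq> nbrs x"
  shows "link v g s = g s"
proof -
  obtain y where "y \<in> f" "y \<notin> nbrs x" using f(3) by blast
  then have "insert x f \<notin> H"
    using f(1) by (intro not_in_complex[of x _ y]) auto
  then have "g (insert v s) = 1"
    using insert_in_crossing_sets[OF g x f(1,2)] f x
    by (intro adapted_off_complex[OF g, of "insert x f"]) auto
  then show ?thesis
    by (simp add: link_def)
qed

lemma pin_vertex_far:
  assumes g: "adapted H J V g" and x: "x \<in> J" "v \<in> V x" and Q: "Q \<subseteq> J - {x}" "finite Q" "u \<in> PiE Q V"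
  shows "pin g Q u {v} = pin g (Q \<inter> nbrs x) u {v}"
  unfolding pin_def
proof (intro prod.mono_neutral_right ballI)
  fix S assume S: "S \<in> Pow Q - Pow (Q \<inter> nbrs x)"
  then obtain y where "y \<in> S" "y \<notin> nbrs x" by blast
  then have "insert x S \<notin> H"
    using S Q by (intro not_in_complex[of x _ y]) auto
  moreover have "insert v (u ` S) \<in> crossing_sets V (insert x S)"
    using S Q g by (intro insert_in_crossing_sets[OF g x] tuple_in_crossing_sets[of V J Q])
      (auto simp: adapted_def)
  ultimately show "g ({v} \<union> u ` S) = 1"
    using S Q x by (simp, intro adapted_off_complex[OF g, of "insert x S"]) auto
qed (use Q in auto)

section \<open>Guarded graphs\<close>

text \<open>
  Forbidden tuples account for all wrong counts: pins that spoil the count of a clustered complex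
  contain a forbidden tuple.
\<close>

definition covered ::
  "real \<Rightarrow> nat \<Rightarrow> 'j set \<Rightarrow> ('j \<Rightarrow> 'v set) \<Rightarrow> ('v set \<Rightarrow> real) \<Rightarrow> ('j set \<Rightarrow> real) \<Rightarrow>
   ('j set \<Rightarrow> ('j \<Rightarrow> 'v) set) \<Rightarrow> bool" where
  "covered \<xi> c J V g p Bad \<longleftrightarrow>
     (\<forall>n\<le>c. \<forall>(\<pi> :: nat \<Rightarrow> 'j) E Q u.
        labelled_complex k J {..<n} \<pi> E \<and> clustered c (\<pi> ` {..<n}) \<and>
        Q \<subseteq> J \<inter> frontier (\<pi> ` {..<n}) \<and> u \<in> PiE Q V \<longrightarrow>
        right_count \<xi> V g p Q u {..<n} \<pi> E \<or> (\<exists>Q0\<subseteq>Q. restrict u Q0 \<in> Bad Q0))"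

lemma coveredD:
  fixes \<pi> :: "nat \<Rightarrow> 'j"
  assumes "covered \<xi> c J V g p Bad" "n \<le> c" "labelled_complex k J {..<n} \<pi> E"
    "clustered c (\<pi> ` {..<n})" "Q \<subseteq> J \<inter> frontier (\<pi> ` {..<n})" "u \<in> PiE Q V"
  shows "right_count \<xi> V g p Q u {..<n} \<pi> E \<or> (\<exists>Q0\<subseteq>Q. restrict u Q0 \<in> Bad Q0)"
  using assms unfolding covered_def by simp

text \<open>
  The invariant of the embedding, with \<open>Bad Q\<close> the forbidden tuples on \<open>Q\<close>. The threshold for
  their mass grows by a factor \<open>1 / \<theta>\<close> whenever an index near \<open>Q\<close> is used up. Since it ends at
  \<open>\<theta>\<close>, it is below one all the time.
\<close>

definition guarded ::
  "real \<Rightarrow> real \<Rightarrow> nat \<Rightarrow> 'j set \<Rightarrow> ('j \<Rightarrow> 'v set) \<Rightarrow> ('v set \<Rightarrow> real) \<Rightarrow> ('j set \<Rightarrow> real) \<Rightarrow>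
   ('j set \<Rightarrow> ('j \<Rightarrow> 'v) set) \<Rightarrow> bool" where
  "guarded \<theta> \<xi> c J V g p Bad \<longleftrightarrow> finite J \<and> adapted H J V g \<and> adapted_density H J p \<and>
     (\<forall>Q. Bad Q \<noteq> {} \<longrightarrow> clustered (c + 2) Q) \<and>
     (\<forall>Q\<subseteq>J. mass V g Q (Bad Q) \<le> \<theta> ^ (lev (c + 2) J Q + 1) * pin_wt p Q (\<lambda>j. j)) \<and>
     covered \<xi> c J V g p Bad"

text \<open>
  The only tuple on the empty set has weight one, which is above the threshold.
\<close>

lemma guarded_Bad_empty:
  assumes "guarded \<theta> \<xi> c J V g p Bad" "\<theta> < 1"
  shows "(\<lambda>_. undefined) \<notin> Bad {}"
proof
  assume "(\<lambda>_. undefined) \<in> Bad {}"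
  then have "mass V g {} (Bad {}) = 1"
    by (simp add: mass_def)
  moreover have "mass V g {} (Bad {}) \<le> \<theta>"
    using assms(1) by (auto simp: guarded_def lev_def dest: spec[of _ "{}"])
  ultimately show False
    using assms(2) by simp
qed

text \<open>
  As the empty tuple is not forbidden, \<open>covered\<close> says for \<open>Q = {}\<close> that the counts of clustered
  complexes are right.
\<close>

lemma guarded_controlled:
  assumes guard: "guarded \<theta> \<xi> c J V g p Bad" and "\<theta> < 1" "0 \<le> \<xi>" "\<xi> \<le> 1"
  shows "controlled UNIV k J V g p (2 ^ c * \<xi>) c"
proof (rule controlled_of_clustered)
  show "controlled {f. clustered c f} k J V g p \<xi> c"
    unfolding controlled_def
  proof (intro allI impI)
    fix n :: nat and \<pi> :: "nat \<Rightarrow> 'j" and E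
    assume "n \<le> c" "labelled_complex k J {..<n} \<pi> E" "\<pi> ` {..<n} \<in> {f. clustered c f}"
    moreover have "\<exists>Q0\<subseteq>{}. restrict (\<lambda>_. undefined) Q0 \<in> Bad Q0 \<Longrightarrow> False"
      using guarded_Bad_empty[OF guard \<open>\<theta> < 1\<close>] by (auto simp: restrict_def)
    ultimately have "right_count \<xi> V g p {} (\<lambda>_. undefined) {..<n} \<pi> E"
      using guard unfolding guarded_def covered_def
      by (metis PiE_empty_domain empty_subsetI insertI1 mem_Collect_eq)
    then show "\<bar>ncount V g {..<n} \<pi> E - dens p \<pi> E\<bar> \<le> \<xi> * dens p \<pi> E"
      by (simp add: right_count_def)
  qed
qed (use assms in \<open>auto simp: guarded_def\<close>)

section \<open>Choosing the next vertex of a guarded graph\<close>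

text \<open>
  The forbidden tuples after the choice of \<open>v\<close> at \<open>x\<close>. The average over \<open>V x\<close> is the total weight
  that \<open>x\<close> has once \<open>u\<close> is pinned. A tuple that gives \<open>x\<close> more than twice the expected weight
  cannot be kept in the first clause, since choosing \<open>v\<close> might increase its weight too much; the
  third clause forbids its part on the neighbours of \<open>x\<close> instead. The second clause takes slices
  at \<open>v\<close>.
\<close>

definition next_bad ::
  "('j \<Rightarrow> 'v set) \<Rightarrow> ('v set \<Rightarrow> real) \<Rightarrow> ('j set \<Rightarrow> real) \<Rightarrow> 'j \<Rightarrow> ('j set \<Rightarrow> ('j \<Rightarrow> 'v) set) \<Rightarrow>
   'v \<Rightarrow> 'j set \<Rightarrow> ('j \<Rightarrow> 'v) set" where
  "next_bad V g p x Bad v Q =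
     {u \<in> Bad Q. avg (V x) (\<lambda>v. pin g Q u {v}) \<le> 2 * pin p Q (\<lambda>j. j) {x}} \<union>
     {u. u(x := v) \<in> Bad (insert x Q)} \<union>
     {u. Q \<subseteq> nbrs x \<and> 2 * pin p Q (\<lambda>j. j) {x} < avg (V x) (\<lambda>v. pin g Q u {v})}"

text \<open>
  The total weight of \<open>x\<close> depends only on the pins at neighbours of \<open>x\<close>. So if a forbidden tuple
  is not kept, its restriction to these neighbours is newly forbidden.
\<close>

lemma next_bad_of_bad:
  assumes g: "adapted H J V g" and p: "adapted_density H J p" and x: "x \<in> J"
    and Q: "Q \<subseteq> J - {x}" "finite Q" "u \<in> PiE Q V" "restrict u Q \<in> Bad Q"
  shows "\<exists>Q1\<subseteq>Q. restrict u Q1 \<in> next_bad V g p x Bad v Q1"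
proof (cases "avg (V x) (\<lambda>v. pin g Q (restrict u Q) {v}) \<le> 2 * pin p Q (\<lambda>j. j) {x}")
  case True
  then show ?thesis
    using Q(4) by (intro exI[of _ Q]) (auto simp: next_bad_def)
next
  case False
  let ?A = "Q \<inter> nbrs x"
  have "pin g ?A (restrict u ?A) {v} = pin g Q (restrict u Q) {v}" if "v \<in> V x" for v
  proof -
    have "pin g ?A (restrict u ?A) {v} = pin g ?A u {v}" "pin g Q (restrict u Q) {v} = pin g Q u {v}"
      by (auto intro!: pin_cong)
    then show ?thesis
      using pin_vertex_far[OF g x that Q(1-3)] by simp
  qed
  then have "avg (V x) (\<lambda>v. pin g ?A (restrict u ?A) {v}) = avg (V x) (\<lambda>v. pin g Q (restrict u Q) {v})"
    by (intro avg_cong) auto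
  moreover have "pin p ?A (\<lambda>j. j) {x} = pin p Q (\<lambda>j. j) {x}"
  proof -
    have "pin p ?A (restrict (\<lambda>j. j) Q) {x} = pin p ?A (\<lambda>j. j) {x}"
      "pin p Q (restrict (\<lambda>j. j) Q) {x} = pin p Q (\<lambda>j. j) {x}"
      by (auto intro!: pin_cong)
    moreover have "pin p Q (restrict (\<lambda>j. j) Q) {x} = pin p ?A (restrict (\<lambda>j. j) Q) {x}"
      by (rule pin_vertex_far[OF p x]) (use Q(1,2) in simp_all)
    ultimately show ?thesis
      by simp
  qed
  ultimately have "restrict u ?A \<in> next_bad V g p x Bad v ?A"
    using False unfolding next_bad_def by simp
  then show ?thesis
    by (intro exI[of _ ?A]) simp
qed

text \<open>
  If \<open>x\<close> is in the frontier, the counts in the link of \<open>v\<close> are those with \<open>v\<close> as an additional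
  pin; otherwise \<open>v\<close> does not influence them.
\<close>

lemma covered_next:
  assumes g: "adapted H J V g" and p: "adapted_density H J p" and x: "x \<in> J" "v \<in> V x" and "finite J"
    and cov: "covered \<xi> c J V g p Bad"
  shows "covered \<xi> c (J - {x}) V (link v g) (link x p) (next_bad V g p x Bad v)"
  unfolding covered_def
proof (intro allI impI, elim conjE)
  fix n :: nat and \<pi> :: "nat \<Rightarrow> 'j" and E Q u
  let ?f = "\<pi> ` {..<n}"
  let ?goal = "right_count \<xi> V (link v g) (link x p) Q u {..<n} \<pi> E \<or>
      (\<exists>Q0\<subseteq>Q. restrict u Q0 \<in> next_bad V g p x Bad v Q0)"
  assume n: "n \<le> c" and Y': "labelled_complex k (J - {x}) {..<n} \<pi> E" and cl: "clustered c ?f"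
    and Q: "Q \<subseteq> (J - {x}) \<inter> frontier ?f" and u: "u \<in> PiE Q V"
  have Y: "labelled_complex k J {..<n} \<pi> E"
    using Y' by (rule labelled_complex_mono) auto
  have f: "?f \<subseteq> J - {x}"
    using Y' by (simp add: labelled_complex_def)
  have QJ: "Q \<subseteq> J - {x}" "finite Q" "x \<notin> Q"
    using Q \<open>finite J\<close> by (auto intro: finite_subset)
  have old: ?goal if "Q0 \<subseteq> Q" "restrict u Q0 \<in> Bad Q0" for Q0
  proof -
    have "restrict u Q0 \<in> PiE Q0 V"
      using u that(1) by (auto simp: PiE_def Pi_def)
    moreover have "Q0 \<subseteq> J - {x}" "finite Q0" "restrict (restrict u Q0) Q0 \<in> Bad Q0"
      using that QJ finite_subset[OF that(1)] by simp_all
    ultimately obtain Q1 where Q1: "Q1 \<subseteq> Q0" "restrict (restrict u Q0) Q1 \<in> next_bad V g p x Bad v Q1"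
      using next_bad_of_bad[OF g p x(1), of Q0 "restrict u Q0" Bad v] by blast
    moreover have "restrict (restrict u Q0) Q1 = restrict u Q1"
      using Q1(1) by (auto simp: fun_eq_iff)
    ultimately show ?thesis
      using that(1) by auto
  qed
  show ?goal
  proof (cases "x \<in> frontier ?f")
    case True
    have "u(x := v) \<in> PiE (insert x Q) V"
      using u x by (auto simp: PiE_def Pi_def extensional_def)
    moreover have "insert x Q \<subseteq> J \<inter> frontier ?f"
      using Q True x by auto
    ultimately have "right_count \<xi> V g p (insert x Q) (u(x := v)) {..<n} \<pi> E \<or>
        (\<exists>Q0\<subseteq>insert x Q. restrict (u(x := v)) Q0 \<in> Bad Q0)"
      by (intro coveredD[OF cov n Y cl])
    then consider "right_count \<xi> V g p (insert x Q) (u(x := v)) {..<n} \<pi> E"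
      | Q0 where "Q0 \<subseteq> insert x Q" "restrict (u(x := v)) Q0 \<in> Bad Q0"
      by (elim disjE exE conjE)
    then show ?thesis
    proof cases
      case 1
      have "pin (link v g) Q u = pin g (insert x Q) (u(x := v))"
        by (intro ext pin_link[OF QJ(3,2)])
      moreover have "pin (link x p) Q (\<lambda>j. j) = pin p (insert x Q) ((\<lambda>j. j)(x := x))"
        by (intro ext pin_link[OF QJ(3,2)])
      then have "pin (link x p) Q (\<lambda>j. j) = pin p (insert x Q) (\<lambda>j. j)"
        by (simp add: fun_upd_idem)
      ultimately show ?thesis
        using 1 by (simp add: right_count_def)
    next
      case (2 Q0)
      show ?thesis
      proof (cases "x \<in> Q0")
        case True
        define Q1 where "Q1 = Q0 - {x}"
        have Q1: "Q0 = insert x Q1" "x \<notin> Q1"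
          using True by (auto simp: Q1_def)
        have "(restrict u Q1)(x := v) = restrict (u(x := v)) Q0"
          unfolding Q1(1) by (auto simp: fun_eq_iff)
        then have "restrict u Q1 \<in> next_bad V g p x Bad v Q1"
          using 2(2) Q1(1) by (simp add: next_bad_def)
        then show ?thesis
          using 2(1) Q1 by blast
      next
        case False
        then have "restrict (u(x := v)) Q0 = restrict u Q0" "Q0 \<subseteq> Q"
          using 2(1) by (auto simp: fun_eq_iff)
        then show ?thesis
          using old 2(2) by simp
      qed
    qed
  next
    case False
    have far: "\<not> \<pi> ` e \<union> S \<subseteq> nbrs x" "\<pi> ` e \<union> S \<subseteq> J - {x}" if e: "e \<in> E" "e \<noteq> {}" and "S \<subseteq> Q" for e S
    proof -
      show "\<pi> ` e \<union> S \<subseteq> J - {x}"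
        using labelled_complex_edgeD(4)[OF Y' e(1)] QJ that(3) by auto
      obtain y where y: "y \<in> e"
        using e(2) by blast
      then have "\<pi> y \<in> ?f"
        using labelled_complex_edgeD(1)[OF Y' e(1)] by auto
      then have "\<pi> y \<notin> nbrs x"
        using False nbrs_sym f by (auto simp: frontier_def)
      then show "\<not> \<pi> ` e \<union> S \<subseteq> nbrs x"
        using y by blast
    qed
    have "ncount V (pin (link v g) Q u) {..<n} \<pi> E = ncount V (pin g Q u) {..<n} \<pi> E"
    proof (rule ncount_cong[OF refl])
      fix e \<phi> assume e: "e \<in> E" "e \<noteq> {}" and \<phi>: "\<phi> \<in> PiE {..<n} (\<lambda>y. V (\<pi> y))"
      have disj: "disjoint_family_on V J"
        using g by (simp add: adapted_def)
      have "\<phi> y \<in> V (\<pi> y)" if "y \<in> e" for y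
        using PiE_mem[OF \<phi>] labelled_complex_edgeD(1)[OF Y e(1)] that by blast
      then have c1: "\<phi> ` e \<in> crossing_sets V (\<pi> ` e)"
        using labelled_complex_edgeD[OF Y e(1)] disj by (intro image_in_crossing_sets)
      have "link v g (\<phi> ` e \<union> u ` S) = g (\<phi> ` e \<union> u ` S)" if S: "S \<in> Pow Q" for S
      proof (rule link_eq_far[OF g x])
        have "\<pi> ` e \<inter> S = {}"
        proof -
          have "\<pi> ` e \<subseteq> ?f"
            using labelled_complex_edgeD(1)[OF Y' e(1)] by (rule image_mono)
          then show ?thesis
            using S Q unfolding frontier_def by blast
        qed
        moreover have "u ` S \<in> crossing_sets V S"
          using S QJ u by (intro tuple_in_crossing_sets[OF disj]) auto
        ultimately show "\<phi> ` e \<union> u ` S \<in> crossing_sets V (\<pi> ` e \<union> S)"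
          using far(2)[OF e, of S] S by (intro Un_in_crossing_sets[OF disj] c1) auto
      qed (use far[OF e, of S] S in auto)
      then show "pin (link v g) Q u (\<phi> ` e) = pin g Q u (\<phi> ` e)"
        unfolding pin_def by (intro prod.cong) auto
    qed
    moreover have "dens (pin (link x p) Q (\<lambda>j. j)) \<pi> E = dens (pin p Q (\<lambda>j. j)) \<pi> E"
    proof (rule dens_cong)
      fix e assume e: "e \<in> E" "e \<noteq> {}"
      have "link x p (\<pi> ` e \<union> S) = p (\<pi> ` e \<union> S)" if S: "S \<in> Pow Q" for S
        using far[OF e, of S] S x(1)
        by (intro link_eq_far[OF p x(1), of x "\<pi> ` e \<union> S"]) (auto simp: crossing_sets_singletons)
      then show "pin (link x p) Q (\<lambda>j. j) (\<pi> ` e) = pin p Q (\<lambda>j. j) (\<pi> ` e)"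
        unfolding pin_def by (intro prod.cong) auto
    qed
    moreover have "right_count \<xi> V g p Q u {..<n} \<pi> E \<or> (\<exists>Q0\<subseteq>Q. restrict u Q0 \<in> Bad Q0)"
      using Q by (intro coveredD[OF cov n Y cl _ u]) auto
    ultimately show ?thesis
      using old unfolding right_count_def by auto
  qed
qed

text \<open>
  The three clauses of \<open>next_bad\<close> contribute \<open>2 * t\<close>, \<open>t\<close> and \<open>8 * \<epsilon>\<close>. For the first, the total
  weight of \<open>x\<close> is at most twice the expected one. The average over \<open>v\<close> of the mass of the slices
  is the mass on \<open>insert x Q\<close>. For the third, \<open>excess_count_rare\<close> applies to the complex that
  consists of the single vertex \<open>x\<close>, with at most \<open>\<Delta>\<close> pins.
\<close>

lemma next_mass_le:
  assumes g: "adapted H J V g" and p: "adapted_density H J p" and x: "x \<in> J" and Q: "Q \<subseteq> J - {x}" "finite Q"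
    and ctrl: "controlled UNIV k J V g p \<epsilon> c" and k: "1 \<le> k" "\<Delta> + 2 \<le> c" and "0 \<le> \<epsilon>" "0 \<le> t"
    and m1: "mass V g Q (Bad Q) \<le> t * pin_wt p Q (\<lambda>j. j)"
    and m2: "mass V g (insert x Q) (Bad (insert x Q)) \<le> t * pin_wt p (insert x Q) (\<lambda>j. j)"
  shows "avg (V x) (\<lambda>v. g {v} * mass V (link v g) Q (next_bad V g p x Bad v Q))
         \<le> (3 * t + 8 * \<epsilon>) * (p {x} * pin_wt (link x p) Q (\<lambda>j. j))"
proof -
  let ?id = "\<lambda>j. j :: 'j"
  define Z where "Z = (\<lambda>u. avg (V x) (\<lambda>v. pin g Q u {v}))"
  define \<zeta> where "\<zeta> = pin p Q ?id {x}"
  define W where "W = pin_wt p Q ?id"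
  have fold: "avg (V x) (\<lambda>v. pin g Q u {v}) = Z u" for u
    by (simp add: Z_def)
  have "x \<notin> Q" and QJ: "Q \<subseteq> J"
    using Q by auto
  have tot: "W * \<zeta> = p {x} * pin_wt (link x p) Q ?id"
    using pin_wt_link[OF Q(2), of p x] by (simp add: W_def \<zeta>_def)
  have tot': "pin_wt p (insert x Q) ?id = W * \<zeta>"
    using pin_wt_insert[OF \<open>x \<notin> Q\<close> Q(2), of p ?id x] by (simp add: W_def \<zeta>_def fun_upd_idem)
  have \<zeta>: "0 \<le> \<zeta>" and W: "0 \<le> W"
    unfolding \<zeta>_def W_def using x by (auto intro!: adapted_density_nonneg[OF p QJ])
  note w = pin_wt_nonneg[OF g QJ]
  have pl: "0 \<le> pin g Q u {v}" if "u \<in> PiE Q V" "v \<in> V x" for u v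
    using x that by (intro pin_nonneg[OF g QJ]) auto
  let ?b1 = "\<lambda>u. of_bool (u \<in> Bad Q \<and> Z u \<le> 2 * \<zeta>) :: real"
  let ?b2 = "\<lambda>v u. of_bool (u(x := v) \<in> Bad (insert x Q)) :: real"
  let ?b3 = "\<lambda>u. of_bool (Q \<subseteq> nbrs x \<and> 2 * \<zeta> < Z u) :: real"
  have "avg (V x) (\<lambda>v. g {v} * mass V (link v g) Q (next_bad V g p x Bad v Q)) =
      avg (V x) (\<lambda>v. avg (PiE Q V) (\<lambda>u. pin_wt g Q u * pin g Q u {v} *
        of_bool (u \<in> next_bad V g p x Bad v Q)))"
    unfolding mass_def avg_mult_left[symmetric] mult.assoc[symmetric] pin_wt_link[OF Q(2)] ..
  also have "\<dots> \<le> avg (V x) (\<lambda>v. avg (PiE Q V) (\<lambda>u. pin_wt g Q u * pin g Q u {v} * (?b1 u + ?b2 v u + ?b3 u)))"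
    using w pl
    by (intro avg_mono mult_left_mono mult_nonneg_nonneg)
       (auto simp: next_bad_def fold \<zeta>_def[symmetric])
  also have "\<dots> = avg (V x) (\<lambda>v. avg (PiE Q V) (\<lambda>u. pin_wt g Q u * pin g Q u {v} * ?b1 u)) +
      avg (V x) (\<lambda>v. avg (PiE Q V) (\<lambda>u. pin_wt g Q u * pin g Q u {v} * ?b2 v u)) +
      avg (V x) (\<lambda>v. avg (PiE Q V) (\<lambda>u. pin_wt g Q u * pin g Q u {v} * ?b3 u))"
    by (simp add: distrib_left avg_add)
  also have "avg (V x) (\<lambda>v. avg (PiE Q V) (\<lambda>u. pin_wt g Q u * pin g Q u {v} * ?b1 u)) \<le> 2 * t * (W * \<zeta>)"
  proof -
    have "avg (V x) (\<lambda>v. avg (PiE Q V) (\<lambda>u. pin_wt g Q u * pin g Q u {v} * ?b1 u)) =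
        avg (PiE Q V) (\<lambda>u. pin_wt g Q u * ?b1 u * Z u)"
      unfolding Z_def avg_mult_left[symmetric] by (subst avg_swap) (simp add: mult_ac)
    also have "\<dots> \<le> avg (PiE Q V) (\<lambda>u. 2 * \<zeta> * (pin_wt g Q u * of_bool (u \<in> Bad Q)))"
    proof (rule avg_mono)
      fix u assume u: "u \<in> PiE Q V"
      show "pin_wt g Q u * ?b1 u * Z u \<le> 2 * \<zeta> * (pin_wt g Q u * of_bool (u \<in> Bad Q))"
        using mult_left_mono[OF _ w[OF u], of "Z u" "2 * \<zeta>"] w[OF u] \<zeta> by (auto simp: mult_ac)
    qed
    also have "\<dots> = 2 * \<zeta> * mass V g Q (Bad Q)"
      by (simp add: avg_mult_left mass_def)
    also have "\<dots> \<le> 2 * \<zeta> * (t * W)"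
      using m1 \<zeta> by (intro mult_left_mono) (auto simp: W_def)
    finally show ?thesis
      by (simp add: mult_ac)
  qed
  also have "avg (V x) (\<lambda>v. avg (PiE Q V) (\<lambda>u. pin_wt g Q u * pin g Q u {v} * ?b2 v u)) \<le> t * (W * \<zeta>)"
    using m2 unfolding mass_def avg_PiE_insert[OF \<open>x \<notin> Q\<close>] pin_wt_insert[OF \<open>x \<notin> Q\<close> Q(2)] tot' .
  also have "avg (V x) (\<lambda>v. avg (PiE Q V) (\<lambda>u. pin_wt g Q u * pin g Q u {v} * ?b3 u)) \<le> 8 * \<epsilon> * (W * \<zeta>)"
  proof (cases "Q \<subseteq> nbrs x")
    case True
    have "card Q \<le> \<Delta>"
      using card_mono[OF finite_nbrs True] card_nbrs[of x] by simp
    have "avg (V x) (\<lambda>v. avg (PiE Q V) (\<lambda>u. pin_wt g Q u * pin g Q u {v} * ?b3 u)) =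
        avg (PiE Q V) (\<lambda>u. pin_wt g Q u * (of_bool (2 * \<zeta> < Z u) * Z u))"
      unfolding Z_def avg_mult_left[symmetric] using True by (subst avg_swap) (simp add: mult_ac)
    also have "\<dots> \<le> 8 * \<epsilon> * \<zeta> * W"
      using excess_count_rare[OF g p ctrl labelled_complex_vertex[OF k(1) x] QJ Q(2)] \<open>x \<notin> Q\<close>
        \<open>card Q \<le> \<Delta>\<close> k(2)
      by (simp add: ncount_vertex dens_vertex Z_def \<zeta>_def W_def)
    finally show ?thesis
      by (simp add: mult_ac)
  next
    case False
    then show ?thesis
      using \<open>0 \<le> \<epsilon>\<close> W \<zeta> by simp
  qed
  finally show ?thesis
    by (simp add: tot algebra_simps)
qed

text \<open>
  No index in \<open>Q\<close> is adjacent to \<open>x\<close>, so weights of tuples on \<open>Q\<close> do not change, and \<open>insert x Q\<close>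
  is not clustered, so there are no slices.
\<close>

lemma next_mass_far:
  assumes g: "adapted H J V g" and p: "adapted_density H J p" and x: "x \<in> J" "v \<in> V x"
    and Q: "Q \<subseteq> J - {x}" "finite Q" "Q \<noteq> {}" and far: "x \<notin> (\<Union>q\<in>Q. nbhd r q)" and "1 \<le> r"
    and bad: "\<And>Q. Bad Q \<noteq> {} \<Longrightarrow> clustered r Q"
    and Z: "avg (V x) (\<lambda>v. g {v}) \<le> 2 * p {x}"
  shows "mass V (link v g) Q (next_bad V g p x Bad v Q) = mass V g Q (Bad Q)"
    and "pin_wt (link x p) Q (\<lambda>j. j) = pin_wt p Q (\<lambda>j. j)"
    and "lev r (J - {x}) Q = lev r J Q"
proof -
  have "Q \<inter> nbrs x = {}"
  proof -
    have "q \<notin> nbrs x" if "q \<in> Q" for q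
    proof
      assume "q \<in> nbrs x"
      then have "x \<in> nbhd 1 q"
        using nbrs_sym by (intro nbrs_nbhd_1) blast
      then show False
        using far that nbhd_mono[OF \<open>1 \<le> r\<close>, of q] by blast
    qed
    then show ?thesis by auto
  qed
  have pin_wt_eq: "pin_wt (link v' g') Q u = pin_wt g' Q u"
    if "adapted H J V' g'" "v' \<in> V' x" "u \<in> PiE Q V'" for V' :: "'j \<Rightarrow> 'z set" and g' v' u
    unfolding pin_wt_def
  proof (intro prod.cong refl)
    fix S assume S: "S \<in> Pow Q - {{}}"
    then have "\<not> S \<subseteq> nbrs x"
      using \<open>Q \<inter> nbrs x = {}\<close> by auto
    moreover have "u ` S \<in> crossing_sets V' S"
      using S Q that(1,3) by (intro tuple_in_crossing_sets[of V' J Q]) (auto simp: adapted_def)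
    ultimately show "link v' g' (u ` S) = g' (u ` S)"
      using S Q by (intro link_eq_far[OF that(1) x(1) that(2), of S]) auto
  qed
  show "pin_wt (link x p) Q (\<lambda>j. j) = pin_wt p Q (\<lambda>j. j)"
    using pin_wt_eq[OF p, of x "restrict (\<lambda>j. j) Q"] pin_wt_cong[of Q "restrict (\<lambda>j. j) Q" "\<lambda>j. j"] by simp
  have "Bad (insert x Q) = {}"
  proof (rule ccontr)
    assume "Bad (insert x Q) \<noteq> {}"
    from bad[OF this] far Q(3) show False
      by (auto simp: clustered_def)
  qed
  moreover have "avg (V x) (\<lambda>v. pin g Q u {v}) \<le> 2 * pin p Q (\<lambda>j. j) {x}" if "u \<in> PiE Q V" for u
  proof -
    have "avg (V x) (\<lambda>v. pin g Q u {v}) = avg (V x) (\<lambda>v. g {v})"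
      using pin_vertex_far[OF g x(1) _ Q(1,2) that] \<open>Q \<inter> nbrs x = {}\<close> by (intro avg_cong) auto
    moreover have "pin p Q (\<lambda>j. j) {x} = pin p Q (restrict (\<lambda>j. j) Q) {x}"
      by (rule pin_cong) simp
    then have "pin p Q (\<lambda>j. j) {x} = p {x}"
      using pin_vertex_far[OF p x(1) _ Q(1,2), of x "restrict (\<lambda>j. j) Q"] \<open>Q \<inter> nbrs x = {}\<close> by simp
    ultimately show ?thesis
      using Z by simp
  qed
  moreover have "\<not> Q \<subseteq> nbrs x"
    using \<open>Q \<inter> nbrs x = {}\<close> Q(3) by auto
  ultimately show "mass V (link v g) Q (next_bad V g p x Bad v Q) = mass V g Q (Bad Q)"
    unfolding mass_def by (intro avg_cong refl) (auto simp: next_bad_def pin_wt_eq[OF g x(2)])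
  show "lev r (J - {x}) Q = lev r J Q"
    unfolding lev_def using far by (intro arg_cong[of _ _ card]) auto
qed

text \<open>
  On average the mass on a set near \<open>x\<close> grows by a constant factor, while its threshold grows by
  the factor \<open>1 / \<theta>\<close>, so by Markov's inequality only a proportion \<open>11 * \<theta>\<close> of the vertices at \<open>x\<close>
  violates it. There are at most \<open>2 ^ D\<close> such sets.
\<close>

lemma guarded_next:
  fixes c :: nat
  defines "D \<equiv> (\<Delta> + 1) ^ (2 * (c + 2))"
  assumes guard: "guarded \<theta> \<xi> c J V g p Bad" and x: "x \<in> J"
    and \<theta>: "0 < \<theta>" "\<theta> < 1" "2 ^ D * (22 * \<theta>) \<le> \<eta>" and \<eta>: "\<eta> \<le> 1" and \<xi>: "0 \<le> \<xi>" "\<xi> \<le> 1" "2 ^ c * \<xi> \<le> \<theta> ^ (D + 2)"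
    and k: "1 \<le> k" "\<Delta> + 2 \<le> c"
  obtains V' where "V' \<subseteq> V x" "(1 - \<eta>) * vertex_norm (V x) g (V x) \<le> vertex_norm (V x) g V'"
    "\<And>v. v \<in> V' \<Longrightarrow> guarded \<theta> \<xi> c (J - {x}) V (link v g) (link x p) (next_bad V g p x Bad v)"
proof -
  let ?id = "\<lambda>j. j :: 'j"
  let ?r = "c + 2" and ?J = "J - {x}"
  let ?B = "next_bad V g p x Bad" and ?p = "link x p"
  define \<epsilon> where "\<epsilon> = 2 ^ c * \<xi>"
  have fin: "finite J" and g: "adapted H J V g" and p: "adapted_density H J p"
    and bad: "\<And>Q. Bad Q \<noteq> {} \<Longrightarrow> clustered ?r Q"
    and mass: "\<And>Q. Q \<subseteq> J \<Longrightarrow> mass V g Q (Bad Q) \<le> \<theta> ^ (lev ?r J Q + 1) * pin_wt p Q ?id"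
    and cov: "covered \<xi> c J V g p Bad"
    using guard by (auto simp: guarded_def)
  have finV: "finite (V x)" "V x \<noteq> {}"
    using g x by (auto simp: adapted_def)
  have ctrl: "controlled UNIV k J V g p \<epsilon> c"
    unfolding \<epsilon>_def by (rule guarded_controlled[OF guard \<theta>(2) \<xi>(1,2)])
  have \<epsilon>: "0 \<le> \<epsilon>" "\<epsilon> \<le> \<theta> ^ (D + 2)"
    using \<xi> by (simp_all add: \<epsilon>_def)
  have px: "0 \<le> p {x}"
    using adapted_densityD(1)[OF p, of "{x}"] x by simp
  have g0: "0 \<le> g {v}" if "v \<in> V x" for v
  proof -
    have "{v} \<subseteq> \<Union> (V ` J)"
      using x that by auto
    then show ?thesis
      using g by (simp add: adapted_def)
  qed
  have "\<theta> ^ (D + 2) \<le> \<theta>"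
    using \<theta> power_decreasing[of 1 "D + 2" \<theta>] by simp
  have "1 * (22 * \<theta>) \<le> 2 ^ D * (22 * \<theta>)"
    using \<theta> by (intro mult_right_mono) auto
  then have "\<epsilon> \<le> 1 / 2" and "0 \<le> \<eta>"
    using \<epsilon> \<open>\<theta> ^ (D + 2) \<le> \<theta>\<close> \<theta> \<eta> by linarith+
  have vert: "\<bar>avg (V x) (\<lambda>v. g {v}) - p {x}\<bar> \<le> \<epsilon> * p {x}"
    using k by (intro controlled_vertex[OF ctrl _ _ x]) auto
  have g': "adapted H ?J V (link v g)" if "v \<in> V x" for v
    by (rule adapted_link[OF g x that])
  have p': "adapted_density H ?J ?p"
    by (rule adapted_link[OF p x]) simp
  \<comment> \<open>Masses on other sets do not change. The empty set is special: it has no indices near it, but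
    the slices on \<open>{x}\<close> end up there.\<close>
  define near where "near = {Q. Q \<subseteq> ?J \<and> clustered ?r Q \<and> (Q = {} \<or> x \<in> (\<Union>q\<in>Q. nbhd ?r q))}"
  have card_near: "card near \<le> 2 ^ D"
    unfolding near_def D_def using fin by (intro card_clustered_near) auto
  have fin_near: "finite near"
    unfolding near_def using fin by simp
  define t where "t = (\<lambda>Q. \<theta> ^ (lev ?r ?J Q + 1))"
  define ok where "ok = (\<lambda>v Q. mass V (link v g) Q (?B v Q) \<le> t Q * pin_wt ?p Q ?id)"
  define V' where "V' = {v \<in> V x. \<forall>Q\<in>near. ok v Q}"

  \<comment> \<open>The old thresholds carry an additional factor \<open>\<theta>\<close>, as \<open>x\<close> itself is one of the indices near
    \<open>insert x Q\<close> and, unless \<open>Q\<close> is empty, near \<open>Q\<close>. The old mass on the empty set is zero.\<close>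
  have rare: "avg (V x) (\<lambda>v. g {v} * of_bool (\<not> ok v Q)) \<le> 11 * \<theta> * p {x}" if Q: "Q \<in> near" for Q
  proof -
    have QJ: "Q \<subseteq> ?J" "finite Q" "Q \<subseteq> J" "insert x Q \<subseteq> J" and cl: "clustered ?r Q"
      using Q fin x by (auto simp: near_def intro: finite_subset)
    have T: "0 < t Q"
      using \<theta> by (simp add: t_def)
    have W: "0 \<le> pin_wt ?p Q ?id"
      by (rule adapted_density_nonneg(1)[OF p' QJ(1)])
    have "mass V g (insert x Q) (Bad (insert x Q)) \<le> \<theta> * t Q * pin_wt p (insert x Q) ?id"
    proof -
      have "lev ?r ?J Q < lev ?r J (insert x Q)"
        unfolding lev_def using fin x self_in_nbhd by (intro psubset_card_mono) auto
      then have "\<theta> ^ (lev ?r J (insert x Q) + 1) \<le> \<theta> * t Q"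
        unfolding t_def power_Suc[symmetric] using \<theta> by (intro power_decreasing) auto
      then show ?thesis
        using mass[OF QJ(4)] adapted_density_nonneg(1)[OF p QJ(4)]
        by (meson mult_right_mono order_trans)
    qed
    moreover have "mass V g Q (Bad Q) \<le> \<theta> * t Q * pin_wt p Q ?id"
    proof (cases "Q = {}")
      case True
      then have "mass V g Q (Bad Q) = 0"
        using guarded_Bad_empty[OF guard \<theta>(2)] by (simp add: mass_def)
      then show ?thesis
        using T \<theta> adapted_density_nonneg(1)[OF p QJ(3)] by simp
    next
      case False
      then have "x \<in> (\<Union>q\<in>Q. nbhd ?r q)"
        using Q by (auto simp: near_def)
      then have "lev ?r ?J Q < lev ?r J Q"
        unfolding lev_def using fin x by (intro psubset_card_mono) auto
      then have "\<theta> ^ (lev ?r J Q + 1) \<le> \<theta> * t Q"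
        unfolding t_def power_Suc[symmetric] using \<theta> by (intro power_decreasing) auto
      then show ?thesis
        using mass[OF QJ(3)] adapted_density_nonneg(1)[OF p QJ(3)]
        by (meson mult_right_mono order_trans)
    qed
    ultimately have "avg (V x) (\<lambda>v. g {v} * mass V (link v g) Q (?B v Q))
        \<le> (3 * (\<theta> * t Q) + 8 * \<epsilon>) * (p {x} * pin_wt ?p Q ?id)"
      using \<theta> T \<epsilon> by (intro next_mass_le[OF g p x QJ(1,2) ctrl k]) auto
    also have "\<dots> \<le> (11 * (\<theta> * t Q)) * (p {x} * pin_wt ?p Q ?id)"
    proof (rule mult_right_mono)
      have "lev ?r ?J Q \<le> D"
        unfolding D_def by (rule lev_le[OF cl])
      then have "\<theta> ^ (D + 2) \<le> \<theta> * t Q"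
        unfolding t_def power_Suc[symmetric] using \<theta> by (intro power_decreasing) auto
      then show "3 * (\<theta> * t Q) + 8 * \<epsilon> \<le> 11 * (\<theta> * t Q)"
        using \<epsilon> by simp
    qed (use px W in auto)
    also have "\<dots> = (11 * \<theta> * p {x}) * (t Q * pin_wt ?p Q ?id)"
      by (simp add: mult_ac)
    finally have "avg (V x) (\<lambda>v. g {v} * of_bool (t Q * pin_wt ?p Q ?id < mass V (link v g) Q (?B v Q)))
        \<le> 11 * \<theta> * p {x}"
    proof (intro avg_Markov finV g0 T W)
      show "0 \<le> mass V (link v g) Q (?B v Q)" if "v \<in> V x" for v
        unfolding mass_def using pin_wt_nonneg[OF g'[OF that] QJ(1)] by (intro avg_nonneg) auto
    qed (use \<theta> px in auto)
    then show ?thesis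
      by (simp add: ok_def not_le)
  qed
  have "avg (V x) (\<lambda>v. g {v} * of_bool (v \<notin> V')) \<le> avg (V x) (\<lambda>v. \<Sum>Q\<in>near. g {v} * of_bool (\<not> ok v Q))"
  proof (rule avg_mono)
    fix v assume v: "v \<in> V x"
    have nn: "0 \<le> g {v} * of_bool (\<not> ok v Q)" for Q
      using g0[OF v] by simp
    show "g {v} * of_bool (v \<notin> V') \<le> (\<Sum>Q\<in>near. g {v} * of_bool (\<not> ok v Q))"
    proof (cases "v \<in> V'")
      case True
      then show ?thesis
        using nn by (simp add: sum_nonneg)
    next
      case False
      then obtain Q where "Q \<in> near" "\<not> ok v Q"
        using v by (auto simp: V'_def)
      then have "g {v} * of_bool (v \<notin> V') = g {v} * of_bool (\<not> ok v Q)"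
        using False by simp
      also have "\<dots> \<le> (\<Sum>Q\<in>near. g {v} * of_bool (\<not> ok v Q))"
        using \<open>Q \<in> near\<close> by (rule member_le_sum) (use nn fin_near in simp_all)
      finally show ?thesis .
    qed
  qed
  also have "\<dots> \<le> (\<Sum>Q\<in>near. 11 * \<theta> * p {x})"
    unfolding avg_sum by (intro sum_mono rare)
  also have "\<dots> \<le> 2 ^ D * (11 * \<theta> * p {x})"
  proof -
    have "real (card near) \<le> real (2 ^ D)"
      using card_near by (rule of_nat_mono)
    then have "real (card near) \<le> 2 ^ D"
      by simp
    then have "real (card near) * (11 * \<theta> * p {x}) \<le> 2 ^ D * (11 * \<theta> * p {x})"
      by (rule mult_right_mono) (use \<theta> px in simp)
    then show ?thesis
      by simp
  qed
  also have "\<dots> \<le> \<eta> * (p {x} / 2)"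
    using mult_right_mono[OF \<theta>(3) px] by simp
  finally have lost: "avg (V x) (\<lambda>v. g {v} * of_bool (v \<notin> V')) \<le> \<eta> * (p {x} / 2)" .
  have norm: "vertex_norm (V x) g U = avg (V x) (\<lambda>v. indicator U v * g {v})" for U
    unfolding vertex_norm_def by (rule expectation_pmf_of_set_eq_avg[OF finV])
  show ?thesis
  proof
    show "V' \<subseteq> V x"
      by (auto simp: V'_def)
    have "vertex_norm (V x) g (V x) = avg (V x) (\<lambda>v. g {v})"
      unfolding norm by (intro avg_cong) auto
    moreover have "avg (V x) (\<lambda>v. g {v}) = avg (V x) (\<lambda>v. indicator V' v * g {v} + g {v} * of_bool (v \<notin> V'))"
      by (intro avg_cong) (auto simp: indicator_def)
    then have "avg (V x) (\<lambda>v. g {v}) = vertex_norm (V x) g V' + avg (V x) (\<lambda>v. g {v} * of_bool (v \<notin> V'))"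
      by (simp add: avg_add norm)
    moreover have "p {x} / 2 \<le> avg (V x) (\<lambda>v. g {v})"
    proof -
      have "\<epsilon> * p {x} \<le> 1 / 2 * p {x}"
        using \<open>\<epsilon> \<le> 1 / 2\<close> px by (rule mult_right_mono)
      then show ?thesis
        using vert by (auto simp: abs_le_iff)
    qed
    then have "\<eta> * (p {x} / 2) \<le> \<eta> * avg (V x) (\<lambda>v. g {v})"
      by (rule mult_left_mono[OF _ \<open>0 \<le> \<eta>\<close>])
    ultimately show "(1 - \<eta>) * vertex_norm (V x) g (V x) \<le> vertex_norm (V x) g V'"
      using lost by (simp add: algebra_simps)
    fix v assume v: "v \<in> V'"
    then have vx: "v \<in> V x" and okv: "\<And>Q. Q \<in> near \<Longrightarrow> ok v Q"
      by (auto simp: V'_def)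
    have bad': "clustered ?r Q" if "?B v Q \<noteq> {}" for Q
    proof -
      consider "Bad Q \<noteq> {}" | "Bad (insert x Q) \<noteq> {}" | "Q \<subseteq> nbrs x"
        using \<open>?B v Q \<noteq> {}\<close> unfolding next_bad_def by blast
      then show ?thesis
      proof cases
        case 2
        from bad[OF this] show ?thesis
          by (rule clustered_subset) auto
      next
        case 3
        from clustered_subset_nbrs[OF this] show ?thesis
          by (rule clustered_mono) simp
      qed (rule bad)
    qed
    have "mass V (link v g) Q (?B v Q) \<le> t Q * pin_wt ?p Q ?id" if Q: "Q \<subseteq> ?J" for Q
    proof (cases "Q \<in> near")
      case True
      then show ?thesis
        using okv by (simp add: ok_def)
    next
      case False
      have QJ: "finite Q" "Q \<subseteq> J"
        using Q fin by (auto intro: finite_subset)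
      show ?thesis
      proof (cases "clustered ?r Q")
        case True
        then have far: "Q \<noteq> {}" "x \<notin> (\<Union>q\<in>Q. nbhd ?r q)"
          using False Q by (auto simp: near_def)
        have "\<epsilon> * p {x} \<le> 1 * p {x}"
          using \<open>\<epsilon> \<le> 1 / 2\<close> px by (intro mult_right_mono) auto
        then have Z: "avg (V x) (\<lambda>v. g {v}) \<le> 2 * p {x}"
          using vert by (auto simp: abs_le_iff)
        have "1 \<le> ?r" by simp
        note eqs = next_mass_far[OF g p x vx Q QJ(1) far \<open>1 \<le> ?r\<close> bad Z]
        show ?thesis
          using mass[OF QJ(2)] eqs by (simp add: t_def)
      next
        case False
        then have "?B v Q = {}"
          using bad' by blast
        then show ?thesis
          using \<theta> adapted_density_nonneg(1)[OF p' Q] by (simp add: mass_def t_def)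
      qed
    qed
    then show "guarded \<theta> \<xi> c ?J V (link v g) ?p (?B v)"
      unfolding guarded_def t_def
      using fin g'[OF vx] p' bad' covered_next[OF g p x vx fin cov] by blast
  qed
qed

section \<open>The initial graph is guarded\<close>

text \<open>
  Representatives of all clustered complexes whose count can be influenced by pins on \<open>Q\<close>.
  Extensional labellings make this a finite set for \<open>Q \<noteq> {}\<close>.
\<close>

definition tests :: "nat \<Rightarrow> 'j set \<Rightarrow> 'j set \<Rightarrow> (nat \<times> (nat \<Rightarrow> 'j) \<times> nat set set) set" where
  "tests c J Q = {(n, \<pi>, E). n \<le> c \<and> \<pi> \<in> extensional {..<n} \<and> labelled_complex k J {..<n} \<pi> E \<and>
     clustered c (\<pi> ` {..<n}) \<and> Q \<subseteq> J \<inter> frontier (\<pi> ` {..<n})}"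

text \<open>
  The bound does not involve \<open>J\<close>, as all index sets of tests lie in a ball about an element of
  \<open>Q\<close>.
\<close>

lemma card_tests:
  assumes "Q \<noteq> {}"
  shows "finite (tests c J Q)"
    and "card (tests c J Q) \<le> (c + 1) * (((\<Delta> + 1) ^ (c + 1)) ^ c * 2 ^ (2 ^ c))"
proof -
  obtain q where q: "q \<in> Q"
    using assms by blast
  let ?N = "nbhd (c + 1) q" and ?m = "(\<Delta> + 1) ^ (c + 1)"
  let ?S = "SIGMA n:{..c}. PiE {..<n} (\<lambda>_. ?N) \<times> Pow (Pow {..<c})"
  have sub: "tests c J Q \<subseteq> ?S"
  proof
    fix T assume "T \<in> tests c J Q"
    then obtain n \<pi> E where T: "T = (n, \<pi>, E)" "n \<le> c" "\<pi> \<in> extensional {..<n}"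
      "labelled_complex k J {..<n} \<pi> E" "clustered c (\<pi> ` {..<n})" "Q \<subseteq> frontier (\<pi> ` {..<n})"
      by (auto simp: tests_def)
    have "\<pi> ` {..<n} \<subseteq> ?N"
      using clustered_near_frontier[OF T(5)] T(6) q by blast
    then have "\<pi> \<in> PiE {..<n} (\<lambda>_. ?N)"
      using T(3) by (auto simp: PiE_def)
    moreover have "e \<subseteq> {..<c}" if "e \<in> E" for e
      using labelled_complex_edgeD(1)[OF T(4) that] T(2) by auto
    ultimately show "T \<in> ?S"
      using T(1,2) by auto
  qed
  have finS: "finite ?S"
    using finite_nbhd by (intro finite_SigmaI finite_cartesian_product finite_PiE) auto
  then show "finite (tests c J Q)"
    using sub by (rule finite_subset[rotated])
  have "card (tests c J Q) \<le> card ?S"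
    using finS sub by (rule card_mono)
  also have "\<dots> = (\<Sum>n\<le>c. card ?N ^ n * 2 ^ (2 ^ c))"
    using finite_nbhd
    by (subst card_SigmaI) (auto simp: card_cartesian_product card_PiE card_Pow intro!: finite_PiE)
  also have "\<dots> \<le> (\<Sum>n\<le>c. ?m ^ c * 2 ^ (2 ^ c))"
  proof (intro sum_mono mult_right_mono)
    fix n assume "n \<in> {..c}"
    have "card ?N ^ n \<le> ?m ^ n"
      by (intro power_mono card_nbhd) simp
    also have "\<dots> \<le> ?m ^ c"
    proof (rule power_increasing)
      show "1 \<le> ?m"
        by (rule one_le_power) simp
    qed (use \<open>n \<in> {..c}\<close> in simp)
    finally show "card ?N ^ n \<le> ?m ^ c" .
  qed simp
  finally show "card (tests c J Q) \<le> (c + 1) * (?m ^ c * 2 ^ (2 ^ c))"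
    by simp
qed

text \<open>
  The union bound over the tests for \<open>Q\<close>, each of which fails on a set of small mass. The frontier
  of an index set of size at most \<open>c\<close> has at most \<open>\<Delta> * c\<close> elements, so the second moments need at
  most \<open>(\<Delta> + 2) * c\<close> vertices.
\<close>

lemma guarded_initially:
  fixes c :: nat
  defines "D \<equiv> (\<Delta> + 1) ^ (2 * (c + 2))"
    and "M \<equiv> (c + 1) * (((\<Delta> + 1) ^ (c + 1)) ^ c * 2 ^ (2 ^ c))"
  assumes fin: "finite J" and g: "adapted H J V g" and p: "adapted_density H J p"
    and ctrl: "controlled UNIV k J V g p \<epsilon> ((\<Delta> + 2) * c)"
    and \<theta>: "0 < \<theta>" "\<theta> \<le> 1" and \<xi>: "0 < \<xi>" and \<epsilon>: "0 \<le> \<epsilon>" "\<epsilon> \<le> \<xi>" "real M * (4 * \<epsilon> / \<xi>\<^sup>2) \<le> \<theta> ^ (D + 1)"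
  obtains Bad where "guarded \<theta> \<xi> c J V g p Bad"
proof -
  let ?id = "\<lambda>j. j :: 'j"
  define wrong where "wrong = (\<lambda>Q u (n, \<pi>, E). \<not> right_count \<xi> V g p Q u {..<n :: nat} \<pi> E)"
  define Bad where "Bad = (\<lambda>Q. {u \<in> PiE Q V. \<exists>T\<in>tests c J Q. wrong Q u T})"
  \<comment> \<open>The number of tests for the empty set is not bounded, but there is nothing to average: every
    test compares counts in the graph itself and succeeds.\<close>
  have Bad0: "Bad {} = {}"
  proof -
    have "\<not> wrong {} u T" if T: "T \<in> tests c J {}" for u T
    proof -
      obtain n \<pi> E where T': "T = (n, \<pi>, E)" "n \<le> c" "labelled_complex k J {..<n} \<pi> E"
        using T by (auto simp: tests_def)
      have "\<bar>ncount V g {..<n} \<pi> E - dens p \<pi> E\<bar> \<le> \<epsilon> * dens p \<pi> E"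
        using T' by (intro controlledD[OF ctrl]) auto
      also have "\<dots> \<le> \<xi> * dens p \<pi> E"
        using \<epsilon> dens_nonneg[OF p T'(3)] by (intro mult_right_mono)
      finally show ?thesis
        by (simp add: wrong_def T'(1) right_count_def)
    qed
    then show ?thesis
      by (auto simp: Bad_def)
  qed
  have clus: "clustered (c + 2) Q" if nonempty: "Bad Q \<noteq> {}" for Q
  proof -
    obtain T where "T \<in> tests c J Q"
      using nonempty unfolding Bad_def by blast
    moreover obtain n \<pi> E where "T = (n, \<pi>, E)"
      by (rule prod_cases3)
    ultimately have "(n, \<pi>, E) \<in> tests c J Q"
      by simp
    then show ?thesis
      by (intro clustered_frontier[of c "\<pi> ` {..<n}"]) (auto simp: tests_def)
  qed
  have "mass V g Q (Bad Q) \<le> \<theta> ^ (lev (c + 2) J Q + 1) * pin_wt p Q ?id" if Q: "Q \<subseteq> J" for Q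
  proof (cases "Bad Q = {}")
    case True
    then show ?thesis
      using \<theta> adapted_density_nonneg(1)[OF p Q] by (simp add: mass_def)
  next
    case False
    then have "Q \<noteq> {}"
      using Bad0 by auto
    note T = card_tests[OF this, of c J]
    have finQ: "finite Q"
      using Q fin by (rule finite_subset)
    have W: "0 \<le> pin_wt p Q ?id"
      by (rule adapted_density_nonneg(1)[OF p Q])
    have "mass V g Q (Bad Q) \<le> avg (PiE Q V) (\<lambda>u. \<Sum>T\<in>tests c J Q. pin_wt g Q u * of_bool (wrong Q u T))"
      unfolding mass_def
    proof (rule avg_mono)
      fix u assume u: "u \<in> PiE Q V"
      have nn: "0 \<le> pin_wt g Q u * of_bool (wrong Q u T)" for T
        using pin_wt_nonneg[OF g Q u] by simp
      show "pin_wt g Q u * of_bool (u \<in> Bad Q) \<le> (\<Sum>T\<in>tests c J Q. pin_wt g Q u * of_bool (wrong Q u T))"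
      proof (cases "u \<in> Bad Q")
        case True
        then obtain T where "T \<in> tests c J Q" "wrong Q u T"
          by (auto simp: Bad_def)
        then have "pin_wt g Q u * of_bool (u \<in> Bad Q) = pin_wt g Q u * of_bool (wrong Q u T)"
          using True by simp
        also have "\<dots> \<le> (\<Sum>T\<in>tests c J Q. pin_wt g Q u * of_bool (wrong Q u T))"
          using \<open>T \<in> tests c J Q\<close> by (rule member_le_sum) (use nn T(1) in simp_all)
        finally show ?thesis .
      next
        case False
        have "0 \<le> (\<Sum>T\<in>tests c J Q. pin_wt g Q u * of_bool (wrong Q u T))"
          by (intro sum_nonneg nn)
        then show ?thesis
          using False by simp
      qed
    qed
    also have "\<dots> = (\<Sum>T\<in>tests c J Q. avg (PiE Q V) (\<lambda>u. pin_wt g Q u * of_bool (wrong Q u T)))"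
      by (rule avg_sum)
    also have "\<dots> \<le> (\<Sum>T\<in>tests c J Q. 4 * \<epsilon> / \<xi>\<^sup>2 * pin_wt p Q ?id)"
    proof (rule sum_mono)
      fix T assume "T \<in> tests c J Q"
      then obtain n \<pi> E where T': "T = (n, \<pi>, E)" "n \<le> c" "labelled_complex k J {..<n} \<pi> E"
        "Q \<subseteq> frontier (\<pi> ` {..<n})"
        by (auto simp: tests_def)
      have disj: "Q \<inter> \<pi> ` {..<n} = {}"
        using T'(4) by (auto simp: frontier_def)
      have "card Q \<le> card (\<pi> ` {..<n}) * \<Delta>"
        by (rule card_frontier_le[OF _ T'(4)]) simp
      also have "\<dots> \<le> c * \<Delta>"
        using card_image_le[of "{..<n}" \<pi>] T'(2) by (intro mult_right_mono) auto
      finally have "card Q + 2 * card {..<n} \<le> (\<Delta> + 2) * c"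
        using T'(2) by (simp add: algebra_simps)
      from wrong_count_rare[OF g p ctrl T'(3) Q finQ disj this \<epsilon>(1) \<xi>]
      show "avg (PiE Q V) (\<lambda>u. pin_wt g Q u * of_bool (wrong Q u T)) \<le> 4 * \<epsilon> / \<xi>\<^sup>2 * pin_wt p Q ?id"
        by (simp add: wrong_def T'(1) right_count_def not_le)
    qed
    also have "\<dots> = real (card (tests c J Q)) * (4 * \<epsilon> / \<xi>\<^sup>2) * pin_wt p Q ?id"
      by simp
    also have "\<dots> \<le> real M * (4 * \<epsilon> / \<xi>\<^sup>2) * pin_wt p Q ?id"
      using T(2) W \<epsilon>(1) unfolding M_def by (intro mult_right_mono of_nat_mono) auto
    also have "\<dots> \<le> \<theta> ^ (D + 1) * pin_wt p Q ?id"
      using \<epsilon>(3) W by (rule mult_right_mono)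
    also have "\<dots> \<le> \<theta> ^ (lev (c + 2) J Q + 1) * pin_wt p Q ?id"
      using lev_le[OF clus[OF False], of J] \<theta> W unfolding D_def
      by (intro mult_right_mono power_decreasing) auto
    finally show ?thesis .
  qed
  moreover have "covered \<xi> c J V g p Bad"
    unfolding covered_def
  proof (intro allI impI, elim conjE)
    fix n :: nat and \<pi> :: "nat \<Rightarrow> 'j" and E Q u
    assume n: "n \<le> c" and Y: "labelled_complex k J {..<n} \<pi> E" and cl: "clustered c (\<pi> ` {..<n})"
      and Q: "Q \<subseteq> J \<inter> frontier (\<pi> ` {..<n})" and u: "u \<in> PiE Q V"
    let ?\<pi> = "restrict \<pi> {..<n}"
    have im: "?\<pi> ` e = \<pi> ` e" if "e \<subseteq> {..<n}" for e
      using that by (intro image_cong) auto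
    have inj: "inj_on ?\<pi> e = inj_on \<pi> e" if "e \<subseteq> {..<n}" for e
      using that by (intro inj_on_cong) auto
    note edge = labelled_complex_edgeD(1)[OF Y]
    have Y': "labelled_complex k J {..<n} ?\<pi> E"
      using Y im inj unfolding labelled_complex_def by (metis order_refl)
    have eqs: "ncount V h {..<n} ?\<pi> E = ncount V h {..<n} \<pi> E" "dens h' ?\<pi> E = dens h' \<pi> E" for h h'
    proof -
      show "ncount V h {..<n} ?\<pi> E = ncount V h {..<n} \<pi> E"
        by (rule ncount_cong) simp_all
      show "dens h' ?\<pi> E = dens h' \<pi> E"
        by (rule dens_cong) (simp only: im edge)
    qed
    show "right_count \<xi> V g p Q u {..<n} \<pi> E \<or> (\<exists>Q0\<subseteq>Q. restrict u Q0 \<in> Bad Q0)"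
    proof (rule disjCI)
      assume neg: "\<not> (\<exists>Q0\<subseteq>Q. restrict u Q0 \<in> Bad Q0)"
      have "(n, ?\<pi>, E) \<in> tests c J Q"
        using n Y' cl Q im[OF order_refl] by (auto simp: tests_def)
      moreover have "u \<notin> Bad Q"
        using neg u by (metis PiE_restrict order_refl)
      ultimately have "\<not> wrong Q u (n, ?\<pi>, E)"
        using u by (auto simp: Bad_def)
      then show "right_count \<xi> V g p Q u {..<n} \<pi> E"
        by (simp add: wrong_def right_count_def eqs)
    qed
  qed
  ultimately have "guarded \<theta> \<xi> c J V g p Bad"
    unfolding guarded_def using fin g p clus by blast
  then show thesis
    by (rule that)
qed

end

section \<open>From guarded graphs to typically hereditary counting\<close>

lemma ncount_singletons:
  assumes "\<And>e. e \<in> E \<Longrightarrow> e \<subseteq> Y"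
  shows "ncount (\<lambda>j. {j}) p Y \<pi> E = dens p \<pi> E"
proof -
  have "PiE Y (\<lambda>y. {\<pi> y}) = PiE Y (\<lambda>y. {restrict \<pi> Y y})"
    by (intro PiE_cong) simp
  also have "\<dots> = {restrict \<pi> Y}"
    by (rule PiE_singleton[OF restrict_extensional])
  finally have "ncount (\<lambda>j. {j}) p Y \<pi> E = (\<Prod>e\<in>E - {{}}. p (restrict \<pi> Y ` e))"
    by (simp add: ncount_def)
  also have "\<dots> = dens p \<pi> E"
    unfolding dens_def
  proof (intro prod.cong refl arg_cong[of _ _ p] image_cong)
    fix e y assume "e \<in> E - {{}}" "y \<in> e"
    then show "restrict \<pi> Y y = \<pi> y"
      using assms by auto
  qed
  finally show ?thesis .
qed

lemma count_in_eq:
  fixes Y :: "'a set" and V :: "'j \<Rightarrow> 'v set"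
  assumes Y: "labelled_complex k J Y \<pi> E" and X: "\<And>j. j \<in> J \<Longrightarrow> X j = {y \<in> Y. \<pi> y = j}"
    and V: "\<And>j. j \<in> J \<Longrightarrow> finite (V j) \<and> V j \<noteq> {}"
  shows "count_in J V g X E = g {} * ncount V g Y \<pi> E"
proof -
  have \<pi>: "\<pi> y \<in> J" if "y \<in> Y" for y
    using Y that by (auto simp: labelled_complex_def)
  have fin: "finite Y" "finite E" "{} \<in> E"
    using Y labelled_complex_finite[OF Y] by (simp_all add: labelled_complex_def)
  have UX: "(\<Union>j\<in>J. X j) = Y"
    using X \<pi> by auto
  have maps: "partite_maps J X V = PiE Y (\<lambda>y. V (\<pi> y))"
  proof -
    have "(\<forall>j\<in>J. \<phi> ` X j \<subseteq> V j) \<longleftrightarrow> (\<forall>y\<in>Y. \<phi> y \<in> V (\<pi> y))" for \<phi> :: "'a \<Rightarrow> 'v"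
      using X \<pi> by (simp add: image_subset_iff) blast
    then show ?thesis
      unfolding partite_maps_def UX by (auto simp: PiE_def Pi_def)
  qed
  have "finite (partite_maps J X V)" "partite_maps J X V \<noteq> {}"
    unfolding maps using fin V \<pi> by (auto simp: PiE_eq_empty_iff intro!: finite_PiE)
  then have "count_in J V g X E = avg (PiE Y (\<lambda>y. V (\<pi> y))) (\<lambda>\<phi>. \<Prod>e\<in>E. g (\<phi> ` e))"
    unfolding count_in_def maps by (rule expectation_pmf_of_set_eq_avg)
  also have "\<dots> = g {} * ncount V g Y \<pi> E"
    unfolding ncount_def avg_mult_left[symmetric] using fin
    by (intro avg_cong refl) (simp add: prod.remove)
  finally show ?thesis .
qed

lemma density_count_eq_dens:
  assumes Y: "labelled_complex k J Y \<pi> E" and X: "\<And>j. j \<in> J \<Longrightarrow> X j = {y \<in> Y. \<pi> y = j}"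
  shows "density_count J p X E = p {} * dens p \<pi> E"
  using count_in_eq[OF Y X, of "\<lambda>j. {j}" p] ncount_singletons[of E Y p \<pi>] labelled_complex_edgeD(1)[OF Y]
  by simp

lemma partite_complex_labelling:
  assumes "partite_complex k J X E"
  obtains \<pi> where "labelled_complex k J (\<Union>j\<in>J. X j) \<pi> E"
    "\<And>j. j \<in> J \<Longrightarrow> X j = {y \<in> (\<Union>j\<in>J. X j). \<pi> y = j}"
proof -
  let ?Y = "\<Union>j\<in>J. X j"
  define \<pi> where "\<pi> = (\<lambda>y. THE j. j \<in> J \<and> y \<in> X j)"
  have disj: "disjoint_family_on X J" and Y: "k_complex k ?Y E" and cr: "\<forall>e\<in>E. crossing J X e"
    using assms by (simp_all add: partite_complex_def)
  have \<pi>: "\<pi> y = j" if "j \<in> J" "y \<in> X j" for y j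
    unfolding \<pi>_def
  proof (rule the_equality)
    show "i = j" if "i \<in> J \<and> y \<in> X i" for i
      using disjoint_family_onD[OF disj, of i j] that \<open>j \<in> J\<close> \<open>y \<in> X j\<close> by auto
  qed (use that in simp)
  show ?thesis
  proof
    show X: "X j = {y \<in> ?Y. \<pi> y = j}" if "j \<in> J" for j
      using \<pi> that by auto
    have "inj_on \<pi> e" if "e \<in> E" for e
    proof (rule inj_onI)
      fix y z assume yz: "y \<in> e" "z \<in> e" "\<pi> y = \<pi> z"
      have e: "e \<subseteq> ?Y" "finite e"
        using Y that by (auto simp: k_complex_def intro: finite_subset)
      then obtain i j where "i \<in> J" "y \<in> X i" "j \<in> J" "z \<in> X j"
        using yz by blast
      then have "j \<in> J" "y \<in> e \<inter> X j" "z \<in> e \<inter> X j"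
        using \<pi> yz by auto
      moreover have "card (e \<inter> X j) \<le> Suc 0"
        using cr that \<open>j \<in> J\<close> by (auto simp: crossing_def)
      ultimately show "y = z"
        using e(2) by (auto simp: card_le_Suc0_iff_eq)
    qed
    then show "labelled_complex k J ?Y \<pi> E"
      using Y \<pi> by (auto simp: labelled_complex_def k_complex_def)
  qed
qed

lemma partite_complex_of_labelled:
  assumes "labelled_complex k J Y \<pi> E"
  shows "partite_complex k J (\<lambda>j. {y \<in> Y. \<pi> y = j}) E"
    and "num_vertices J (\<lambda>j. {y \<in> Y. \<pi> y = j}) = card Y"
proof -
  let ?X = "\<lambda>j. {y \<in> Y. \<pi> y = j}"
  have UX: "(\<Union>j\<in>J. ?X j) = Y"
    using assms by (auto simp: labelled_complex_def)
  then show "num_vertices J ?X = card Y"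
    by (simp add: num_vertices_def)
  have "crossing J ?X e" if "e \<in> E" for e
    unfolding crossing_def UX
  proof (intro conjI ballI)
    show "e \<subseteq> Y"
      by (rule labelled_complex_edgeD(1)[OF assms that])
    fix j
    have "card (e \<inter> ?X j) \<le> Suc 0"
      using labelled_complex_edgeD[OF assms that] by (subst card_le_Suc0_iff_eq) (auto dest: inj_onD)
    then show "card (e \<inter> ?X j) \<le> 1"
      by simp
  qed
  moreover have "disjoint_family_on ?X J"
    by (auto simp: disjoint_family_on_def)
  moreover have "k_complex k Y E"
    using assms by (simp add: k_complex_def labelled_complex_def)
  ultimately show "partite_complex k J ?X E"
    unfolding partite_complex_def UX by simp
qed

lemma controlled_of_approx_count:
  assumes V: "\<And>j. j \<in> J \<Longrightarrow> finite (V j) \<and> V j \<noteq> {}" and pos: "0 < g {}" "0 < p {}"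
    and approx: "\<And>(X :: 'j \<Rightarrow> nat set) E. partite_complex k J X E \<Longrightarrow> num_vertices J X \<le> K \<Longrightarrow>
      approx_count \<epsilon> J p V g X E"
  shows "controlled UNIV k J V g p \<epsilon> K"
  unfolding controlled_def
proof (intro allI impI)
  fix n :: nat and \<pi> :: "nat \<Rightarrow> 'j" and E
  assume n: "n \<le> K" and Y: "labelled_complex k J {..<n} \<pi> E"
  let ?X = "\<lambda>j. {y \<in> {..<n}. \<pi> y = j}"
  let ?n = "ncount V g {..<n} \<pi> E" and ?d = "dens p \<pi> E"
  have "approx_count \<epsilon> J p V g ?X E"
    using partite_complex_of_labelled[OF Y] n by (intro approx) simp_all
  moreover have "count_in J V g ?X E = g {} * ?n" "density_count J p ?X E = p {} * ?d"
    by (rule count_in_eq[OF Y _ V], simp, assumption) (rule density_count_eq_dens[OF Y], simp)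
  ultimately have "g {} * ((1 - \<epsilon>) * ?d) \<le> g {} * ?n" "g {} * ?n \<le> g {} * ((1 + \<epsilon>) * ?d)"
    using pos by (simp_all add: approx_count_def mult_ac)
  then have "(1 - \<epsilon>) * ?d \<le> ?n" "?n \<le> (1 + \<epsilon>) * ?d"
    unfolding mult_le_cancel_left_pos[OF pos(1)] .
  then show "\<bar>?n - ?d\<bar> \<le> \<epsilon> * ?d"
    by (auto simp: abs_le_iff algebra_simps)
qed

lemma approx_count_of_controlled:
  assumes ctrl: "controlled UNIV k J V g p \<epsilon> K" and V: "\<And>j. j \<in> J \<Longrightarrow> finite (V j) \<and> V j \<noteq> {}"
    and pos: "0 \<le> g {}" "0 < p {}" and p: "adapted_density H J p"
    and X: "partite_complex k J X E" "num_vertices J X \<le> K" and "0 \<le> \<eta>" "\<epsilon> \<le> \<eta>"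
  shows "approx_count (real (num_vertices J X) * \<eta>) J p V g X E"
proof -
  let ?Y = "\<Union>j\<in>J. X j"
  obtain \<pi> where Y: "labelled_complex k J ?Y \<pi> E" and \<pi>: "\<And>j. j \<in> J \<Longrightarrow> X j = {y \<in> ?Y. \<pi> y = j}"
    using partite_complex_labelling[OF X(1)] by blast
  let ?n = "ncount V g ?Y \<pi> E" and ?d = "dens p \<pi> E" and ?m = "real (num_vertices J X)"
  have d: "0 \<le> ?d"
    unfolding dens_def
    using adapted_densityD(1)[OF p] labelled_complex_edgeD(4)[OF Y] by (auto intro!: prod_nonneg)
  have eqs: "count_in J V g X E = g {} * ?n" "density_count J p X E = p {} * ?d"
    using count_in_eq[of k J ?Y \<pi> E X V g, OF Y \<pi> V] density_count_eq_dens[of k J ?Y \<pi> E X p, OF Y \<pi>]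
    by blast+
  have close: "\<bar>?n - ?d\<bar> \<le> ?m * \<eta> * ?d"
    \<comment> \<open>Without vertices no error is allowed, and none occurs; otherwise the factor
      \<open>num_vertices J X\<close> is at least one.\<close>
  proof (cases "num_vertices J X = 0")
    case True
    have "finite ?Y"
      using Y by (simp add: labelled_complex_def)
    then have "?Y = {}"
      using True by (simp add: num_vertices_def)
    moreover have "E = {{}}"
      using labelled_complex_edgeD(1)[OF Y] Y unfolding \<open>?Y = {}\<close> by (auto simp: labelled_complex_def)
    ultimately show ?thesis
      using True by simp
  next
    case False
    have "\<bar>?n - ?d\<bar> \<le> \<epsilon> * ?d"
      using X(2) by (intro controlledD[OF ctrl Y]) (auto simp: num_vertices_def)
    also have "\<epsilon> \<le> 1 * \<eta>"
      using assms by simp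
    also have "1 * \<eta> \<le> ?m * \<eta>"
      using False \<open>0 \<le> \<eta>\<close> by (intro mult_right_mono) auto
    finally show ?thesis
      using d by (simp add: mult_right_mono)
  qed
  then have "(1 - ?m * \<eta>) * ?d \<le> ?n" "?n \<le> (1 + ?m * \<eta>) * ?d"
    by (auto simp: abs_le_iff algebra_simps)
  then have "g {} * ((1 - ?m * \<eta>) * ?d) \<le> g {} * ?n" "g {} * ?n \<le> g {} * ((1 + ?m * \<eta>) * ?d)"
    using pos(1) by (auto intro: mult_left_mono)
  then show ?thesis
    unfolding approx_count_def eqs using pos(2) by (simp add: mult_ac)
qed

lemma partite_k_graph_link:
  assumes g: "partite_k_graph k J V g" and x: "x \<in> J" "v \<in> V x"
  shows "partite_k_graph k (J - {x}) V (link v g)"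
  unfolding partite_k_graph_def k_graph_def weighted_hypergraph_def
proof (intro conjI ballI allI impI)
  show "disjoint_family_on V (J - {x})"
    using g by (auto simp: partite_k_graph_def disjoint_family_on_def)
  show "finite (V j)" "V j \<noteq> {}" if "j \<in> J - {x}" for j
    using g that by (auto simp: partite_k_graph_def)
  have sub: "e \<subseteq> (\<Union>j\<in>J. V j)" "insert v e \<subseteq> (\<Union>j\<in>J. V j)" if "e \<subseteq> (\<Union>j\<in>J - {x}. V j)" for e
    using that x by auto
  show "0 \<le> link v g e" if "e \<subseteq> (\<Union>j\<in>J - {x}. V j)" for e
    using g sub[OF that] by (simp add: partite_k_graph_def k_graph_def weighted_hypergraph_def link_def)
  show "link v g e = 1" if e: "e \<subseteq> (\<Union>j\<in>J - {x}. V j) \<and> k + 1 \<le> card e" for e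
  proof -
    have "k + 1 \<le> card e" "k + 1 \<le> card (insert v e)"
      using e card_insert_le[of e v] by linarith+
    moreover have "e \<subseteq> (\<Union>j\<in>J. V j)" "insert v e \<subseteq> (\<Union>j\<in>J. V j)"
      using e sub by blast+
    ultimately show ?thesis
      using g by (simp add: partite_k_graph_def k_graph_def link_def)
  qed
qed

text \<open>
  All counts vanish, in the graph and in all links, so any density graph \<open>p\<close> will do and no vertex
  has to be excluded. This takes care of vertices of weight zero and thereby of vanishing
  densities.
\<close>

lemma THC_of_empty_weight_0:
  assumes "partite_k_graph k J V g" "g {} = 0" "0 \<le> \<eta>"
  shows "THC \<eta> c k J p V g"
  using assms(1,2)
proof (induction "card J" arbitrary: J g p rule: less_induct)
  case less
  note g = less.prems(1)
  have count: "count_in J V g X E = 0" if X: "partite_complex k J X E" for X :: "'a \<Rightarrow> nat set" and E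
  proof -
    obtain \<pi> where \<pi>: "labelled_complex k J (\<Union>j\<in>J. X j) \<pi> E"
      "\<And>j. j \<in> J \<Longrightarrow> X j = {y \<in> (\<Union>j\<in>J. X j). \<pi> y = j}"
      using partite_complex_labelling[OF X] by blast
    have "count_in J V g X E = g {} * ncount V g (\<Union>j\<in>J. X j) \<pi> E"
      using g by (intro count_in_eq[OF \<pi>]) (auto simp: partite_k_graph_def)
    then show ?thesis
      using less.prems(2) by simp
  qed
  have "\<exists>V'\<subseteq>V (Min J). vertex_norm (V (Min J)) g V' \<ge> (1 - \<eta>) * vertex_norm (V (Min J)) g (V (Min J)) \<and>
      (\<forall>v\<in>V'. THC \<eta> c k (J - {Min J}) (link (Min J) p) V (link v g))" if "2 \<le> card J"
  proof (intro exI[of _ "V (Min J)"] conjI ballI)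
    have "finite J" "J \<noteq> {}"
      using that by (auto intro: card_ge_0_finite)
    then have x: "Min J \<in> J"
      by (rule Min_in)
    have V: "finite (V (Min J))" "V (Min J) \<noteq> {}"
      using g x by (auto simp: partite_k_graph_def)
    have "0 \<le> g {v}" if "v \<in> V (Min J)" for v
    proof -
      have "{v} \<subseteq> (\<Union>j\<in>J. V j)"
        using x that by auto
      then show ?thesis
        using g by (simp add: partite_k_graph_def k_graph_def weighted_hypergraph_def)
    qed
    then have "0 \<le> vertex_norm (V (Min J)) g (V (Min J))"
      unfolding vertex_norm_def expectation_pmf_of_set_eq_avg[OF V]
      by (intro avg_nonneg) (simp add: indicator_def)
    then show "(1 - \<eta>) * vertex_norm (V (Min J)) g (V (Min J)) \<le> vertex_norm (V (Min J)) g (V (Min J))"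
      using \<open>0 \<le> \<eta>\<close> by (simp add: mult_left_le_one_le algebra_simps)
    fix v assume "v \<in> V (Min J)"
    then show "THC \<eta> c k (J - {Min J}) (link (Min J) p) V (link v g)"
      using less.prems card_Diff_Min_less[OF that] x
      by (intro less.hyps partite_k_graph_link) (auto simp: link_def)
  qed simp
  then show ?case
    using g count less.prems(2) by (subst THC.simps) (simp add: approx_count_def)
qed

text \<open>
  Each vertex \<open>v\<close> provided by \<open>guarded_next\<close> has a guarded link. If \<open>v\<close> has positive weight, then
  the density of \<open>x\<close> is positive, because the count of a single vertex is right; so the density
  graph of the link again has positive weight at the empty set.
\<close>

lemma THC_of_guarded:
  fixes \<Delta> k c :: nat and J :: "'j::linorder set" and H :: "'j set set"
  defines "D \<equiv> (\<Delta> + 1) ^ (2 * (c + 2))"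
  assumes H: "bounded_degree_complex H k \<Delta>"
    and guard: "bounded_degree_complex.guarded H k \<theta> \<xi> c J V g p Bad"
    and \<theta>: "0 < \<theta>" "\<theta> < 1" "2 ^ D * (22 * \<theta>) \<le> \<eta>" and \<eta>: "\<eta> \<le> 1"
    and \<xi>: "0 \<le> \<xi>" "\<xi> \<le> 1" "2 ^ c * \<xi> \<le> \<theta> ^ (D + 2)"
    and k: "1 \<le> k" "\<Delta> + 2 \<le> c"
    and g: "partite_k_graph k J V g" and pos: "0 < p {}" "0 < g {}"
  shows "THC \<eta> c k J p V g"
proof -
  interpret bounded_degree_complex H k \<Delta> by (rule H)
  have "\<theta> ^ (D + 2) \<le> \<theta>" "1 * (22 * \<theta>) \<le> 2 ^ D * (22 * \<theta>)"
    using \<theta> power_decreasing[of 1 "D + 2" \<theta>] by (simp_all add: mult_right_mono del: mult_1)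
  then have \<epsilon>: "2 ^ c * \<xi> \<le> \<eta>" "0 \<le> \<eta>" "2 ^ c * \<xi> \<le> 1"
    using \<theta> \<xi> by linarith+
  show ?thesis
    using guard g pos
  proof (induction "card J" arbitrary: J g p Bad rule: less_induct)
    case less
    note guard = less.prems(1) and gk = less.prems(2)
    have g: "adapted H J V g" and p: "adapted_density H J p"
      using guard by (simp_all add: guarded_def)
    have parts: "finite (V j) \<and> V j \<noteq> {}" if "j \<in> J" for j
      using g that by (simp add: adapted_def)
    have ctrl: "controlled UNIV k J V g p (2 ^ c * \<xi>) c"
      by (rule guarded_controlled[OF guard \<theta>(2) \<xi>(1,2)])
    have "approx_count (real (num_vertices J X) * \<eta>) J p V g X E"
      if "partite_complex k J X E" "num_vertices J X \<le> c" for X :: "'j \<Rightarrow> nat set" and E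
      using less.prems(3,4) that \<epsilon> by (intro approx_count_of_controlled[OF ctrl parts _ _ p]) auto
    moreover have "\<exists>V'\<subseteq>V (Min J). vertex_norm (V (Min J)) g V' \<ge> (1 - \<eta>) * vertex_norm (V (Min J)) g (V (Min J)) \<and>
      (\<forall>v\<in>V'. THC \<eta> c k (J - {Min J}) (link (Min J) p) V (link v g))" if J: "2 \<le> card J"
    proof -
      let ?x = "Min J"
      have "finite J" "J \<noteq> {}"
        using J by (auto intro: card_ge_0_finite)
      then have x: "?x \<in> J"
        by (rule Min_in)
      obtain V' where V': "V' \<subseteq> V ?x" "(1 - \<eta>) * vertex_norm (V ?x) g (V ?x) \<le> vertex_norm (V ?x) g V'"
        "\<And>v. v \<in> V' \<Longrightarrow> guarded \<theta> \<xi> c (J - {?x}) V (link v g) (link ?x p) (next_bad V g p ?x Bad v)"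
        using guarded_next[OF guard x \<theta>(1,2) _ \<eta> \<xi>(1,2) _ k] \<theta>(3) \<xi>(3) unfolding D_def by blast
      have "THC \<eta> c k (J - {?x}) (link ?x p) V (link v g)" if v: "v \<in> V'" for v
      \<comment> \<open>A vertex of weight zero costs nothing in the norm and may have been retained.\<close>
      proof (cases "g {v} = 0")
        case True
        then show ?thesis
          using V'(1) v \<epsilon>
          by (intro THC_of_empty_weight_0 partite_k_graph_link[OF gk x]) (auto simp: link_def)
      next
        case False
        have vx: "v \<in> V ?x"
          using V'(1) v by blast
        have g0: "0 \<le> g {w}" if "w \<in> V ?x" for w
        proof -
          have "{w} \<subseteq> \<Union> (V ` J)"
            using x that by auto
          then show ?thesis
            using g by (simp add: adapted_def)
        qed
        have "\<bar>avg (V ?x) (\<lambda>v. g {v}) - p {?x}\<bar> \<le> 2 ^ c * \<xi> * p {?x}"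
          using k by (intro controlled_vertex[OF ctrl _ _ x]) auto
        moreover have "avg (V ?x) (\<lambda>v. g {v}) \<noteq> 0"
          using avg_eq_0_D[of "V ?x" "\<lambda>v. g {v}" v] parts[OF x] g0 vx False by auto
        ultimately have "p {?x} \<noteq> 0"
          by auto
        moreover have "0 \<le> p {?x}"
          using adapted_densityD(1)[OF p, of "{?x}"] x by simp
        ultimately have "0 < link ?x p {}"
          using less.prems(3) by (simp add: link_def)
        moreover have "0 < link v g {}"
          using less.prems(4) False g0[OF vx] by (simp add: link_def)
        ultimately show ?thesis
          using V'(3)[OF v] partite_k_graph_link[OF gk x vx] card_Diff_Min_less[OF J]
          by (intro less.hyps) auto
      qed
      then show ?thesis
        using V' by (intro exI[of _ V']) auto
    qed
    ultimately show ?case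
      using gk by (subst THC.simps) blast
  qed
qed

lemma bounded_degree_complex_of_partite:
  fixes H :: "'j set set"
  assumes "finite J" and H: "partite_complex k J (\<lambda>j. {j}) H" and deg: "max_degree_le J (level 2 H) \<Delta>"
  shows "bounded_degree_complex H k \<Delta>"
proof
  have H': "\<And>e. e \<in> H \<Longrightarrow> e \<subseteq> J \<and> card e \<le> k" "\<And>e f. e \<in> H \<Longrightarrow> f \<subseteq> e \<Longrightarrow> f \<in> H"
    using H by (auto simp: partite_complex_def k_complex_def)
  show "finite e \<and> card e \<le> k" if "e \<in> H" for e
    using H'(1)[OF that] assms(1) by (auto intro: finite_subset)
  show "f \<in> H" if "e \<in> H" "f \<subseteq> e" for e f
    using H'(2) that .
  fix x
  let ?N = "{y. y \<noteq> x \<and> {x, y} \<in> H}"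
  have "?N \<subseteq> J"
    using H'(1) by blast
  then have fin: "finite ?N"
    using assms(1) by (rule finite_subset)
  have "card ?N \<le> \<Delta>"
  proof (cases "x \<in> J")
    case True
    have "(\<lambda>y. {x, y}) ` ?N \<subseteq> {e \<in> level 2 H. x \<in> e}"
      by (auto simp: level_def)
    moreover have inj: "inj_on (\<lambda>y. {x, y}) ?N"
      by (auto simp: inj_on_def doubleton_eq_iff)
    moreover have "finite {e \<in> level 2 H. x \<in> e}"
      by (rule finite_subset[of _ "Pow J"]) (use H'(1) assms(1) in \<open>auto simp: level_def\<close>)
    ultimately have "card ?N \<le> card {e \<in> level 2 H. x \<in> e}"
      by (intro card_inj_on_le[OF inj])
    then show ?thesis
      using deg True by (auto simp: max_degree_le_def)
  next
    case False
    then have "?N = {}"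
      using H'(1) by blast
    then show ?thesis
      by (simp only: card.empty)
  qed
  with fin show "finite ?N \<and> card ?N \<le> \<Delta>" ..
qed

theorem theorem3:
  fixes \<Delta> k c :: nat and \<eta>' :: real
  assumes "2 \<le> \<Delta>" and "2 \<le> k" and "\<Delta> + 2 \<le> c" and "0 < \<eta>'" and "\<eta>' < 1/2"
  shows "\<exists>\<eta>\<^sub>0>0. \<forall>\<eta>. 0 < \<eta> \<and> \<eta> < \<eta>\<^sub>0 \<longrightarrow>
    (\<forall>(J :: 'j::linorder set) (H :: 'j set set) (V :: 'j \<Rightarrow> 'v set)
        (\<gamma> :: 'v set \<Rightarrow> real) (p :: 'j set \<Rightarrow> real).
      finite J \<and>
      partite_complex k J (\<lambda>j. {j}) H \<and>
      max_degree_le J (level 2 H) \<Delta> \<and>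
      partite_k_graph k J V \<gamma> \<and>
      (\<forall>e. e \<subseteq> J \<and> e \<notin> H \<longrightarrow> (\<forall>s\<in>crossing_sets V e. \<gamma> s = 1)) \<and>
      density_k_graph k J p \<and>
      (\<forall>e. e \<subseteq> J \<and> e \<notin> H \<longrightarrow> p e = 1) \<and>
      (\<forall>(X :: 'j \<Rightarrow> nat set) F.
         partite_complex k J X F \<and> num_vertices J X \<le> (\<Delta> + 2) * c \<longrightarrow>
         approx_count \<eta> J p V \<gamma> X F)
      \<longrightarrow> THC \<eta>' c k J p V \<gamma>)"
proof -
  define D where "D = (\<Delta> + 1) ^ (2 * (c + 2))"
  define M where "M = (c + 1) * (((\<Delta> + 1) ^ (c + 1)) ^ c * 2 ^ (2 ^ c))"
  \<comment> \<open>A ball of radius \<open>2 * (c + 2)\<close> has at most \<open>D\<close> elements, and each nonempty set has at most \<open>M\<close>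
    tests. The constant \<open>\<theta>\<close> compensates for the \<open>2 ^ D\<close> sets near an index. The accuracy \<open>\<xi>\<close> is chosen
    such that counts are more precise than the smallest threshold \<open>\<theta> ^ (D + 1)\<close>, and \<open>\<eta>\<^sub>0\<close> such that
    all tests of accuracy \<open>\<xi>\<close> together fail only on a set of mass below this threshold.\<close>
  define \<theta> where "\<theta> = \<eta>' / (22 * 2 ^ D)"
  define \<xi> where "\<xi> = \<theta> ^ (D + 2) / 2 ^ c"
  define \<eta>\<^sub>0 where "\<eta>\<^sub>0 = min \<xi> (\<xi>\<^sup>2 * \<theta> ^ (D + 1) / (4 * real M))"
  have "0 < M"
    by (simp add: M_def)
  have \<theta>: "0 < \<theta>" "2 ^ D * (22 * \<theta>) \<le> \<eta>'"
    using assms by (simp_all add: \<theta>_def)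
  have "1 * (22 * \<theta>) \<le> 2 ^ D * (22 * \<theta>)"
    using \<theta> by (intro mult_right_mono) auto
  then have \<theta>1: "\<theta> < 1"
    using \<theta> assms by linarith
  have \<xi>: "0 < \<xi>" "2 ^ c * \<xi> \<le> \<theta> ^ (D + 2)"
    using \<theta> by (simp_all add: \<xi>_def)
  have "\<xi> \<le> 2 ^ c * \<xi>"
    using \<xi>(1) by simp
  also have "\<dots> \<le> 1"
    using \<xi>(2) power_le_one[of \<theta> "D + 2"] \<theta> \<theta>1 by linarith
  finally have "\<xi> \<le> 1" .
  have "0 < \<eta>\<^sub>0"
    using \<xi> \<theta> \<open>0 < M\<close> by (simp add: \<eta>\<^sub>0_def)
  have main: "THC \<eta>' c k J p V \<gamma>"
    if \<eta>: "0 < \<eta>" "\<eta> < \<eta>\<^sub>0" and "finite J" and H: "partite_complex k J (\<lambda>j. {j}) H"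
      and deg: "max_degree_le J (level 2 H) \<Delta>" and \<gamma>: "partite_k_graph k J V \<gamma>"
      and \<gamma>1: "\<forall>e. e \<subseteq> J \<and> e \<notin> H \<longrightarrow> (\<forall>s\<in>crossing_sets V e. \<gamma> s = 1)"
      and p: "density_k_graph k J p" and p1: "\<forall>e. e \<subseteq> J \<and> e \<notin> H \<longrightarrow> p e = 1"
      and approx: "\<forall>(X :: 'j \<Rightarrow> nat set) F.
         partite_complex k J X F \<and> num_vertices J X \<le> (\<Delta> + 2) * c \<longrightarrow> approx_count \<eta> J p V \<gamma> X F"
    for \<eta> and J :: "'j set" and H and V :: "'j \<Rightarrow> 'v set" and \<gamma> p
  proof (cases "\<gamma> {} = 0")
    case True
    then show ?thesis
      using \<gamma> assms by (intro THC_of_empty_weight_0) auto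
  next
    case False
    interpret bounded_degree_complex H k \<Delta>
      by (rule bounded_degree_complex_of_partite) fact+
    have pos: "0 < \<gamma> {}" "0 < p {}"
      using False \<gamma> p
      by (auto simp: partite_k_graph_def k_graph_def weighted_hypergraph_def density_k_graph_def
          order_less_le)
    have g: "adapted H J V \<gamma>"
      using \<gamma> \<gamma>1 by (auto simp: adapted_def partite_k_graph_def k_graph_def weighted_hypergraph_def)
    have pd: "adapted_density H J p"
      using p p1 by (auto simp: adapted_def density_k_graph_def partite_k_graph_def k_graph_def
          weighted_hypergraph_def crossing_sets_singletons)
    have ctrl: "controlled UNIV k J V \<gamma> p \<eta> ((\<Delta> + 2) * c)"
      using \<gamma> approx by (intro controlled_of_approx_count pos) (auto simp: partite_k_graph_def)
    have "\<eta> \<le> \<xi>" "\<eta> \<le> \<xi>\<^sup>2 * \<theta> ^ (D + 1) / (4 * real M)"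
      using \<eta> by (simp_all add: \<eta>\<^sub>0_def)
    moreover from this(2) have "real M * (4 * \<eta> / \<xi>\<^sup>2) \<le> \<theta> ^ (D + 1)"
      using \<xi>(1) \<open>0 < M\<close> by (simp add: field_simps)
    ultimately obtain Bad where "guarded \<theta> \<xi> c J V \<gamma> p Bad"
      using guarded_initially[OF \<open>finite J\<close> g pd ctrl \<theta>(1) less_imp_le[OF \<theta>1] \<xi>(1) less_imp_le[OF \<eta>(1)]]
      unfolding D_def M_def by blast
    then show ?thesis
      using \<theta> \<theta>1 \<xi> \<open>\<xi> \<le> 1\<close> assms \<gamma> pos unfolding D_def
      by (intro THC_of_guarded[OF bounded_degree_complex_axioms]) auto
  qed
  show ?thesis
    by (intro exI[of _ \<eta>\<^sub>0] conjI[OF \<open>0 < \<eta>\<^sub>0\<close>] allI impI, elim conjE) (rule main; assumption)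
qed

end
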